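(* Let $H$ be a finite, simple, connected graph. There are positive integer-valued functions $f,g,h$ of $(\varepsilon,H)$ such that for every $\varepsilon\in(0,1)$ and every planar graph $G$: if $G$ is $H$-free, then $\mathrm{RBE}(G,H,\varepsilon)$ accepts $G$; and if $G$ is $\varepsilon$-far from $H$-free, then $\mathrm{RBE}(G,H,\varepsilon)$ rejects $G$ with probability at least $0.99$.
   Context: Access to $G=(V,E)$, $V=\{1,\dots,n\}$, is via the random neighbor oracle: a query on vertex $v$ returns a uniformly random neighbor of $v$, independently of all other queries. Procedure $\mathrm{Traverse}(G,v,d,\ell)$: set $L_0=\{v\}$; for levels $j=1,\dots,\ell$, every $u\in L_{j-1}$ makes $d$ random neighbor queries, obtaining a set $\Gamma_u$, and the edges $(u,x)$, $x\in\Gamma_u$, are recorded; $L_j$ is the union of the $\Gamma_u$ minus the vertices in $L_0\cup\dots\cup L_{j-1}$; return the subgraph of $G$ formed by all recorded edges. $\mathrm{RLBFS}(G,d,\ell)$: pick $v\in V$ uniformly at random and run $\mathrm{Traverse}(G,v,d,\ell)$. Tester $\mathrm{RBE}(G,H,\varepsilon)$: repeat $f(\varepsilon,H)$ times: run $\mathrm{RLBFS}(G,h(\varepsilon,H),g(\varepsilon,H))$ and reject if the returned subgraph contains a (not necessarily induced) copy of $H$; if no repetition rejects, accept. $G$ is $H$-free if it contains no subgraph isomorphic to $H$; $G$ is $\varepsilon$-far from $H$-free if more than $\varepsilon|V|$ edges must be deleted from $G$ to make it $H$-free. *)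

theory Defs
  imports "HOL-Analysis.Analysis" "HOL-Probability.Probability"
begin

datatype 'a sgraph = SGraph (verts: "'a set") (edges: "'a set set")

definition simple_graph :: "'a sgraph \<Rightarrow> bool" where
  "simple_graph G \<longleftrightarrow> finite (verts G) \<and> (\<forall>e\<in>edges G. e \<subseteq> verts G \<and> card e = 2)"

definition neighbors :: "'a sgraph \<Rightarrow> 'a \<Rightarrow> 'a set" where
  "neighbors G u = {x. {u, x} \<in> edges G}"

text \<open>The graph without vertices is not regarded as connected.\<close>

definition connected_graph :: "'a sgraph \<Rightarrow> bool" where
  "connected_graph G \<longleftrightarrow> verts G \<noteq> {} \<and>
     (\<forall>u\<in>verts G. \<forall>v\<in>verts G. (u, v) \<in> {(x, y). {x, y} \<in> edges G}\<^sup>*)"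

definition subgraph :: "'a sgraph \<Rightarrow> 'a sgraph \<Rightarrow> bool" where
  "subgraph S G \<longleftrightarrow> simple_graph S \<and> verts S \<subseteq> verts G \<and> edges S \<subseteq> edges G"

definition isomorphic :: "'a sgraph \<Rightarrow> 'b sgraph \<Rightarrow> bool" where
  "isomorphic G H \<longleftrightarrow>
     (\<exists>\<phi>. bij_betw \<phi> (verts G) (verts H) \<and> edges H = (\<lambda>e. \<phi> ` e) ` edges G)"

definition contains_copy :: "'a sgraph \<Rightarrow> 'b sgraph \<Rightarrow> bool" where
  "contains_copy G H \<longleftrightarrow> (\<exists>S. subgraph S G \<and> isomorphic S H)"

definition H_free :: "'a sgraph \<Rightarrow> 'b sgraph \<Rightarrow> bool" where
  "H_free G H \<longleftrightarrow> \<not> contains_copy G H"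

definition delete_edges :: "'a sgraph \<Rightarrow> 'a set set \<Rightarrow> 'a sgraph" where
  "delete_edges G D = SGraph (verts G) (edges G - D)"

definition far_from_H_free :: "real \<Rightarrow> 'a sgraph \<Rightarrow> 'b sgraph \<Rightarrow> bool" where
  "far_from_H_free \<epsilon> G H \<longleftrightarrow>
     (\<forall>D \<subseteq> edges G. H_free (delete_edges G D) H \<longrightarrow> real (card D) > \<epsilon> * real (card (verts G)))"

text \<open>Planarity is the existence of a topological drawing in the plane: the vertices are distinct
  points, each edge is an arc joining its two end points that avoids all other vertices, and two
  different arcs meet only in common end points.\<close>

definition planar :: "'a sgraph \<Rightarrow> bool" where
  "planar G \<longleftrightarrow> (\<exists>(p :: 'a \<Rightarrow> complex) (\<gamma> :: 'a set \<Rightarrow> real \<Rightarrow> complex).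
     inj_on p (verts G) \<and>
     (\<forall>e\<in>edges G. arc (\<gamma> e) \<and> {pathstart (\<gamma> e), pathfinish (\<gamma> e)} = p ` e \<and>
                   path_image (\<gamma> e) \<inter> p ` verts G = p ` e) \<and>
     (\<forall>e\<in>edges G. \<forall>e'\<in>edges G. e \<noteq> e' \<longrightarrow>
        path_image (\<gamma> e) \<inter> path_image (\<gamma> e') = p ` (e \<inter> e')))"

text \<open>The set of answers to \<open>d\<close> independent random neighbor queries on \<open>u\<close>. An isolated vertex has
  no neighbor to return, so queries on it yield nothing.\<close>

definition random_neighbors :: "'a sgraph \<Rightarrow> nat \<Rightarrow> 'a \<Rightarrow> 'a set pmf" where
  "random_neighbors G d u =
     (if neighbors G u = {} then return_pmf {}
      else map_pmf set (replicate_pmf d (pmf_of_set (neighbors G u))))"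

text \<open>In \<open>traverse_levels G d k S L R\<close>, \<open>k\<close> levels remain, \<open>L\<close> is the last level built, \<open>S\<close> is the
  union of all levels so far (including \<open>L\<close>), and \<open>R\<close> is the set of edges recorded so far.\<close>

fun traverse_levels ::
  "'a sgraph \<Rightarrow> nat \<Rightarrow> nat \<Rightarrow> 'a set \<Rightarrow> 'a set \<Rightarrow> 'a set set \<Rightarrow> 'a set set pmf" where
  "traverse_levels G d 0 S L R = return_pmf R"
| "traverse_levels G d (Suc k) S L R =
     bind_pmf (Pi_pmf L {} (random_neighbors G d)) (\<lambda>\<Gamma>.
       traverse_levels G d k (S \<union> (\<Union>u\<in>L. \<Gamma> u)) ((\<Union>u\<in>L. \<Gamma> u) - S)
         (R \<union> {{u, x} | u x. u \<in> L \<and> x \<in> \<Gamma> u}))"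

text \<open>The start vertex belongs to the returned subgraph even if it is isolated; this only matters
  for copies of the one-vertex graph.\<close>

definition traverse :: "'a sgraph \<Rightarrow> 'a \<Rightarrow> nat \<Rightarrow> nat \<Rightarrow> 'a sgraph pmf" where
  "traverse G v d l =
     map_pmf (\<lambda>R. SGraph (insert v (\<Union>R)) R) (traverse_levels G d l {v} {v} {})"

definition RLBFS :: "'a sgraph \<Rightarrow> nat \<Rightarrow> nat \<Rightarrow> 'a sgraph pmf" where
  "RLBFS G d l = bind_pmf (pmf_of_set (verts G)) (\<lambda>v. traverse G v d l)"

datatype verdict = Accept | Reject

definition RBE ::
  "(real \<Rightarrow> 'b sgraph \<Rightarrow> nat) \<Rightarrow> (real \<Rightarrow> 'b sgraph \<Rightarrow> nat) \<Rightarrow> (real \<Rightarrow> 'b sgraph \<Rightarrow> nat) \<Rightarrow>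
   'a sgraph \<Rightarrow> 'b sgraph \<Rightarrow> real \<Rightarrow> verdict pmf" where
  "RBE f g h G H \<epsilon> =
     map_pmf (\<lambda>Ss. if \<exists>S\<in>set Ss. contains_copy S H then Reject else Accept)
       (replicate_pmf (f \<epsilon> H) (RLBFS G (h \<epsilon> H) (g \<epsilon> H)))"

end

theory Submission imports Defs begin

text \<open>Planar graphs have no \<open>K6\<close> minor and therefore bounded weak coloring numbers: there is an ordering
  in which every vertex weakly reaches boundedly many vertices by short paths. If \<open>G\<close> is far from \<open>H\<close>-free, it
  has linearly many edge-disjoint copies of \<open>H\<close>; a random coloring and the pigeonhole principle make the vertices of
  each copy recognizable by their colors and let all copies meet the ordering in the same way. Discarding copies
  that are rare around one of their vertices leaves a family that a random exploration can follow: at a vertex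
  \<open>\<phi> a\<close> a constant fraction of the neighbors continues a copy that agrees with \<open>\<phi>\<close> on the weakly
  reachable part. The exploration may switch between copies all the time and still assembles a complete one, whose
  vertices are distinct because their colors are.\<close>

text \<open>The obstacle is that degrees are unbounded: a query at a vertex of large degree hits a
  prescribed neighbor only with small probability, so no fixed copy can be followed. Agreement on
  the ancestors is the compromise. It is little enough to be common: once the image of
  \<open>a\<close> is known, its ancestors have boundedly many possible images, so demanding a
  constant fraction of the neighbors at every vertex costs a small constant times the sum of the
  degrees, which is linear in the number of vertices. And it is enough for gluing: of two adjacent
  vertices of \<open>H\<close> one is an ancestor of the other, so every edge is controlled by one
  of the agreements. Edge-disjointness turns the number of agreeing copies into a number of distinct
  neighbors. \<open>K6\<close> is excluded instead of \<open>K5\<close> because six mutually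
  touching sets split into three and three, so that the nonplanarity of \<open>K33\<close> is all
  the topology that is required.\<close>

section \<open>Planar graphs have no K6 minor\<close>

text \<open>Let \<open>V\<close> be the side of the closed curve \<open>c1 \<union> c2\<close> that does not contain \<open>q\<close>. Along \<open>Z1\<close> one gets from
  \<open>q\<close> to \<open>c1\<close> and thence into \<open>V\<close> without meeting \<open>c2 \<union> K\<close>, and along \<open>Z2\<close> without meeting \<open>c1 \<union> K\<close>. By
  Janiszewski's theorem \<open>c1 \<union> c2 \<union> K\<close> does not separate \<open>q\<close> from \<open>V\<close>, although \<open>c1 \<union> c2\<close> does.\<close>

lemma crossing_connected_sets_intersect:
  fixes c1 c2 :: "real \<Rightarrow> complex"
  assumes c: "arc c1" "arc c2" "pathstart c1 = a" "pathfinish c1 = b" "pathstart c2 = a" "pathfinish c2 = b"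
    and c12: "path_image c1 \<inter> path_image c2 = {a, b}"
    and K: "compact K" "connected K" "K \<inter> (path_image c1 \<union> path_image c2) = {a, b}"
    and M: "connected M" "M \<inter> (path_image c1 \<union> path_image c2) = {}" "K - {a, b} \<subseteq> M" "q \<in> M"
    and Z1: "connected Z1" "q \<in> Z1" "Z1 \<inter> (path_image c2 \<union> K) = {}" "Z1 \<inter> path_image c1 \<noteq> {}"
    and Z2: "connected Z2" "q \<in> Z2" "Z2 \<inter> (path_image c1 \<union> K) = {}" "Z2 \<inter> path_image c2 \<noteq> {}"
  shows False
proof -
  define J where "J = path_image c1 \<union> path_image c2"
  define c where "c = c1 +++ reversepath c2"
  have "simple_path c"
    unfolding c_def using c c12
    by (intro simple_path_join_loop) (auto simp: arc_reversepath)
  moreover have "pathfinish c = pathstart c"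
    using c by (simp add: c_def)
  moreover have Jc: "path_image c = J"
    using c by (simp add: c_def J_def path_image_join)
  ultimately have J: "connected (inside J)" "connected (outside J)" "inside J \<inter> outside J = {}"
    "inside J \<union> outside J = - J" "frontier (inside J) = J" "frontier (outside J) = J"
    "inside J \<noteq> {}" "outside J \<noteq> {}" "open (inside J)" "open (outside J)"
    using Jordan_inside_outside[of c] by auto
  have sub: "C \<subseteq> inside J \<or> C \<subseteq> outside J" if "connected C" "C \<inter> J = {}" for C
  proof (rule ccontr)
    assume a: "\<not> ?thesis"
    have s: "C \<subseteq> inside J \<union> outside J"
      using that J(4) by auto
    then show False
      using connectedD[OF that(1) J(9,10) _ s] J(3) a by blast
  qed
  have "M \<subseteq> inside J \<or> M \<subseteq> outside J"
    using sub[OF M(1)] M(2) by (simp add: J_def)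
  then obtain V where V: "connected V" "V \<inter> M = {}" "frontier V = J" "V \<noteq> {}" "V \<inter> J = {}"
      "\<And>C. connected C \<Longrightarrow> C \<inter> J = {} \<Longrightarrow> C \<inter> V \<noteq> {} \<Longrightarrow> C \<subseteq> V"
  proof -
    assume hyp: "\<And>V. connected V \<Longrightarrow> V \<inter> M = {} \<Longrightarrow> frontier V = J \<Longrightarrow> V \<noteq> {} \<Longrightarrow> V \<inter> J = {} \<Longrightarrow> 
      (\<And>C. connected C \<Longrightarrow> C \<inter> J = {} \<Longrightarrow> C \<inter> V \<noteq> {} \<Longrightarrow> C \<subseteq> V) \<Longrightarrow> thesis"
    assume "M \<subseteq> inside J \<or> M \<subseteq> outside J"
    then show thesis
    proof
      assume "M \<subseteq> inside J"
      then show thesis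
        using J sub by (intro hyp[of "outside J"]) blast+
    next
      assume "M \<subseteq> outside J"
      then show thesis
        using J sub by (intro hyp[of "inside J"]) blast+
    qed
  qed
  have KV: "K \<inter> V = {}"
    using M(3) V(2,5) K(3) by (auto simp: J_def)
  \<comment> \<open>\<open>J\<close> is the frontier of \<open>V\<close>, so every ball around a
    point of \<open>Z\<close> on \<open>J\<close> contains points of \<open>V\<close>. A ball that
    avoids the closed set \<open>T\<close> joins \<open>Z\<close> to \<open>V\<close> off
    \<open>T\<close>.\<close>
  have reach: "connected_component (- T) q v"
    if T: "closed T" "V \<inter> T = {}" and Z: "connected Z" "q \<in> Z" "Z \<inter> T = {}" "x \<in> Z" "x \<in> J" and v: "v \<in> V" for T Z x v
  proof -
    have "x \<in> - T" "open (- T)"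
      using Z T by auto
    then obtain e where e: "e > 0" "ball x e \<subseteq> - T"
      using openE by blast
    have "x \<in> closure V"
      using Z(5) V(3) by (auto simp: frontier_def)
    then obtain y where y: "y \<in> V" "dist y x < e"
      using e(1) by (auto simp: closure_approachable)
    have "connected (Z \<union> ball x e)"
      using Z e by (intro connected_Un) auto
    then have "connected ((Z \<union> ball x e) \<union> V)"
      using V(1) y by (intro connected_Un[OF \<open>connected (Z \<union> ball x e)\<close>]) (auto simp: dist_commute)
    moreover have "(Z \<union> ball x e) \<union> V \<subseteq> - T"
      using e T Z by auto
    ultimately show ?thesis
      using Z(2) v unfolding connected_component_def by blast
  qed
  obtain v where v: "v \<in> V"
    using V(4) by auto
  have cl: "compact (path_image c1 \<union> K)" "compact (path_image c2 \<union> K)"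
    using K c by (auto intro!: compact_Un compact_path_image arc_imp_path)
  obtain x1 x2 where x: "x1 \<in> Z1" "x1 \<in> path_image c1" "x2 \<in> Z2" "x2 \<in> path_image c2"
    using Z1 Z2 by auto
  have 1: "connected_component (- (path_image c2 \<union> K)) q v"
    by (rule reach[OF _ _ Z1(1,2,3) x(1) _ v])
      (use cl x KV V(5) compact_imp_closed in \<open>auto simp: J_def\<close>)
  have 2: "connected_component (- (path_image c1 \<union> K)) q v"
    by (rule reach[OF _ _ Z2(1,2,3) x(3) _ v])
      (use cl x KV V(5) compact_imp_closed in \<open>auto simp: J_def\<close>)
  have "(path_image c1 \<union> K) \<inter> (path_image c2 \<union> K) = K"
    using c12 K(3) by auto
  then have "connected_component (- ((path_image c1 \<union> K) \<union> (path_image c2 \<union> K))) q v"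
    using Janiszewski[OF cl(1) compact_imp_closed[OF cl(2)] _ 2 1] K(2) by simp
  then obtain C where C: "connected C" "C \<subseteq> - ((path_image c1 \<union> K) \<union> (path_image c2 \<union> K))" "q \<in> C" "v \<in> C"
    by (auto simp: connected_component_def)
  then have "C \<subseteq> V"
    using v by (intro V(6)) (auto simp: J_def)
  then show False
    using C(3) M(4) V(2) by auto
qed

text \<open>An arc from \<open>w1\<close> to \<open>w2\<close> is cut at the point \<open>a\<close>
  where a path from \<open>w3\<close> first meets it. The arc runs in \<open>X\<close>,
  \<open>e1\<close>, \<open>e2\<close> and the path in \<open>X\<close>, \<open>e3\<close>, and
  different prongs meet only in \<open>X\<close>, so \<open>a\<close> lies in \<open>X\<close>.
  Stopping at the first meeting also keeps the third leg connected when \<open>a\<close> is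
  removed.\<close>

lemma tripod:
  fixes X :: "complex set"
  assumes X: "compact X" 
    and e: "compact e1" "compact e2" "compact e3"
    and pc: "path_connected (X \<union> e1 \<union> e2)" "path_connected (X \<union> e3)"
    and w: "w1 \<in> e1 - X" "w2 \<in> e2 - X" "w3 \<in> e3 - X"
    and d: "e1 \<inter> e2 \<subseteq> X" "e1 \<inter> e3 \<subseteq> X" "e2 \<inter> e3 \<subseteq> X"
  obtains a P1 P2 P3 where "a \<in> X" "path_connected P1" "path_connected P2" "connected P3"
    "compact P1" "compact P2" "compact P3" "connected (P3 - {a})"
    "a \<in> P1" "a \<in> P2" "a \<in> P3" "w1 \<in> P1" "w2 \<in> P2" "w3 \<in> P3"
    "P1 \<inter> P2 = {a}" "(P1 \<union> P2) \<inter> P3 = {a}"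
    "P1 \<subseteq> X \<union> e1 \<union> e2" "P2 \<subseteq> X \<union> e1 \<union> e2" "P3 \<subseteq> X \<union> e3"
proof -
  have "w1 \<noteq> w2"
    using w d by auto
  then obtain \<alpha> where \<alpha>: "arc \<alpha>" "path_image \<alpha> \<subseteq> X \<union> e1 \<union> e2" "pathstart \<alpha> = w1" "pathfinish \<alpha> = w2"
    using pc(1) w unfolding path_connected_arcwise by (metis DiffE UnCI)
  \<comment> \<open>Off \<open>X\<close> the arc would be split by the closed sets \<open>e1\<close>
    and \<open>e2\<close>, each of which contains one of its ends.\<close>
  have "\<exists>y. y \<in> path_image \<alpha> \<inter> X"
  proof (rule ccontr)
    assume "\<not> ?thesis"
    then have s: "path_image \<alpha> \<subseteq> e1 \<union> e2" "e1 \<inter> e2 \<inter> path_image \<alpha> = {}"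
      using \<alpha>(2) d(1) by auto
    have "w1 \<in> path_image \<alpha>" "w2 \<in> path_image \<alpha>"
      using \<alpha>(3,4) by auto
    then show False
      using connected_closedD[OF connected_path_image[OF arc_imp_path[OF \<alpha>(1)]] s(2,1)] w e
      by (auto dest: compact_imp_closed)
  qed
  then obtain y where y: "y \<in> path_image \<alpha>" "y \<in> X"
    by auto
  have w3: "w3 \<notin> path_image \<alpha>"
    using \<alpha>(2) w d by auto
  obtain \<beta> where \<beta>: "path \<beta>" "path_image \<beta> \<subseteq> X \<union> e3" "pathstart \<beta> = w3" "pathfinish \<beta> = y"
    using pc(2) w y unfolding path_connected_def by (metis DiffE UnCI)
  define T where "T = {t \<in> {0..1}. \<beta> t \<in> path_image \<alpha>}"
  have "compact T"
  proof -
    have "closed (path_image \<alpha>)"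
      using \<alpha>(1) by (simp add: arc_imp_path closed_path_image)
    then have "closedin (top_of_set {0..1}) ({0..1} \<inter> \<beta> -` path_image \<alpha>)"
      using \<beta>(1) by (intro continuous_closedin_preimage) (auto simp: path_def)
    moreover have "T = {0..1} \<inter> \<beta> -` path_image \<alpha>"
      by (auto simp: T_def)
    ultimately show ?thesis
      using closedin_compact[OF compact_Icc] by metis
  qed
  moreover have "1 \<in> T"
    using \<beta>(4) y by (auto simp: T_def pathfinish_def)
  ultimately obtain u where u: "u \<in> T" "\<And>t. t \<in> T \<Longrightarrow> u \<le> t"
    using compact_attains_inf[of T] by auto
  define a where "a = \<beta> u"
  have u01: "0 \<le> u" "u \<le> 1" and a: "a \<in> path_image \<alpha>"
    using u by (auto simp: T_def a_def)
  have "u \<noteq> 0"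
    using w3 a \<beta>(3) by (auto simp: a_def pathstart_def)
  have a\<beta>: "a \<in> path_image \<beta>"
    using u01 by (auto simp: a_def path_image_def)
  have aX: "a \<in> X"
    using a a\<beta> \<alpha>(2) \<beta>(2) d by blast
  obtain s where s: "s \<in> {0..1}" "\<alpha> s = a"
    using a by (auto simp: path_image_def)
  have c\<alpha>: "continuous_on {0..1} \<alpha>" and i\<alpha>: "inj_on \<alpha> {0..1}" and c\<beta>: "continuous_on {0..1} \<beta>"
    using \<alpha>(1) \<beta>(1) by (auto simp: arc_def path_def)
  define P1 P2 P3 where "P1 = \<alpha> ` {0..s}" and "P2 = \<alpha> ` {s..1}" and "P3 = \<beta> ` {0..u}"
  have co: "continuous_on {0..s} \<alpha>" "continuous_on {s..1} \<alpha>" "continuous_on {0..u} \<beta>"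
    using continuous_on_subset[OF c\<alpha>, of "{0..s}"] continuous_on_subset[OF c\<alpha>, of "{s..1}"]
      continuous_on_subset[OF c\<beta>, of "{0..u}"] s u01 by simp_all
  have pcI: "path_connected {x..y}" for x y :: real
    by (simp add: convex_imp_path_connected)
  have i: "path_connected P1" "path_connected P2" "path_connected P3" "compact P1" "compact P2" "compact P3"
    unfolding P1_def P2_def P3_def
    using co by (simp_all add: path_connected_continuous_image compact_continuous_image pcI)
  have P3a: "P3 - {a} = \<beta> ` {0..<u}"
  proof -
    have "\<beta> t \<noteq> a" if "t \<in> {0..<u}" for t
    proof
      assume "\<beta> t = a"
      then have "t \<in> T"
        using that a u01 by (simp add: T_def)
      then show False
        using u(2) that by force
    qed
    moreover have "t \<in> {0..<u}" if "t \<in> {0..u}" "\<beta> t \<noteq> a" for t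
      using that unfolding a_def by (metis atLeastAtMost_iff atLeastLessThan_iff order_le_less)
    moreover have "{0..<u} \<subseteq> {0..u}"
      by auto
    ultimately show ?thesis
      unfolding P3_def by blast
  qed
  have P12: "P1 \<subseteq> path_image \<alpha>" "P2 \<subseteq> path_image \<alpha>" "P3 \<subseteq> path_image \<beta>"
    using s u01 by (auto simp: P1_def P2_def P3_def path_image_def)
  have eqs: "w1 = \<alpha> 0" "w2 = \<alpha> 1" "w3 = \<beta> 0" "a = \<alpha> s" 
    using \<alpha> \<beta> s by (auto simp: pathstart_def pathfinish_def)
  have mem: "w1 \<in> P1" "w2 \<in> P2" "w3 \<in> P3" "a \<in> P1" "a \<in> P2"
    unfolding P1_def P2_def P3_def eqs by (rule imageI; use s u01 in simp)+
  have mem3: "a \<in> P3"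
    unfolding P3_def a_def by (rule imageI; use s u01 in simp)
  show thesis
  proof (rule that[of a P1 P2 P3])
    show "connected (P3 - {a})"
      unfolding P3a using u01
      by (intro connected_continuous_image continuous_on_subset[OF c\<beta>]) auto
    show "P1 \<inter> P2 = {a}"
    proof -
      have "{0..s} \<inter> {s..1} = {s}" "{0..s} \<subseteq> {0..1}" "{s..1} \<subseteq> {0..1}"
        using s(1) by auto
      then show ?thesis
        unfolding P1_def P2_def using inj_on_image_Int[OF i\<alpha>, of "{0..s}" "{s..1}"] s(2) by simp
    qed
    have only_a: "x = a" if "x \<in> P3" "x \<in> path_image \<alpha>" for x
    proof (rule ccontr)
      assume "x \<noteq> a"
      then have "x \<in> \<beta> ` {0..<u}"
        unfolding P3a[symmetric] using that(1) by simp
      then obtain t where t: "x = \<beta> t" "t \<in> {0..<u}"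
        by (rule imageE)
      then have "t \<in> T"
        using that u01 by (simp add: T_def)
      then show False
        using u(2)[of t] t(2) by simp
    qed
    show "(P1 \<union> P2) \<inter> P3 = {a}"
      using only_a P12 mem mem3 by blast
  qed (use i mem mem3 aX P12 \<alpha>(2) \<beta>(2) in \<open>auto intro: path_connected_imp_connected\<close>)
qed

lemma connected_Un3:
  assumes "connected S" "connected T" "connected U" "S \<inter> T \<noteq> {}" "T \<inter> U \<noteq> {}"
  shows "connected (S \<union> T \<union> U)"
  by (rule connected_Un[OF connected_Un[OF assms(1,2,4)] assms(3)]) (use assms(5) in auto)

lemma path_connected_Un3:
  assumes "path_connected S" "path_connected T" "path_connected U" "S \<inter> T \<noteq> {}" "T \<inter> U \<noteq> {}"
  shows "path_connected (S \<union> T \<union> U)"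
  by (rule path_connected_Un[OF path_connected_Un[OF assms(1,2,4)] assms(3)]) (use assms(5) in auto)

text \<open>After \<open>A 0\<close> and \<open>A 1\<close> are replaced by tripods with hubs
  \<open>a\<close> and \<open>b\<close>, the three sets \<open>Y k\<close>, each passing through
  \<open>B k\<close>, join \<open>a\<close> to \<open>b\<close> and meet only there.
  \<open>A 2\<close> is attached to all three. This is impossible: arcs in two of them form a closed
  curve, and the third serves as the set \<open>K\<close> of the crossing lemma.\<close>

lemma no_K33_connected_sets:
  fixes A B :: "nat \<Rightarrow> complex set" and E :: "nat \<Rightarrow> nat \<Rightarrow> complex set"
  assumes A: "\<And>i. i < 3 \<Longrightarrow> compact (A i)" "\<And>i. i < 3 \<Longrightarrow> path_connected (A i)"
    and B: "\<And>i. i < 3 \<Longrightarrow> compact (B i)" "\<And>i. i < 3 \<Longrightarrow> path_connected (B i)"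
    and E: "\<And>i j. i < 3 \<Longrightarrow> j < 3 \<Longrightarrow> compact (E i j)" "\<And>i j. i < 3 \<Longrightarrow> j < 3 \<Longrightarrow> path_connected (E i j)"
    and EA: "\<And>i j. i < 3 \<Longrightarrow> j < 3 \<Longrightarrow> E i j \<inter> A i \<noteq> {}"
    and EB: "\<And>i j. i < 3 \<Longrightarrow> j < 3 \<Longrightarrow> E i j \<inter> B j = {w i j}"
    and EA': "\<And>i i' j. i < 3 \<Longrightarrow> j < 3 \<Longrightarrow> i' < 3 \<Longrightarrow> i \<noteq> i' \<Longrightarrow> E i j \<inter> A i' = {}"
    and EB': "\<And>i j' j. i < 3 \<Longrightarrow> j < 3 \<Longrightarrow> j' < 3 \<Longrightarrow> j \<noteq> j' \<Longrightarrow> E i j \<inter> B j' = {}"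
    and AB: "\<And>i j. i < 3 \<Longrightarrow> j < 3 \<Longrightarrow> A i \<inter> B j = {}"
    and AA: "\<And>i j. i < 3 \<Longrightarrow> j < 3 \<Longrightarrow> i \<noteq> j \<Longrightarrow> A i \<inter> A j = {}"
    and BB: "\<And>i j. i < 3 \<Longrightarrow> j < 3 \<Longrightarrow> i \<noteq> j \<Longrightarrow> B i \<inter> B j = {}"
    and EE: "\<And>i j i' j'. i < 3 \<Longrightarrow> j < 3 \<Longrightarrow> i' < 3 \<Longrightarrow> j' < 3 \<Longrightarrow> (i, j) \<noteq> (i', j') \<Longrightarrow>
        E i j \<inter> E i' j' \<subseteq> (A i \<inter> A i') \<union> (B j \<inter> B j')"
  shows False
proof -
  have all3: "(\<forall>k<3. Q k) \<longleftrightarrow> Q 0 \<and> Q 1 \<and> Q (2::nat)" for Q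
    by (auto simp: numeral_3_eq_3 less_Suc_eq numeral_2_eq_2)
  have trip: "\<exists>a P. a \<in> A i \<and> path_connected (P 0) \<and> path_connected (P 1) \<and> connected (P 2) \<and> connected (P 2 - {a})
      \<and> (\<forall>k<3. compact (P k) \<and> a \<in> P k \<and> w i k \<in> P k \<and> P k \<subseteq> A i \<union> (\<Union>j\<in>{..<3}. E i j))
      \<and> (\<forall>k<3. \<forall>l<3. k \<noteq> l \<longrightarrow> P k \<inter> P l = {a} \<and> P k \<inter> B l = {})" if i: "i < 3" for i
  proof -
    have w: "w i j \<in> E i j - A i" if "j < 3" for j
      using EB[OF i that] AB[OF i that] by auto
    have pcu: "path_connected (A i \<union> E i j)" if "j < 3" for j
      using A(2)[OF i] E(2)[OF i that] EA[OF i that] by (intro path_connected_Un) auto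
    have pc2: "path_connected (A i \<union> E i 0 \<union> E i 1)"
      using pcu[of 0] E(2)[OF i, of 1] EA[OF i, of 1] by (intro path_connected_Un[OF pcu]) auto
    have EEi: "E i j \<inter> E i j' \<subseteq> A i" if "j < 3" "j' < 3" "j \<noteq> j'" for j j'
      using EE[OF i that(1) i that(2)] BB[OF that] that by auto
    have l: "(0::nat) < 3" "(1::nat) < 3" "(2::nat) < 3"
      by auto
    obtain a P0 P1 P2 where P: "a \<in> A i" "path_connected P0" "path_connected P1" "connected P2"
      "compact P0" "compact P1" "compact P2" "connected (P2 - {a})"
      "a \<in> P0" "a \<in> P1" "a \<in> P2" "w i 0 \<in> P0" "w i 1 \<in> P1" "w i 2 \<in> P2"
      "P0 \<inter> P1 = {a}" "(P0 \<union> P1) \<inter> P2 = {a}"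
      "P0 \<subseteq> A i \<union> E i 0 \<union> E i 1" "P1 \<subseteq> A i \<union> E i 0 \<union> E i 1" "P2 \<subseteq> A i \<union> E i 2"
      by (rule tripod[OF A(1)[OF i] E(1)[OF i l(1)] E(1)[OF i l(2)] E(1)[OF i l(3)] pc2 pcu[OF l(3)]
          w[OF l(1)] w[OF l(2)] w[OF l(3)] EEi[OF l(1,2)] EEi[OF l(1,3)] EEi[OF l(2,3)]]) auto
    define P where "P k = (if k = 0 then P0 else if k = 1 then P1 else P2)" for k :: nat
    have sub: "\<forall>k<3. P k \<subseteq> A i \<union> (\<Union>j\<in>{..<3}. E i j)"
      unfolding all3 using P(17-19) by (auto simp: P_def)
    have wP: "\<forall>k<3. w i k \<in> P k \<and> a \<in> P k \<and> compact (P k)"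
      unfolding all3 using P by (auto simp: P_def)
    have PP: "\<forall>k<3. \<forall>l<3. k \<noteq> l \<longrightarrow> P k \<inter> P l = {a}"
      unfolding all3 using P(9-11,15,16) by (auto simp: P_def)
    \<comment> \<open>A leg can enter \<open>B l\<close> only at \<open>w i l\<close>, which belongs
      to leg \<open>l\<close>. Two legs share only the hub, and the hub lies in
      \<open>A i\<close>.\<close>
    have "P k \<inter> B l = {}" if k: "k < 3" "l < 3" "k \<noteq> l" for k l
    proof (rule ccontr)
      assume "\<not> ?thesis"
      then obtain x where x: "x \<in> P k" "x \<in> B l"
        by auto
      then obtain j where j: "j < 3" "x \<in> E i j"
        using sub AB[OF i k(2)] k by blast
      then have "j = l"
        using EB'[OF i, of j l] k x by auto
      then have "x = w i l"
        using EB[OF i k(2)] j x by auto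
      then have "x = a"
        using wP PP k x by blast
      then show False
        using P(1) AB[OF i k(2)] x by auto
    qed
    then show ?thesis
      using P sub wP PP by (intro exI[of _ a] exI[of _ P]) (auto simp: P_def)
  qed
  obtain a P where P: "a \<in> A 0" "path_connected (P 0)" "path_connected (P 1)" "connected (P 2)" "connected (P 2 - {a})"
    "\<And>k. k < 3 \<Longrightarrow> compact (P k)" "\<And>k. k < 3 \<Longrightarrow> a \<in> P k" "\<And>k. k < 3 \<Longrightarrow> w 0 k \<in> P k"
    "\<And>k. k < 3 \<Longrightarrow> P k \<subseteq> A 0 \<union> (\<Union>j\<in>{..<3}. E 0 j)"
    "\<And>k l. k < 3 \<Longrightarrow> l < 3 \<Longrightarrow> k \<noteq> l \<Longrightarrow> P k \<inter> P l = {a}" "\<And>k l. k < 3 \<Longrightarrow> l < 3 \<Longrightarrow> k \<noteq> l \<Longrightarrow> P k \<inter> B l = {}"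
    using trip[of 0] by auto
  obtain b Q where Q: "b \<in> A 1" "path_connected (Q 0)" "path_connected (Q 1)" "connected (Q 2)" "connected (Q 2 - {b})"
    "\<And>k. k < 3 \<Longrightarrow> compact (Q k)" "\<And>k. k < 3 \<Longrightarrow> b \<in> Q k" "\<And>k. k < 3 \<Longrightarrow> w 1 k \<in> Q k"
    "\<And>k. k < 3 \<Longrightarrow> Q k \<subseteq> A 1 \<union> (\<Union>j\<in>{..<3}. E 1 j)"
    "\<And>k l. k < 3 \<Longrightarrow> l < 3 \<Longrightarrow> k \<noteq> l \<Longrightarrow> Q k \<inter> Q l = {b}" "\<And>k l. k < 3 \<Longrightarrow> l < 3 \<Longrightarrow> k \<noteq> l \<Longrightarrow> Q k \<inter> B l = {}"
    using trip[of 1] by auto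
  have meet: "x \<in> (\<Union>j\<in>{..<3}. B j)"
    if h: "x \<in> A i \<union> (\<Union>j\<in>{..<3}. E i j)" "x \<in> A i' \<union> (\<Union>j\<in>{..<3}. E i' j)" "i < 3" "i' < 3" "i \<noteq> i'" for x i i'
  proof -
    have n: "A i \<inter> A i' = {}"
      using AA h by simp
    have n1: "E i j \<inter> A i' = {}" "E i' j \<inter> A i = {}" if "j < 3" for j
      using EA'[of i j i'] EA'[of i' j i] that \<open>i < 3\<close> \<open>i' < 3\<close> \<open>i \<noteq> i'\<close> by simp_all
    have n2: "E i j \<inter> E i' j' \<subseteq> B j" if "j < 3" "j' < 3" for j j'
      using EE[of i j i' j'] n that \<open>i < 3\<close> \<open>i' < 3\<close> \<open>i \<noteq> i'\<close> by auto
    obtain j where j: "j < 3" "x \<in> E i j"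
      using h(1,2) n n1 by blast
    moreover obtain j' where "j' < 3" "x \<in> E i' j'"
      using h(1,2) n n1 by blast
    ultimately show ?thesis
      using n2 by blast
  qed
  have PQ: "P k \<inter> Q l = {}" if kl: "k < 3" "l < 3" "k \<noteq> l" for k l
  proof (rule ccontr)
    assume "\<not> ?thesis"
    then obtain x where x: "x \<in> P k" "x \<in> Q l"
      by auto
    then obtain j where j: "j < 3" "x \<in> B j"
      using meet[OF subsetD[OF P(9)[OF kl(1)] x(1)] subsetD[OF Q(9)[OF kl(2)] x(2)]] by auto
    then show False
      using P(11)[OF kl(1), of j] Q(11)[OF kl(2), of j] x kl by auto
  qed
  define R where "R j = A 2 \<union> E 2 j" for j
  have RE: "R j \<subseteq> A 2 \<union> (\<Union>j\<in>{..<3}. E 2 j)" if "j < 3" for j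
    using that by (auto simp: R_def)
  have PR: "P k \<inter> R l = {}" if kl: "k < 3" "l < 3" "k \<noteq> l" for k l
  proof (rule ccontr)
    assume "\<not> ?thesis"
    then obtain x where x: "x \<in> P k" "x \<in> R l"
      by auto
    then obtain j where j: "j < 3" "x \<in> B j"
      using meet[OF subsetD[OF P(9)[OF kl(1)] x(1)] subsetD[OF RE[OF kl(2)] x(2)]] by auto
    moreover have "R l \<inter> B j = {}" if "j \<noteq> l"
      using EB'[of 2 l j] AB[of 2 j] j that kl by (auto simp: R_def)
    ultimately show False
      using P(11)[OF kl(1), of j] x kl by auto
  qed
  have QR: "Q k \<inter> R l = {}" if kl: "k < 3" "l < 3" "k \<noteq> l" for k l
  proof (rule ccontr)
    assume "\<not> ?thesis"
    then obtain x where x: "x \<in> Q k" "x \<in> R l"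
      by auto
    then obtain j where j: "j < 3" "x \<in> B j"
      using meet[OF subsetD[OF Q(9)[OF kl(1)] x(1)] subsetD[OF RE[OF kl(2)] x(2)]] by auto
    moreover have "R l \<inter> B j = {}" if "j \<noteq> l"
      using EB'[of 2 l j] AB[of 2 j] j that kl by (auto simp: R_def)
    ultimately show False
      using Q(11)[OF kl(1), of j] x kl by auto
  qed
  have BR: "B k \<inter> R l = {}" if "k < 3" "l < 3" "k \<noteq> l" for k l
    using EB'[of 2 l k] AB[of 2 k] that by (auto simp: R_def)
  have aB: "a \<notin> B k" "b \<notin> B k" if "k < 3" for k
    using AB[of 0 k] AB[of 1 k] that P(1) Q(1) by auto
  have wB: "w i k \<in> B k" "w i k \<in> E i k" if "i < 3" "k < 3" for i k
    using EB[OF that] by auto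
  have "a \<noteq> b"
    using P(1) Q(1) AA[of 0 1] by auto
  define Y where "Y k = P k \<union> B k \<union> Q k" for k
  have PB: "P k \<inter> B k \<noteq> {}" "B k \<inter> Q k \<noteq> {}" "(P k - {a}) \<inter> B k \<noteq> {}" "B k \<inter> (Q k - {b}) \<noteq> {}"
    if "k < 3" for k
    using P(8)[OF that] Q(8)[OF that] wB[of 0 k] wB[of 1 k] aB[OF that] that by auto
  have pcY: "path_connected (Y k)" if "k = 0 \<or> k = 1" for k
    unfolding Y_def using that P(2,3) Q(2,3) PB(1,2)[of k] B(2)[of k]
    by (intro path_connected_Un3) auto
  have abY: "a \<in> Y k" "b \<in> Y k" if "k < 3" for k
    using that P(7) Q(7) by (auto simp: Y_def)
  \<comment> \<open>Outside \<open>B k\<close> the sets \<open>P k\<close> and \<open>Q k\<close>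
    are disjoint, so an arc avoiding \<open>B k\<close> would be split between them. The meeting
    with \<open>B k\<close> is what lets \<open>R k\<close> together with \<open>B k\<close> reach
    the curve.\<close>
  have arcY: "\<exists>g. arc g \<and> path_image g \<subseteq> Y k \<and> pathstart g = a \<and> pathfinish g = b \<and> path_image g \<inter> B k \<noteq> {}" 
    if k: "k = 0 \<or> k = 1" for k
  proof -
    obtain g where g: "arc g" "path_image g \<subseteq> Y k" "pathstart g = a" "pathfinish g = b"
      using pcY[OF k] abY[of k] k \<open>a \<noteq> b\<close> unfolding path_connected_arcwise by force
    have "path_image g \<inter> B k \<noteq> {}"
    proof
      assume n: "path_image g \<inter> B k = {}"
      have k3: "k < 3"
        using k by auto
      have "P k \<inter> Q k \<subseteq> B k"
        proof
        fix x assume x: "x \<in> P k \<inter> Q k"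
        then obtain j where "j < 3" "x \<in> B j"
          using meet[OF subsetD[OF P(9)[OF k3]] subsetD[OF Q(9)[OF k3]]] by auto
        then show "x \<in> B k"
          using P(11)[OF k3, of j] x by auto
      qed
      then have "P k \<inter> Q k \<inter> path_image g = {}" "path_image g \<subseteq> P k \<union> Q k"
        using n g(2) by (auto simp: Y_def)
      moreover have "a \<in> path_image g" "b \<in> path_image g"
        using g by auto
      ultimately show False
        using connected_closedD[OF connected_path_image[OF arc_imp_path[OF g(1)]], of "P k" "Q k"]
          P(6,7)[OF k3] Q(6,7)[OF k3] by (auto dest: compact_imp_closed)
    qed
    then show ?thesis
      using g by auto
  qed
  obtain c1 where c1: "arc c1" "path_image c1 \<subseteq> Y 0" "pathstart c1 = a" "pathfinish c1 = b" "path_image c1 \<inter> B 0 \<noteq> {}"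
    using arcY[of 0] by auto
  obtain c2 where c2: "arc c2" "path_image c2 \<subseteq> Y 1" "pathstart c2 = a" "pathfinish c2 = b" "path_image c2 \<inter> B 1 \<noteq> {}"
    using arcY[of 1] by auto
  have ab: "a \<in> path_image c1" "b \<in> path_image c1" "a \<in> path_image c2" "b \<in> path_image c2"
    using c1(3,4) c2(3,4) pathstart_in_path_image pathfinish_in_path_image by metis+
  have YY: "Y k \<inter> Y l \<subseteq> {a, b}" if "k < 3" "l < 3" "k \<noteq> l" for k l
  proof -
    have "B k \<inter> P l = {}" "B k \<inter> Q l = {}" "Q k \<inter> P l = {}"
      using P(11)[of l k] Q(11)[of l k] PQ[of l k] that by auto
    then show ?thesis
      using P(10,11)[OF that] Q(10,11)[OF that] BB[OF that] PQ[OF that]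
      by (simp add: Y_def Int_Un_distrib Int_Un_distrib2)
  qed
  have YR: "Y k \<inter> R l = {}" if "k < 3" "l < 3" "k \<noteq> l" for k l
    using PR[OF that] QR[OF that] BR[OF that] by (simp add: Y_def Int_Un_distrib2)
  have BY: "B k \<inter> Y l = {}" if "k < 3" "l < 3" "k \<noteq> l" for k l
  proof -
    have "B k \<inter> P l = {}" "B k \<inter> Q l = {}"
      using P(11)[of l k] Q(11)[of l k] that by auto
    then show ?thesis
      using BB[OF that] by (simp add: Y_def Int_Un_distrib)
  qed
  have cR: "connected (R k)" if "k < 3" for k
    using A(2)[of 2] E(2)[of 2 k] EA[of 2 k] that unfolding R_def
    by (intro connected_Un) (auto dest: path_connected_imp_connected)
  obtain q where q: "q \<in> A 2" "q \<in> E 2 2"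
    using EA[of 2 2] by auto
  have cB: "connected (B k)" if "k < 3" for k
    using B(2)[OF that] by (rule path_connected_imp_connected)
  have cRB: "connected (R k \<union> B k)" if "k < 3" for k
    using cR[OF that] cB[OF that] wB[of 2 k] that by (intro connected_Un) (auto simp: R_def)
  have cY: "connected (Y 2)"
    unfolding Y_def using P(4) Q(4) cB[of 2] PB[of 2]
    by (intro connected_Un3) auto
  have cY': "connected ((P 2 - {a}) \<union> B 2 \<union> (Q 2 - {b}))"
    using P(5) Q(5) cB[of 2] PB[of 2]
    by (intro connected_Un3) auto
  have cM: "connected ((P 2 - {a}) \<union> B 2 \<union> (Q 2 - {b}) \<union> R 2)"
    using cY' cR[of 2] wB[of 2 2] by (intro connected_Un[OF cY']) (auto simp: R_def)
  \<comment> \<open>\<open>R 0\<close> with \<open>B 0\<close> and \<open>R 1\<close> with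
    \<open>B 1\<close> lead from \<open>q\<close> to the two arcs, while \<open>R 2\<close> ties
    \<open>q\<close> to the third connection \<open>Y 2\<close> with its hubs removed.\<close>
  show False
  proof (rule crossing_connected_sets_intersect[OF c1(1) c2(1) c1(3,4) c2(3,4), where K = "Y 2" and q = q
        and M = "(P 2 - {a}) \<union> B 2 \<union> (Q 2 - {b}) \<union> R 2" and ?Z1.0 = "R 0 \<union> B 0" and ?Z2.0 = "R 1 \<union> B 1"])
    show "path_image c1 \<inter> path_image c2 = {a, b}"
      using ab c1(2) c2(2) YY[of 0 1] by auto
    show "Y 2 \<inter> (path_image c1 \<union> path_image c2) = {a, b}"
      using ab c1(2) c2(2) YY[of 2 0] YY[of 2 1] abY[of 2] by auto
    have "b \<notin> P 2" "a \<notin> Q 2"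
      using PQ[of 2 0] PQ[of 0 2] P(7)[of 0] Q(7)[of 0] by auto
    have M: "((P 2 - {a}) \<union> B 2 \<union> (Q 2 - {b})) \<subseteq> Y 2 - {a, b}"
      using \<open>b \<notin> P 2\<close> \<open>a \<notin> Q 2\<close> aB[of 2] by (auto simp: Y_def)
    show "((P 2 - {a}) \<union> B 2 \<union> (Q 2 - {b}) \<union> R 2) \<inter> (path_image c1 \<union> path_image c2) = {}"
    proof -
      have *: "(N \<union> R') \<inter> (C \<union> C') = {}"
        if "N \<subseteq> Z - D" "C \<subseteq> Z1" "C' \<subseteq> Z2" "Z \<inter> Z1 \<subseteq> D" "Z \<inter> Z2 \<subseteq> D" "Z1 \<inter> R' = {}" "Z2 \<inter> R' = {}"
        for N R' C C' Z Z1 Z2 D :: "complex set"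
        using that by blast
      show ?thesis
        by (rule *[OF M c1(2) c2(2) YY YY YR YR]) auto
    qed
    show "Y 2 - {a, b} \<subseteq> (P 2 - {a}) \<union> B 2 \<union> (Q 2 - {b}) \<union> R 2"
      by (auto simp: Y_def)
    show "(R 0 \<union> B 0) \<inter> (path_image c2 \<union> Y 2) = {}"
      using c2(2) YR[of 1 0] YR[of 2 0] BY[of 0 1] BY[of 0 2] by auto
    show "(R 1 \<union> B 1) \<inter> (path_image c1 \<union> Y 2) = {}"
      using c1(2) YR[of 0 1] YR[of 2 1] BY[of 1 0] BY[of 1 2] by auto
    show "compact (Y 2)"
      using P(6) Q(6) B(1) by (auto simp: Y_def intro!: compact_Un)
  qed (use c1 c2 cY cM cRB q in \<open>auto simp: R_def\<close>)
qed

section \<open>Minors as disjoint, connected, mutually touching vertex sets\<close>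

definition adj_within :: "'a sgraph \<Rightarrow> 'a set \<Rightarrow> ('a \<times> 'a) set" where
  "adj_within G A = {(x, y). x \<in> A \<and> y \<in> A \<and> {x, y} \<in> edges G}"

definition connected_within :: "'a sgraph \<Rightarrow> 'a set \<Rightarrow> bool" where
  "connected_within G A \<longleftrightarrow> A \<noteq> {} \<and> A \<subseteq> verts G \<and> (\<forall>u\<in>A. \<forall>v\<in>A. (u, v) \<in> (adj_within G A)\<^sup>*)"

definition touching :: "'a sgraph \<Rightarrow> 'a set \<Rightarrow> 'a set \<Rightarrow> bool" where
  "touching G A B \<longleftrightarrow> (\<exists>x\<in>A. \<exists>y\<in>B. {x, y} \<in> edges G)"

lemma adj_within_mono: "A \<subseteq> B \<Longrightarrow> adj_within G A \<subseteq> adj_within G B"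
  by (auto simp: adj_within_def)

lemma sym_adj_within: "(x, y) \<in> adj_within G A \<Longrightarrow> (y, x) \<in> adj_within G A"
  by (auto simp: adj_within_def insert_commute)

lemma touching_sym: "touching G A B \<Longrightarrow> touching G B A"
  unfolding touching_def by (metis insert_commute)

lemma simple_graph_finite_edges: "simple_graph G \<Longrightarrow> finite (edges G)"
  unfolding simple_graph_def by (meson PowI finite_Pow_iff finite_subset subsetI)

lemma simple_graph_edgeD: "simple_graph G \<Longrightarrow> {x, y} \<in> edges G \<Longrightarrow> x \<noteq> y \<and> x \<in> verts G \<and> y \<in> verts G"
  by (auto simp: simple_graph_def)

text \<open>The first three and the last three sets, thickened to unions of arcs, form a forbidden \<open>K33\<close>.\<close>

lemma planar_no_K6_minor:
  fixes C :: "nat \<Rightarrow> 'a set"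
  assumes G: "simple_graph G" "planar G"
    and C: "\<And>i. i < 6 \<Longrightarrow> connected_within G (C i)"
    and disj: "\<And>i j. i < 6 \<Longrightarrow> j < 6 \<Longrightarrow> i \<noteq> j \<Longrightarrow> C i \<inter> C j = {}"
    and touch: "\<And>i j. i < 6 \<Longrightarrow> j < 6 \<Longrightarrow> i \<noteq> j \<Longrightarrow> touching G (C i) (C j)"
  shows False
proof -
  obtain p :: "'a \<Rightarrow> complex" and \<gamma> :: "'a set \<Rightarrow> real \<Rightarrow> complex" where
    p: "inj_on p (verts G)" and
    drawing: "\<forall>e\<in>edges G. arc (\<gamma> e) \<and> {pathstart (\<gamma> e), pathfinish (\<gamma> e)} = p ` e \<and>
       path_image (\<gamma> e) \<inter> p ` verts G = p ` e" and
    meets: "\<forall>e\<in>edges G. \<forall>e'\<in>edges G. e \<noteq> e' \<longrightarrow> path_image (\<gamma> e) \<inter> path_image (\<gamma> e') = p ` (e \<inter> e')"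
    using G(2) unfolding planar_def by (elim exE conjE)
  have \<gamma>: "arc (\<gamma> e)" "path_image (\<gamma> e) \<inter> p ` verts G = p ` e" if "e \<in> edges G" for e
    using bspec[OF drawing that] by simp_all
  have \<gamma>\<gamma>: "path_image (\<gamma> e) \<inter> path_image (\<gamma> e') = p ` (e \<inter> e')"
    if "e \<in> edges G" "e' \<in> edges G" "e \<noteq> e'" for e e'
    using meets that by simp
  have fin: "finite (verts G)" "finite (edges G)"
    using G(1) simple_graph_finite_edges by (auto simp: simple_graph_def)
  have ev: "e \<subseteq> verts G" if "e \<in> edges G" for e
    using G(1) that by (auto simp: simple_graph_def)
  have pg: "p ` e \<subseteq> path_image (\<gamma> e)" if "e \<in> edges G" for e
    using \<gamma>(2)[OF that] by auto
  have p\<gamma>: "v \<in> e" if "e \<in> edges G" "v \<in> verts G" "p v \<in> path_image (\<gamma> e)" for e v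
  proof -
    have "p v \<in> p ` e"
      using \<gamma>(2)[OF that(1)] that by auto
    then show ?thesis
      using p that ev[OF that(1)] by (auto simp: inj_on_def)
  qed
  \<comment> \<open>The drawing of the subgraph induced by \<open>A\<close>. It inherits
    connectedness from \<open>A\<close>, and disjoint vertex sets have disjoint drawings.\<close>
  define X where "X A = p ` A \<union> (\<Union>e\<in>{e \<in> edges G. e \<subseteq> A}. path_image (\<gamma> e))" for A
  have pX: "p v \<in> X A" if "v \<in> A" for v A
    using that by (auto simp: X_def)
  have X_cpt: "compact (X A)" if "A \<subseteq> verts G" for A
    unfolding X_def using fin that \<gamma>(1)
    by (intro compact_Un compact_UN finite_imp_compact compact_path_image arc_imp_path)
       (auto intro: finite_subset)
  have pcg: "path_connected (path_image (\<gamma> e))" if "e \<in> edges G" for e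
    using \<gamma>(1)[OF that] by (simp add: arc_imp_path path_connected_path_image)
  have X_pc: "path_connected (X A)" if A: "connected_within G A" for A
  proof -
    have edge: "path_component (X A) x y" if "e \<in> edges G" "e \<subseteq> A" "x \<in> path_image (\<gamma> e)" "y \<in> path_image (\<gamma> e)" for e x y
    proof (rule path_component_of_subset)
      show "path_image (\<gamma> e) \<subseteq> X A"
        using that by (auto simp: X_def)
      show "path_component (path_image (\<gamma> e)) x y"
        using pcg[OF that(1)] that by (simp add: path_connected_component)
    qed
    have vert: "path_component (X A) (p u) (p v)" if "(u, v) \<in> (adj_within G A)\<^sup>*" "u \<in> A" for u v
      using that
    proof (induction rule: rtrancl_induct)
      case base
      then show ?case
        using pX by (intro path_component_refl)
    next
      case (step y z)
      have "path_component (X A) (p y) (p z)"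
        using step.hyps(2) pg[of "{y, z}"] by (intro edge[of "{y, z}"]) (auto simp: adj_within_def)
      then show ?case
        using step path_component_trans by metis
    qed
    obtain u where u: "u \<in> A"
      using A by (auto simp: connected_within_def)
    have "path_component (X A) (p u) x" if x: "x \<in> X A" for x
    proof (cases "x \<in> p ` A")
      case True
      then show ?thesis
        using A u vert by (auto simp: connected_within_def)
    next
      case False
      then obtain e where e: "e \<in> edges G" "e \<subseteq> A" "x \<in> path_image (\<gamma> e)"
        using x by (auto simp: X_def)
      have "e \<noteq> {}"
        using G(1) e(1) by (auto simp: simple_graph_def)
      then obtain v where v: "v \<in> e"
        by auto
      have "path_component (X A) (p u) (p v)"
        using A u v e vert by (auto simp: connected_within_def)
      moreover have "path_component (X A) (p v) x"
        using e v pg[OF e(1)] by (intro edge[OF e(1,2)]) auto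
      ultimately show ?thesis
        by (rule path_component_trans)
    qed
    then show ?thesis
      unfolding path_connected_component by (meson path_component_sym path_component_trans)
  qed
  have XX: "X A \<inter> X B = {}" if AB: "A \<inter> B = {}" "A \<subseteq> verts G" "B \<subseteq> verts G" for A B
  proof (rule ccontr)
    assume "\<not> ?thesis"
    then obtain x where x: "x \<in> X A" "x \<in> X B"
      by auto
    have pp: "x \<notin> p ` B" if "x \<in> p ` A" "A \<inter> B = {}" "A \<subseteq> verts G" "B \<subseteq> verts G" for A B
      using that inj_on_image_Int[OF p that(3,4)] by auto
    have pe: "x \<notin> path_image (\<gamma> e)" if "x \<in> p ` A" "A \<inter> B = {}" "A \<subseteq> verts G" "e \<in> edges G" "e \<subseteq> B" for A B e
      using that p\<gamma>[OF that(4)] by auto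
    have ee: "x \<notin> path_image (\<gamma> e')" if "x \<in> path_image (\<gamma> e)" "e \<in> edges G" "e' \<in> edges G" "e \<subseteq> A" "e' \<subseteq> B" for e e'
    proof -
      have "e \<inter> e' = {}" "e \<noteq> {}"
        using that AB G(1) by (auto simp: simple_graph_def)
      then show ?thesis
        using \<gamma>\<gamma>[OF that(2,3)] that(1) by auto
    qed
    show False
      using x pp[of A B] pe[of A B] pe[of B A] ee AB unfolding X_def by blast
  qed
  have eX: "path_image (\<gamma> e) \<inter> X A = p ` (e \<inter> A)" if "e \<in> edges G" "\<not> e \<subseteq> A" "A \<subseteq> verts G" for e A
  proof
    show "p ` (e \<inter> A) \<subseteq> path_image (\<gamma> e) \<inter> X A"
      using pg[OF that(1)] by (auto simp: X_def)
    show "path_image (\<gamma> e) \<inter> X A \<subseteq> p ` (e \<inter> A)"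
    proof
      fix x assume x: "x \<in> path_image (\<gamma> e) \<inter> X A"
      show "x \<in> p ` (e \<inter> A)"
      proof (cases "x \<in> p ` A")
        case True
        then show ?thesis
          using p\<gamma>[OF that(1)] x that(3) by auto
      next
        case False
        then obtain e' where e': "e' \<in> edges G" "e' \<subseteq> A" "x \<in> path_image (\<gamma> e')"
          using x by (auto simp: X_def)
        then have "x \<in> p ` (e \<inter> e')"
          using \<gamma>\<gamma>[OF that(1) e'(1)] that(2) x by auto
        then show ?thesis
          using e' by auto
      qed
    qed
  qed
  have Cv: "C i \<subseteq> verts G" if "i < 6" for i
    using C[OF that] by (auto simp: connected_within_def)
  \<comment> \<open>One edge is selected for each of the nine pairs; its arc becomes
    \<open>E i j\<close>, and \<open>p (y i j)\<close> is its single contact with the drawing of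
    \<open>C (3 + j)\<close>.\<close>
  have "\<exists>x y. x \<in> C i \<and> y \<in> C (3 + j) \<and> {x, y} \<in> edges G" if "i < 3" "j < 3" for i j
    using touch[of i "3 + j"] that by (auto simp: touching_def)
  then obtain x y where xy: "\<And>i j. i < 3 \<Longrightarrow> j < 3 \<Longrightarrow> x i j \<in> C i \<and> y i j \<in> C (3 + j) \<and> {x i j, y i j} \<in> edges G"
    by metis
  have neq: "k = l" if "v \<in> C k" "v \<in> C l" "k < 6" "l < 6" for v k l
    using disj[of k l] that by auto
  have cap: "{x i j, y i j} \<inter> C k = (if k = i then {x i j} else if k = 3 + j then {y i j} else {})"
    if "i < 3" "j < 3" "k < 6" for i j k
    using xy[OF that(1,2)] neq[of _ k i] neq[of _ k "3 + j"] neq[of _ i "3 + j"] that by auto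
  have nsub: "\<not> {x i j, y i j} \<subseteq> C k" if "i < 3" "j < 3" "k < 6" for i j k
    using xy[OF that(1,2)] neq[of _ k i] neq[of _ k "3 + j"] that by auto
  have eXC: "path_image (\<gamma> {x i j, y i j}) \<inter> X (C k) = p ` (if k = i then {x i j} else if k = 3 + j then {y i j} else {})"
    if "i < 3" "j < 3" "k < 6" for i j k
    using eX[of "{x i j, y i j}" "C k"] nsub[OF that] xy[OF that(1,2)] Cv[OF that(3)] cap[OF that] by simp
  show False
  proof (rule no_K33_connected_sets[of "\<lambda>i. X (C i)" "\<lambda>j. X (C (3 + j))" "\<lambda>i j. path_image (\<gamma> {x i j, y i j})" "\<lambda>i j. p (y i j)"])
    fix i j i' j' :: nat
    assume ij: "i < 3" "j < 3" "i' < 3" "j' < 3" "(i, j) \<noteq> (i', j')"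
    have ne: "{x i j, y i j} \<noteq> {x i' j', y i' j'}"
    proof
      assume eq: "{x i j, y i j} = {x i' j', y i' j'}"
      have "i = i'"
        using cap[of i j i] cap[of i' j' i] ij unfolding eq by (auto split: if_splits)
      moreover have "j = j'"
        using cap[of i j "3 + j"] cap[of i' j' "3 + j"] ij unfolding eq by (auto split: if_splits)
      ultimately show False
        using ij by simp
    qed
    have "v \<in> C i \<inter> C i' \<union> C (3 + j) \<inter> C (3 + j')" if "v \<in> {x i j, y i j} \<inter> {x i' j', y i' j'}" for v
      using that xy[of i j] xy[of i' j'] ij neq[of v i "3 + j'"] neq[of v "3 + j" i'] by auto
    then have "p ` ({x i j, y i j} \<inter> {x i' j', y i' j'}) \<subseteq> X (C i) \<inter> X (C i') \<union> X (C (3 + j)) \<inter> X (C (3 + j'))"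
      using pX by blast
    then show "path_image (\<gamma> {x i j, y i j}) \<inter> path_image (\<gamma> {x i' j', y i' j'})
       \<subseteq> X (C i) \<inter> X (C i') \<union> X (C (3 + j)) \<inter> X (C (3 + j'))"
      using \<gamma>\<gamma>[OF _ _ ne] xy ij by auto
  qed (use X_cpt X_pc C Cv XX disj eXC xy pcg \<gamma>(1) in \<open>auto simp: arc_imp_path compact_path_image\<close>)
qed

section \<open>Weak coloring numbers\<close>

definition K6_minor_free :: "'a sgraph \<Rightarrow> bool" where
  "K6_minor_free G \<longleftrightarrow> \<not> (\<exists>C :: nat \<Rightarrow> 'a set. (\<forall>i<6. connected_within G (C i)) \<and>
     (\<forall>i<6. \<forall>j<6. i \<noteq> j \<longrightarrow> C i \<inter> C j = {} \<and> touching G (C i) (C j)))"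

lemma relpow_sym: "(x, y) \<in> R ^^ n \<Longrightarrow> (\<And>x y. (x, y) \<in> R \<Longrightarrow> (y, x) \<in> R) \<Longrightarrow> (y, x) \<in> R ^^ n"
proof (induction n arbitrary: y)
  case (Suc n)
  then obtain z where "(x, z) \<in> R ^^ n" "(z, y) \<in> R"
    by auto
  then show ?case
    using Suc by (meson relpow_Suc_I2)
qed auto

lemma rtrancl_sym: "(x, y) \<in> R\<^sup>* \<Longrightarrow> (\<And>x y. (x, y) \<in> R \<Longrightarrow> (y, x) \<in> R) \<Longrightarrow> (y, x) \<in> R\<^sup>*"
  using symD[OF sym_rtrancl[OF symI]] by metis

lemma rtrancl_adj_within_sym: "(x, y) \<in> (adj_within G A)\<^sup>* \<Longrightarrow> (y, x) \<in> (adj_within G A)\<^sup>*"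
  by (rule rtrancl_sym) (auto intro: sym_adj_within)

lemma rtrancl_adj_within_mono: "(x, y) \<in> (adj_within G A)\<^sup>* \<Longrightarrow> A \<subseteq> B \<Longrightarrow> (x, y) \<in> (adj_within G B)\<^sup>*"
  using rtrancl_mono[OF adj_within_mono] by blast

lemma relpow_add_trans: "(x, y) \<in> R ^^ a \<Longrightarrow> (y, z) \<in> R ^^ b \<Longrightarrow> (x, z) \<in> R ^^ (a + b)"
  by (auto simp: relpow_add)

lemma relpow_mono:
  fixes R S :: "('a \<times> 'a) set"
  shows "R \<subseteq> S \<Longrightarrow> R ^^ n \<subseteq> S ^^ n"
  by (induction n) (auto simp: relcomp_mono)

text \<open>\<open>X\<close> is the vertex set of a shortest walk from \<open>s\<close> to
  \<open>t\<close> inside \<open>A\<close>. Two of its vertices within distance \<open>r\<close> of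
  the same \<open>v\<close> are at distance at most \<open>2 * r\<close> from each other, so a
  larger gap between their positions would permit a shortcut.\<close>

lemma geodesic:
  assumes "(s, t) \<in> (adj_within G A)\<^sup>*"
  obtains X where "finite X" "s \<in> X" "t \<in> X" "\<And>x. x \<in> X \<Longrightarrow> (s, x) \<in> (adj_within G X)\<^sup>*"
    "\<And>x. x \<in> X \<Longrightarrow> (s, x) \<in> (adj_within G A)\<^sup>*"
    "\<And>v r. card {u \<in> X. \<exists>m\<le>r. (v, u) \<in> adj_within G A ^^ m} \<le> 2 * r + 1"
proof -
  define R where "R = adj_within G A"
  have sym: "(x, y) \<in> R \<Longrightarrow> (y, x) \<in> R" for x y
    by (auto simp: R_def intro: sym_adj_within)
  have ex: "\<exists>m. (s, t) \<in> R ^^ m"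
    using assms by (simp add: R_def rtrancl_power)
  define m where "m = (LEAST m. (s, t) \<in> R ^^ m)"
  have m: "(s, t) \<in> R ^^ m" and least: "\<And>k. (s, t) \<in> R ^^ k \<Longrightarrow> m \<le> k"
    using ex unfolding m_def by (auto intro: LeastI_ex Least_le)
  obtain f where f: "f 0 = s" "f m = t" "\<And>i. i < m \<Longrightarrow> (f i, f (Suc i)) \<in> R"
    using m unfolding relpow_fun_conv by auto
  have seg: "(f a, f (a + k)) \<in> R ^^ k" if "a + k \<le> m" for a k
    using that by (induction k) (auto intro!: relpow_Suc_I f(3))
  define X where "X = f ` {..m}"
  show thesis
  proof (rule that[of X])
    show "(s, x) \<in> (adj_within G X)\<^sup>*" if x: "x \<in> X" for x
    proof -
      have "(f 0, f k) \<in> (adj_within G X)\<^sup>*" if "k \<le> m" for k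
        using that
      proof (induction k)
        case (Suc k)
        have "(f k, f (Suc k)) \<in> adj_within G X"
          using f(3)[of k] Suc.prems by (auto simp: R_def adj_within_def X_def)
        then show ?case
          using Suc by (meson Suc_leD rtrancl.rtrancl_into_rtrancl)
      qed auto
      then show ?thesis
        using x f(1) by (auto simp: X_def)
    qed
    show "(s, x) \<in> (adj_within G A)\<^sup>*" if x: "x \<in> X" for x
    proof -
      obtain k where k: "k \<le> m" "x = f k"
        using x by (auto simp: X_def)
      have "(s, x) \<in> R ^^ k"
        using seg[of 0 k] k f(1) by simp
      then show ?thesis
        unfolding R_def by (rule relpow_imp_rtrancl)
    qed
    show "card {u \<in> X. \<exists>m\<le>r. (v, u) \<in> adj_within G A ^^ m} \<le> 2 * r + 1" for v r
    proof -
      define I where "I = {a \<in> {..m}. \<exists>k\<le>r. (v, f a) \<in> R ^^ k}"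
      have fI: "finite I"
        by (auto simp: I_def)
      have "I \<subseteq> {Min I..Min I + 2 * r}" if "I \<noteq> {}"
      proof
        fix a assume a: "a \<in> I"
        have "Min I \<in> I"
          using that fI by simp
        then obtain k0 where k0: "k0 \<le> r" "(v, f (Min I)) \<in> R ^^ k0" "Min I \<le> m"
          by (auto simp: I_def)
        obtain k where k: "k \<le> r" "(v, f a) \<in> R ^^ k" "a \<le> m"
          using a by (auto simp: I_def)
        have "(f 0, f (Min I)) \<in> R ^^ Min I" "(f a, f m) \<in> R ^^ (m - a)"
          using seg[of 0 "Min I"] seg[of a "m - a"] k0 k by auto
        moreover have "(f (Min I), v) \<in> R ^^ k0"
          using relpow_sym[OF k0(2)] sym by blast
        ultimately have "(f 0, f m) \<in> R ^^ (Min I + k0 + k + (m - a))"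
          using k(2) by (blast intro: relpow_add_trans)
        then have "m \<le> Min I + k0 + k + (m - a)"
          using least f by simp
        then show "a \<in> {Min I..Min I + 2 * r}"
          using k k0 a fI by auto
      qed
      then have "card I \<le> 2 * r + 1"
        using card_mono[of "{Min I..Min I + 2 * r}" I] by (cases "I = {}") auto
      moreover have "{u \<in> X. \<exists>m\<le>r. (v, u) \<in> adj_within G A ^^ m} = f ` I"
        by (auto simp: X_def I_def R_def)
      ultimately show ?thesis
        using card_image_le[OF fI, of f] by simp
    qed
  qed (use f in \<open>auto simp: X_def\<close>)
qed

text \<open>The parts \<open>0, \<dots>, i - 1\<close> have been split off, and \<open>pt\<close> has the value \<open>i\<close> on all remaining vertices. Thus
  the set of vertices with \<open>pt \<ge> j\<close> does not change any more once part \<open>j\<close> has been split off.\<close>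

definition partial_decomposition :: "'a sgraph \<Rightarrow> nat \<Rightarrow> ('a \<Rightarrow> nat) \<Rightarrow> bool" where
  "partial_decomposition G i pt \<longleftrightarrow>
     (\<forall>v\<in>verts G. pt v \<le> i) \<and>
     (\<forall>j<i. connected_within G {v \<in> verts G. pt v = j}) \<and>
     (\<forall>j<i. \<exists>S. finite S \<and> card S \<le> 4 \<and> (\<forall>v x w. v \<in> verts G \<longrightarrow> pt v = j \<longrightarrow> w \<in> verts G \<longrightarrow> pt w < j \<longrightarrow>
        (v, x) \<in> (adj_within G {u \<in> verts G. j \<le> pt u})\<^sup>* \<longrightarrow> {x, w} \<in> edges G \<longrightarrow> pt w \<in> S)) \<and>
     (\<forall>j<i. \<forall>r v. card {u \<in> verts G. pt u = j \<and> (\<exists>m\<le>r. (v, u) \<in> adj_within G {u \<in> verts G. j \<le> pt u} ^^ m)} \<le> 5 * (2 * r + 1)) \<and>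
     (\<forall>C j k. connected_within G C \<longrightarrow> C \<subseteq> {v \<in> verts G. pt v = i} \<longrightarrow> j < i \<longrightarrow> k < i \<longrightarrow> j \<noteq> k \<longrightarrow>
        touching G C {v \<in> verts G. pt v = j} \<longrightarrow> touching G C {v \<in> verts G. pt v = k} \<longrightarrow>
        touching G {v \<in> verts G. pt v = j} {v \<in> verts G. pt v = k})"

text \<open>Five of the sets \<open>Q j\<close> together with \<open>C\<close> would be the six
  branch sets of a \<open>K6\<close> minor. This four is the origin of the fives in the bound on
  weak reachability.\<close>

lemma card_parts_touching:
  assumes G: "K6_minor_free G"
    and Q: "\<And>j. j \<in> S \<Longrightarrow> connected_within G (Q j)" "\<And>j k. j \<in> S \<Longrightarrow> k \<in> S \<Longrightarrow> j \<noteq> k \<Longrightarrow> Q j \<inter> Q k = {}"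
      "\<And>j k. j \<in> S \<Longrightarrow> k \<in> S \<Longrightarrow> j \<noteq> k \<Longrightarrow> touching G (Q j) (Q k)"
    and C: "connected_within G C" "\<And>j. j \<in> S \<Longrightarrow> C \<inter> Q j = {}" "\<And>j. j \<in> S \<Longrightarrow> touching G C (Q j)"
    and "finite S"
  shows "card S \<le> 4"
proof (rule ccontr)
  assume "\<not> card S \<le> 4"
  then obtain T where T: "T \<subseteq> S" "card T = 5" "finite T"
    using obtain_subset_with_card_n[of 5 S] \<open>finite S\<close> by (metis finite_subset not_less_eq_eq numeral_eq_Suc pred_numeral_simps(3) semiring_norm(28) eval_nat_numeral(2) semiring_norm(26) semiring_norm(27))
  then obtain h where h: "bij_betw h {..<5::nat} T"
    using ex_bij_betw_nat_finite[of T] by (auto simp: atLeast0LessThan)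
  have hS: "h i \<in> S" if "i < 5" for i
    using h T that by (auto simp: bij_betw_def)
  have hinj: "h i \<noteq> h j" if "i < 5" "j < 5" "i \<noteq> j" for i j
    using h that by (auto simp: bij_betw_def inj_on_def)
  define D where "D i = (if i < 5 then Q (h i) else C)" for i
  have "connected_within G (D i)" if "i < 6" for i
    using Q(1) hS C(1) by (auto simp: D_def)
  moreover have "D i \<inter> D j = {} \<and> touching G (D i) (D j)" if "i < 6" "j < 6" "i \<noteq> j" for i j
  proof -
    consider "i < 5" "j < 5" | "i < 5" "j = 5" | "i = 5" "j < 5"
      using \<open>i < 6\<close> \<open>j < 6\<close> \<open>i \<noteq> j\<close> by linarith
    then show ?thesis
    proof cases
      case 1
      then show ?thesis
        using Q(2,3)[OF hS hS hinj] that by (simp add: D_def)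
    next
      case 2
      then show ?thesis
        using C(2,3)[OF hS[of i]] touching_sym by (auto simp: D_def)
    next
      case 3
      then show ?thesis
        using C(2,3)[OF hS[of j]] by (auto simp: D_def)
    qed
  qed
  ultimately show False
    using G unfolding K6_minor_free_def by blast
qed

lemma component_connected_within:
  assumes "s \<in> A" "A \<subseteq> verts G"
  shows "connected_within G {u. (s, u) \<in> (adj_within G A)\<^sup>*}" (is "connected_within G ?C")
proof -
  have sub: "?C \<subseteq> A"
  proof
    fix u assume "u \<in> ?C"
    then show "u \<in> A"
      using assms(1) by (auto elim: rtranclE simp: adj_within_def)
  qed
  have "(s, u) \<in> (adj_within G ?C)\<^sup>*" if "(s, u) \<in> (adj_within G A)\<^sup>*" for u
    using that
  proof (induction rule: rtrancl_induct)
    case (step y z)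
    then have "(y, z) \<in> adj_within G ?C"
      by (auto simp: adj_within_def intro: rtrancl.rtrancl_into_rtrancl)
    then show ?case
      using step by simp
  qed simp
  then have walk: "(s, u) \<in> (adj_within G ?C)\<^sup>*" if "u \<in> ?C" for u
    using that by simp
  have "(u, v) \<in> (adj_within G ?C)\<^sup>*" if "u \<in> ?C" "v \<in> ?C" for u v
    using rtrancl_trans[OF rtrancl_adj_within_sym[OF walk[OF that(1)]] walk[OF that(2)]] .
  moreover have "s \<in> ?C"
    by simp
  ultimately show ?thesis
    using sub assms(2) unfolding connected_within_def by blast
qed

text \<open>The new part lies in one component \<open>C\<close> of the remaining graph and consists of geodesics of \<open>C\<close>, one to
  each earlier part that touches \<open>C\<close>. These parts touch each other, so there are at most four of them.\<close>

lemma partial_decomposition_step: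
  assumes G: "simple_graph G" "K6_minor_free G" and dec: "partial_decomposition G i pt"
    and s: "s \<in> verts G" "pt s = i"
  obtains pt' where "partial_decomposition G (Suc i) pt'"
    "{v \<in> verts G. pt' v = Suc i} \<subset> {v \<in> verts G. pt v = i}"
proof -
  let ?V = "verts G" 
  define U where "U = {v \<in> ?V. pt v = i}"
  define P where "P j = {v \<in> ?V. pt v = j}" for j
  define R where "R = adj_within G U"
  define C where "C = {u. (s, u) \<in> R\<^sup>*}"
  have finV: "finite ?V"
    using G(1) by (simp add: simple_graph_def)
  have d1: "\<And>v. v \<in> ?V \<Longrightarrow> pt v \<le> i" and d2: "\<And>j. j < i \<Longrightarrow> connected_within G (P j)"
    and d3: "\<And>j. j < i \<Longrightarrow> \<exists>S. finite S \<and> card S \<le> 4 \<and> (\<forall>v x w. v \<in> verts G \<longrightarrow> pt v = j \<longrightarrow> w \<in> verts G \<longrightarrow> pt w < j \<longrightarrow>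
        (v, x) \<in> (adj_within G {u \<in> verts G. j \<le> pt u})\<^sup>* \<longrightarrow> {x, w} \<in> edges G \<longrightarrow> pt w \<in> S)"
    and d4: "\<And>j r v. j < i \<Longrightarrow> card {u \<in> verts G. pt u = j \<and> (\<exists>m\<le>r. (v, u) \<in> adj_within G {u \<in> verts G. j \<le> pt u} ^^ m)} \<le> 5 * (2 * r + 1)"
    and d5: "\<And>C j k. connected_within G C \<Longrightarrow> C \<subseteq> U \<Longrightarrow> j < i \<Longrightarrow> k < i \<Longrightarrow> j \<noteq> k \<Longrightarrow>
        touching G C (P j) \<Longrightarrow> touching G C (P k) \<Longrightarrow> touching G (P j) (P k)"
    using dec unfolding partial_decomposition_def P_def U_def by simp_all
  have sU: "s \<in> U"
    using s by (simp add: U_def)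
  have UV: "U \<subseteq> ?V"
    by (auto simp: U_def)
  have connC: "connected_within G C"
    using component_connected_within[OF sU UV] by (simp add: C_def R_def)
  have CU: "C \<subseteq> U"
  proof
    fix u assume "u \<in> C"
    then show "u \<in> U"
      using sU by (auto elim: rtranclE simp: C_def R_def adj_within_def)
  qed
  define S where "S = {j. j < i \<and> touching G C (P j)}"
  have finS: "finite S"
    by (simp add: S_def)
  \<comment> \<open>The last clause of the invariant exists for this purpose: applied to
    \<open>C\<close>, it makes all parts that touch \<open>C\<close> touch each other.\<close>
  have S4: "card S \<le> 4"
  proof (rule card_parts_touching[OF G(2), where Q = P and C = C])
    show "P j \<inter> P k = {}" if "j \<noteq> k" for j k
      using that by (auto simp: P_def)
    show "C \<inter> P j = {}" if "j \<in> S" for j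
      using that CU by (auto simp: P_def U_def S_def)
    show "touching G (P j) (P k)" if "j \<in> S" "k \<in> S" "j \<noteq> k" for j k
      using that d5[OF connC CU] by (auto simp: S_def)
  qed (use d2 connC finS in \<open>auto simp: S_def\<close>)
  have "\<exists>w. w \<in> C \<and> touching G {w} (P j)" if "j \<in> S" for j
    using that by (auto simp: S_def touching_def)
  then obtain w where w: "\<And>j. j \<in> S \<Longrightarrow> w j \<in> C \<and> touching G {w j} (P j)"
    by metis
  define geo where "geo j X \<longleftrightarrow> finite X \<and> s \<in> X \<and> w j \<in> X \<and> (\<forall>x\<in>X. (s, x) \<in> (adj_within G X)\<^sup>*) \<and>
      (\<forall>x\<in>X. (s, x) \<in> R\<^sup>*) \<and> (\<forall>v r. card {u \<in> X. \<exists>m\<le>r. (v, u) \<in> R ^^ m} \<le> 2 * r + 1)" for j X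
  have "\<exists>X. geo j X" if "j \<in> S" for j
  proof -
    have "(s, w j) \<in> (adj_within G U)\<^sup>*"
      using w[OF that] by (simp add: C_def R_def)
    then show ?thesis
    proof (rule geodesic)
      fix X assume X: "finite X" "s \<in> X" "w j \<in> X" "\<And>x. x \<in> X \<Longrightarrow> (s, x) \<in> (adj_within G X)\<^sup>*"
        "\<And>x. x \<in> X \<Longrightarrow> (s, x) \<in> (adj_within G U)\<^sup>*"
        "\<And>v r. card {u \<in> X. \<exists>m\<le>r. (v, u) \<in> adj_within G U ^^ m} \<le> 2 * r + 1"
      show ?thesis
        unfolding R_def geo_def by (intro exI[of _ X] conjI ballI allI X; assumption)
    qed
  qed
  then obtain g where "\<And>j. j \<in> S \<Longrightarrow> geo j (g j)"
    by metis
  then have g: "finite (g j)" "s \<in> g j" "w j \<in> g j" "\<And>x. x \<in> g j \<Longrightarrow> (s, x) \<in> (adj_within G (g j))\<^sup>*"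
      "\<And>x. x \<in> g j \<Longrightarrow> (s, x) \<in> R\<^sup>*" "\<And>v r. card {u \<in> g j. \<exists>m\<le>r. (v, u) \<in> R ^^ m} \<le> 2 * r + 1"
    if "j \<in> S" for j
    using that unfolding geo_def by simp_all
  \<comment> \<open>All geodesics start in \<open>s\<close>, which makes their union connected.
    Inserting \<open>s\<close> covers the case that \<open>C\<close> touches no earlier
    part.\<close>
  define X where "X = insert s (\<Union>j\<in>S. g j)"
  have XC: "X \<subseteq> C"
    using g(5) by (auto simp: X_def C_def)
  have finX: "finite X"
    using finS g(1) by (simp add: X_def)
  have Xs: "(s, x) \<in> (adj_within G X)\<^sup>*" if x: "x \<in> X" for x
  proof (cases "x = s")
    case False
    then obtain j where "j \<in> S" "x \<in> g j"
      using x by (auto simp: X_def)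
    then show ?thesis
      using g(4)[of j] by (intro rtrancl_adj_within_mono[of s x G "g j" X]) (auto simp: X_def)
  qed simp
  have connX: "connected_within G X"
    unfolding connected_within_def
  proof (intro conjI ballI)
    show "X \<noteq> {}" "X \<subseteq> ?V"
      using XC CU UV by (auto simp: X_def)
    show "(u, v) \<in> (adj_within G X)\<^sup>*" if "u \<in> X" "v \<in> X" for u v
      using rtrancl_trans[OF rtrancl_adj_within_sym[OF Xs[OF that(1)]] Xs[OF that(2)]] .
  qed
  \<comment> \<open>At most four geodesics contribute \<open>2 * r + 1\<close> vertices each; the
    extra vertex \<open>s\<close> is absorbed by a fifth such summand.\<close>
  have cardX: "card {u \<in> X. \<exists>m\<le>r. (v, u) \<in> R ^^ m} \<le> 5 * (2 * r + 1)" for v r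
  proof -
    let ?F = "\<lambda>Y. {u \<in> Y. \<exists>m\<le>r. (v, u) \<in> R ^^ m}"
    have "?F X \<subseteq> {s} \<union> (\<Union>j\<in>S. ?F (g j))"
      by (auto simp: X_def)
    then have "card (?F X) \<le> card ({s} \<union> (\<Union>j\<in>S. ?F (g j)))"
      using finS g(1) by (intro card_mono) auto
    also have "\<dots> \<le> card {s} + card (\<Union>j\<in>S. ?F (g j))"
      by (rule card_Un_le)
    also have "card (\<Union>j\<in>S. ?F (g j)) \<le> (\<Sum>j\<in>S. card (?F (g j)))"
      using finS by (rule card_UN_le)
    also have "\<dots> \<le> (\<Sum>j\<in>S. 2 * r + 1)"
      using g(6) by (intro sum_mono)
    also have "\<dots> \<le> 4 * (2 * r + 1)"
      using mult_right_mono[OF S4, of "2 * r + 1"] by simp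
    finally show ?thesis
      by simp
  qed
  \<comment> \<open>Everything in \<open>U\<close> outside \<open>X\<close> is moved on, including
    the components of \<open>U\<close> other than \<open>C\<close>.\<close>
  define pt' where "pt' v = (if v \<in> U - X then Suc i else pt v)" for v
  have XU: "X \<subseteq> U"
    using XC CU by auto
  have P': "{v \<in> ?V. pt' v = j} = P j" if "j < i" for j
    using that by (auto simp: pt'_def P_def U_def)
  have Pi: "{v \<in> ?V. pt' v = i} = X"
    using XU UV by (auto simp: pt'_def U_def)
  have PSi: "{v \<in> ?V. pt' v = Suc i} = U - X"
  proof -
    have "pt v \<noteq> Suc i" if "v \<in> ?V" for v
      using d1[OF that] by simp
    then show ?thesis
      using UV by (auto simp: pt'_def)
  qed
  have U': "{v \<in> ?V. j \<le> pt' v} = {v \<in> ?V. j \<le> pt v}" if "j \<le> i" for j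
    using that by (auto simp: pt'_def U_def)
  have Ui: "{v \<in> ?V. i \<le> pt v} = U"
    using d1 by (auto simp: U_def intro: le_antisym)
  have lt': "pt' v = pt v" if "pt' v < i \<or> pt v < i" for v
    using that by (auto simp: pt'_def U_def split: if_splits)
  have adjC: "C' \<subseteq> C" if C': "connected_within G C'" "C' \<subseteq> U" "touching G C' X" for C'
  proof
    fix u assume u: "u \<in> C'"
    obtain x y where xy: "x \<in> C'" "y \<in> X" "{x, y} \<in> edges G"
      using C'(3) by (auto simp: touching_def)
    have sy: "(s, y) \<in> R\<^sup>*"
      using XC xy by (auto simp: C_def)
    have yx: "(y, x) \<in> R"
      using xy XU C' by (auto simp: R_def adj_within_def insert_commute)
    have xu: "(x, u) \<in> R\<^sup>*"
      using C'(1) xy(1) u unfolding R_def connected_within_def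
      by (intro rtrancl_adj_within_mono[OF _ C'(2)]) auto
    show "u \<in> C"
      using rtrancl_trans[OF rtrancl.rtrancl_into_rtrancl[OF sy yx] xu] by (simp add: C_def)
  qed
  have touchX: "touching G X (P j)" if "j \<in> S" for j
    using g(3)[OF that] w[OF that] that by (auto simp: touching_def X_def)
  show thesis
  proof (rule that)
    show "{v \<in> verts G. pt' v = Suc i} \<subset> {v \<in> verts G. pt v = i}"
      unfolding PSi U_def[symmetric] using XU by (auto simp: X_def)
    show "partial_decomposition G (Suc i) pt'"
      unfolding partial_decomposition_def
    proof (intro conjI allI impI ballI)
      show "pt' v \<le> Suc i" if "v \<in> ?V" for v
        using d1[OF that] by (auto simp: pt'_def)
      fix j assume j: "j < Suc i"
      show "connected_within G {v \<in> ?V. pt' v = j}"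
        using j d2 P' Pi connX by (cases "j = i") auto
      show "card {u \<in> ?V. pt' u = j \<and> (\<exists>m\<le>r. (v, u) \<in> adj_within G {u \<in> ?V. j \<le> pt' u} ^^ m)} \<le> 5 * (2 * r + 1)" for r v
      proof (cases "j = i")
        case True
        have "{u \<in> ?V. pt' u = j \<and> (\<exists>m\<le>r. (v, u) \<in> R ^^ m)} = {u \<in> X. \<exists>m\<le>r. (v, u) \<in> R ^^ m}"
          using Pi True by blast
        then show ?thesis
          using cardX U'[of i] Ui True by (simp add: R_def)
      next
        case False
        then have "pt' u = j \<longleftrightarrow> pt u = j" for u
          using j by (auto simp: pt'_def U_def)
        then have "{u \<in> ?V. pt' u = j \<and> (\<exists>m\<le>r. (v, u) \<in> adj_within G {u \<in> ?V. j \<le> pt u} ^^ m)}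
          = {u \<in> ?V. pt u = j \<and> (\<exists>m\<le>r. (v, u) \<in> adj_within G {u \<in> ?V. j \<le> pt u} ^^ m)}"
          by simp
        then show ?thesis
          using d4[of j r v] U'[of j] j False by simp
      qed
      show "\<exists>S. finite S \<and> card S \<le> 4 \<and> (\<forall>v x w. v \<in> ?V \<longrightarrow> pt' v = j \<longrightarrow> w \<in> ?V \<longrightarrow> pt' w < j \<longrightarrow>
        (v, x) \<in> (adj_within G {u \<in> ?V. j \<le> pt' u})\<^sup>* \<longrightarrow> {x, w} \<in> edges G \<longrightarrow> pt' w \<in> S)"
      proof (cases "j = i")
        case True
        have "pt' z \<in> S" if v: "v \<in> ?V" "pt' v = i" and z: "z \<in> ?V" "pt' z < i"
          and x: "(v, x) \<in> (adj_within G {u \<in> ?V. i \<le> pt' u})\<^sup>*" "{x, z} \<in> edges G" for v x z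
        proof -
          have "v \<in> C"
            using v Pi XC by auto
          then have "x \<in> C"
            using x U'[of i] Ui by (auto simp: C_def R_def intro: rtrancl_trans)
          moreover have "z \<in> P (pt z)"
            using z by (simp add: P_def)
          ultimately have "touching G C (P (pt z))"
            using x by (auto simp: touching_def)
          then show ?thesis
            using lt'[of z] z by (simp add: S_def)
        qed
        then show ?thesis
          using True finS S4 by (intro exI[of _ S]) blast
      next
        case False
        then have j: "j < i"
          using j by simp
        obtain S' where S': "finite S'" "card S' \<le> 4" "\<And>v x w. v \<in> verts G \<Longrightarrow> pt v = j \<Longrightarrow> w \<in> verts G \<Longrightarrow> pt w < j \<Longrightarrow>
        (v, x) \<in> (adj_within G {u \<in> verts G. j \<le> pt u})\<^sup>* \<Longrightarrow> {x, w} \<in> edges G \<Longrightarrow> pt w \<in> S'"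
          using d3[OF j] by blast
        have "pt' z \<in> S'" if v: "v \<in> ?V" "pt' v = j" and z: "z \<in> ?V" "pt' z < j"
          and x: "(v, x) \<in> (adj_within G {u \<in> ?V. j \<le> pt' u})\<^sup>*" "{x, z} \<in> edges G" for v x z
          using S'(3)[of v z x] lt'[of v] lt'[of z] that U'[of j] j by simp
        then show ?thesis
          using S'(1,2) by (intro exI[of _ S']) blast
      qed
    next
      fix C' j k
      assume C': "connected_within G C'" "C' \<subseteq> {v \<in> ?V. pt' v = Suc i}" and jk: "j < Suc i" "k < Suc i" "j \<noteq> k"
        and t: "touching G C' {v \<in> ?V. pt' v = j}" "touching G C' {v \<in> ?V. pt' v = k}"
      have C'U: "C' \<subseteq> U"
        using C' PSi by auto
      \<comment> \<open>This restores the last clause. A connected set of remaining vertices that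
        touches \<open>X\<close> lies in \<open>C\<close>, so an earlier part touched by it is also
        touched by \<open>C\<close>, and one of the geodesics in \<open>X\<close> leads to that
        part.\<close>
      have key: "touching G X (P j)" if "touching G C' X" "touching G C' (P j)" "j < i" for j
      proof -
        have "touching G C (P j)"
          using adjC[OF C'(1) C'U that(1)] that(2) by (auto simp: touching_def)
        then show ?thesis
          using touchX that(3) by (simp add: S_def)
      qed
      consider "j < i" "k < i" | "j < i" "k = i" | "j = i" "k < i"
        using jk by linarith
      then show "touching G {v \<in> ?V. pt' v = j} {v \<in> ?V. pt' v = k}"
      proof cases
        case 1
        then show ?thesis
          using d5[OF C'(1) C'U 1 jk(3)] t P' by simp
      next
        case 2
        then show ?thesis
          using key[of j] t P' Pi touching_sym by auto
      next
        case 3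
        then show ?thesis
          using key[of k] t P' Pi by auto
      qed
    qed
  qed
qed


lemma exists_decomposition:
  assumes G: "simple_graph G" "K6_minor_free G"
  obtains i pt where "partial_decomposition G i pt" "\<And>v. v \<in> verts G \<Longrightarrow> pt v < i"
proof -
  have finV: "finite (verts G)"
    using G(1) by (simp add: simple_graph_def)
  have "\<exists>i pt. partial_decomposition G i pt \<and> (\<forall>v\<in>verts G. pt v < i)"
    if "partial_decomposition G i pt" for i pt
    using that
  proof (induction "card {v \<in> verts G. pt v = i}" arbitrary: i pt rule: less_induct)
    case less
    show ?case
    proof (cases "\<exists>s\<in>verts G. pt s = i")
      case True
      then obtain s where s: "s \<in> verts G" "pt s = i"
        by auto
      obtain pt' where pt': "partial_decomposition G (Suc i) pt'"
        "{v \<in> verts G. pt' v = Suc i} \<subset> {v \<in> verts G. pt v = i}"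
        using partial_decomposition_step[OF G less.prems s] by auto
      show ?thesis
        using less.hyps[OF _ pt'(1)] psubset_card_mono[OF _ pt'(2)] finV by auto
    next
      case False
      have "\<forall>v\<in>verts G. pt v \<le> i"
        using less.prems unfolding partial_decomposition_def by blast
      then show ?thesis
        using False less.prems by (metis le_neq_implies_less)
    qed
  qed
  moreover have "partial_decomposition G 0 (\<lambda>_. 0)"
    by (simp add: partial_decomposition_def)
  ultimately show thesis
    using that by blast
qed

section \<open>Weak reachability along the decomposition\<close>

definition weakly_reachable :: "'a sgraph \<Rightarrow> ('a \<Rightarrow> nat) \<Rightarrow> nat \<Rightarrow> 'a \<Rightarrow> 'a set" where
  "weakly_reachable G rk r v =
     {u \<in> verts G. \<exists>m\<le>r. (v, u) \<in> adj_within G {w \<in> verts G. rk u \<le> rk w} ^^ m}"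

text \<open>A path of length \<open>d\<close> that leaves part \<open>i\<close> towards smaller parts first enters one of the at most four parts
  in \<open>S i\<close>, so that it can only end in a part of \<open>ancestor_parts S d i\<close>.\<close>

fun ancestor_parts :: "(nat \<Rightarrow> nat set) \<Rightarrow> nat \<Rightarrow> nat \<Rightarrow> nat set" where
  "ancestor_parts S 0 i = {i}"
| "ancestor_parts S (Suc d) i = insert i (\<Union>j\<in>S i. ancestor_parts S d j)"

lemma ancestor_parts_self: "i \<in> ancestor_parts S d i"
  by (cases d) auto

lemma ancestor_parts_mono: "d \<le> d' \<Longrightarrow> ancestor_parts S d i \<subseteq> ancestor_parts S d' i"
proof (induction d arbitrary: d' i)
  case 0
  then show ?case
    using ancestor_parts_self by auto
next
  case (Suc d)
  then obtain d'' where "d' = Suc d''" "d \<le> d''"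
    by (metis Suc_le_D Suc_le_mono)
  then show ?case
    using Suc.IH by fastforce
qed

lemma card_ancestor_parts:
  assumes "\<And>i. finite (S i) \<and> card (S i) \<le> 4"
  shows "finite (ancestor_parts S d i) \<and> card (ancestor_parts S d i) \<le> 5 ^ d"
proof (induction d arbitrary: i)
  case (Suc d)
  have "card (ancestor_parts S (Suc d) i) \<le> Suc (card (\<Union>j\<in>S i. ancestor_parts S d j))"
    by (simp add: card_insert_le_m1 card_insert_if assms Suc)
  also have "card (\<Union>j\<in>S i. ancestor_parts S d j) \<le> (\<Sum>j\<in>S i. card (ancestor_parts S d j))"
    using assms by (intro card_UN_le) auto
  also have "\<dots> \<le> (\<Sum>j\<in>S i. 5 ^ d)"
    using Suc by (intro sum_mono) auto
  also have "\<dots> \<le> 4 * 5 ^ d"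
    using assms[of i] by simp
  also have "Suc (4 * 5 ^ d) \<le> 5 ^ Suc d"
    by simp
  finally show ?case
    using assms Suc by simp
qed simp

text \<open>Ranks compare parts first, so a vertex that is minimal on a walk of length at most
  \<open>r\<close> also lies in the smallest part on that walk. Each part is left downwards through
  at most four others, which admits at most \<open>5 ^ r\<close> parts, and in each of them the
  geodesics admit at most \<open>5 * (2 * r + 1)\<close> vertices. One ordering serves all
  radii.\<close>

theorem weak_coloring_number_bound:
  assumes G: "simple_graph G" "K6_minor_free G"
  obtains rk where "inj_on rk (verts G)"
    "\<And>r v. v \<in> verts G \<Longrightarrow> card (weakly_reachable G rk r v) \<le> 5 ^ r * (5 * (2 * r + 1))"
proof -
  let ?V = "verts G"
  have finV: "finite ?V"
    using G(1) by (simp add: simple_graph_def)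
  obtain i pt where dec: "partial_decomposition G i pt" and pt: "\<And>v. v \<in> ?V \<Longrightarrow> pt v < i"
    using exists_decomposition[OF G] by blast
  define U where "U j = {u \<in> ?V. j \<le> pt u}" for j
  have "\<exists>S. finite S \<and> card S \<le> 4 \<and> (\<forall>v x w. v \<in> ?V \<longrightarrow> pt v = j \<longrightarrow> w \<in> ?V \<longrightarrow> pt w < j \<longrightarrow>
      (v, x) \<in> (adj_within G (U j))\<^sup>* \<longrightarrow> {x, w} \<in> edges G \<longrightarrow> pt w \<in> S)" for j
  proof (cases "j < i")
    case True
    then show ?thesis
      using dec unfolding partial_decomposition_def U_def by simp
  next
    case False
    then show ?thesis
      using pt by (intro exI[of _ "{}"]) auto
  qed
  then obtain S where S: "\<And>j. finite (S j) \<and> card (S j) \<le> 4"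
    "\<And>j v x w. v \<in> ?V \<Longrightarrow> pt v = j \<Longrightarrow> w \<in> ?V \<Longrightarrow> pt w < j \<Longrightarrow>
      (v, x) \<in> (adj_within G (U j))\<^sup>* \<Longrightarrow> {x, w} \<in> edges G \<Longrightarrow> pt w \<in> S j"
    by metis
  have ball: "card {u \<in> ?V. pt u = j \<and> (\<exists>m\<le>r. (v, u) \<in> adj_within G (U j) ^^ m)} \<le> 5 * (2 * r + 1)" for j r v
  proof (cases "j < i")
    case True
    then show ?thesis
      using dec unfolding partial_decomposition_def U_def by simp
  next
    case False
    then have "{u \<in> ?V. pt u = j \<and> (\<exists>m\<le>r. (v, u) \<in> adj_within G (U j) ^^ m)} = {}"
      using pt by auto
    then show ?thesis
      by (simp only: card.empty)
  qed
  \<comment> \<open>Until its first step below \<open>pt v\<close> the walk stays in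
    \<open>U (pt v)\<close>, so this step enters a part in \<open>S (pt v)\<close>. The rest of the
    walk is shorter and is handled by induction.\<close>
  have anc: "pt u \<in> ancestor_parts S m (pt v)"
    if "(v, u) \<in> adj_within G (U (pt u)) ^^ m" "v \<in> ?V" for m u v
    using that
  proof (induction m arbitrary: v rule: less_induct)
    case (less m)
    obtain f where f: "f 0 = v" "f m = u" "\<And>k. k < m \<Longrightarrow> (f k, f (Suc k)) \<in> adj_within G (U (pt u))"
      using less.prems(1) unfolding relpow_fun_conv by auto
    have fU: "f k \<in> U (pt u)" if "k \<le> m" "m > 0" for k
      using that f(3)[of k] f(3)[of "k - 1"] by (cases "k = m") (auto simp: adj_within_def)
    show ?case
    proof (cases "m = 0 \<or> pt u = pt v")
      case True
      then show ?thesis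
        using less.prems ancestor_parts_self by auto
    next
      case False
      have "pt u < pt v"
        using fU[of 0] False f(1) by (auto simp: U_def)
      define s where "s = (LEAST k. pt (f k) < pt v)"
      have s: "pt (f s) < pt v"
        unfolding s_def by (rule LeastI[of _ m]) (use \<open>pt u < pt v\<close> f in simp)
      have least: "pt v \<le> pt (f k)" if "k < s" for k
        using not_less_Least[of k "\<lambda>k. pt (f k) < pt v"] that by (simp add: s_def)
      have "s \<le> m"
        unfolding s_def by (rule Least_le) (use \<open>pt u < pt v\<close> f in simp)
      have "s \<noteq> 0"
        using s f(1) by (metis less_irrefl)
      then obtain t where t: "s = Suc t"
        using not0_implies_Suc by auto
      have "(f 0, f k) \<in> (adj_within G (U (pt v)))\<^sup>*" if "k \<le> t" for k
        using that
      proof (induction k)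
        case (Suc k)
        then have "(f k, f (Suc k)) \<in> adj_within G (U (pt v))"
          using f(3)[of k] least[of k] least[of "Suc k"] t \<open>s \<le> m\<close> by (auto simp: adj_within_def U_def)
        then show ?case
          using Suc by (meson Suc_leD rtrancl.rtrancl_into_rtrancl)
      qed simp
      moreover have "{f t, f s} \<in> edges G"
        using f(3)[of t] t \<open>s \<le> m\<close> by (auto simp: adj_within_def)
      moreover have "f s \<in> ?V"
        using fU[of s] \<open>s \<le> m\<close> False by (auto simp: U_def)
      ultimately have "pt (f s) \<in> S (pt v)"
        using S(2)[OF less.prems(2) refl, of "f s" "f t"] s f(1) by auto
      moreover have "(f s, u) \<in> adj_within G (U (pt u)) ^^ (m - s)"
        unfolding relpow_fun_conv using f \<open>s \<le> m\<close>
        by (intro exI[of _ "\<lambda>k. f (s + k)"]) auto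
      then have "pt u \<in> ancestor_parts S (m - s) (pt (f s))"
        using less.IH[of "m - s" "f s"] \<open>s \<noteq> 0\<close> \<open>s \<le> m\<close> \<open>f s \<in> ?V\<close> by auto
      moreover have "ancestor_parts S (m - s) (pt (f s)) \<subseteq> ancestor_parts S (m - 1) (pt (f s))"
        using \<open>s \<noteq> 0\<close> by (intro ancestor_parts_mono) auto
      moreover have "m = Suc (m - 1)"
        using False by simp
      ultimately show ?thesis
        by (metis UN_I ancestor_parts.simps(2) insertI2 subsetD)
    qed
  qed
  obtain g :: "'a \<Rightarrow> nat" where g: "inj_on g ?V"
    using finite_imp_inj_to_nat_seg[OF finV] by blast
  define M where "M = Suc (Max (insert 0 (g ` ?V)))"
  have gM: "g v < M" if "v \<in> ?V" for v
    using that finV by (auto simp: M_def less_Suc_eq_le intro: Max_ge)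
  \<comment> \<open>Lexicographic: the part number comes first, and ties are broken by the injection
    \<open>g\<close>, whose values are below \<open>M\<close>.\<close>
  define rk where "rk v = pt v * M + g v" for v
  have rk_div: "rk v div M = pt v" "rk v mod M = g v" if "v \<in> ?V" for v
    using gM[OF that] by (auto simp: rk_def)
  have inj: "inj_on rk ?V"
    using g rk_div by (metis inj_onD inj_onI)
  have rk_le: "pt u \<le> pt w" if "rk u \<le> rk w" "u \<in> ?V" "w \<in> ?V" for u w
    using div_le_mono[OF that(1), of M] rk_div that by simp
  show thesis
  proof (rule that[OF inj])
    fix r v assume v: "v \<in> ?V"
    let ?W = "ancestor_parts S r (pt v)"
    have "weakly_reachable G rk r v \<subseteq> (\<Union>j\<in>?W. {u \<in> ?V. pt u = j \<and> (\<exists>m\<le>r. (v, u) \<in> adj_within G (U j) ^^ m)})"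
    proof
      fix u assume "u \<in> weakly_reachable G rk r v"
      then obtain m where u: "u \<in> ?V" and m: "m \<le> r" "(v, u) \<in> adj_within G {w \<in> ?V. rk u \<le> rk w} ^^ m"
        by (auto simp: weakly_reachable_def)
      have "adj_within G {w \<in> ?V. rk u \<le> rk w} \<subseteq> adj_within G (U (pt u))"
        using rk_le u by (intro adj_within_mono) (auto simp: U_def)
      then have vu: "(v, u) \<in> adj_within G (U (pt u)) ^^ m"
        using m(2) relpow_mono by blast
      then have "pt u \<in> ?W"
        using anc[OF vu v] ancestor_parts_mono[OF m(1)] by blast
      then show "u \<in> (\<Union>j\<in>?W. {u \<in> ?V. pt u = j \<and> (\<exists>m\<le>r. (v, u) \<in> adj_within G (U j) ^^ m)})"
        using u vu m(1) by blast
    qed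
    then have "card (weakly_reachable G rk r v) \<le> card (\<Union>j\<in>?W. {u \<in> ?V. pt u = j \<and> (\<exists>m\<le>r. (v, u) \<in> adj_within G (U j) ^^ m)})"
      using card_ancestor_parts[of S r "pt v"] S(1) finV by (intro card_mono) auto
    also have "\<dots> \<le> (\<Sum>j\<in>?W. card {u \<in> ?V. pt u = j \<and> (\<exists>m\<le>r. (v, u) \<in> adj_within G (U j) ^^ m)})"
      using card_ancestor_parts[of S r "pt v"] S(1) by (intro card_UN_le) auto
    also have "\<dots> \<le> (\<Sum>j\<in>?W. 5 * (2 * r + 1))"
      using ball by (intro sum_mono)
    also have "\<dots> \<le> 5 ^ r * (5 * (2 * r + 1))"
      using card_ancestor_parts[of S r "pt v"] S(1) by (simp only: sum_constant) (intro mult_right_mono, auto)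
    finally show "card (weakly_reachable G rk r v) \<le> 5 ^ r * (5 * (2 * r + 1))" .
  qed
qed

section \<open>Families of copies\<close>

text \<open>Embeddings instead of subgraphs, so that different copies can be compared vertex by
  vertex along \<open>H\<close>.\<close>

definition is_copy :: "'a sgraph \<Rightarrow> 'b sgraph \<Rightarrow> ('b \<Rightarrow> 'a) \<Rightarrow> bool" where
  "is_copy G H \<phi> \<longleftrightarrow> inj_on \<phi> (verts H) \<and> \<phi> ` verts H \<subseteq> verts G \<and> (\<forall>e\<in>edges H. \<phi> ` e \<in> edges G)"

definition copy_edges :: "'b sgraph \<Rightarrow> ('b \<Rightarrow> 'a) \<Rightarrow> 'a set set" where
  "copy_edges H \<phi> = (\<lambda>e. \<phi> ` e) ` edges H"

lemma is_copy_imp_contains_copy: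
  assumes H: "simple_graph H" and \<phi>: "is_copy G H \<phi>"
  shows "contains_copy G H"
proof -
  have eH: "e \<subseteq> verts H" "card e = 2" if "e \<in> edges H" for e
    using H that by (auto simp: simple_graph_def)
  have inj: "inj_on \<phi> (verts H)"
    using \<phi> by (simp add: is_copy_def)
  define S where "S = SGraph (\<phi> ` verts H) (copy_edges H \<phi>)"
  have "simple_graph S"
    using H eH inj by (auto simp: S_def simple_graph_def copy_edges_def card_image inj_on_subset)
  then have "subgraph S G"
    using \<phi> by (auto simp: subgraph_def S_def copy_edges_def is_copy_def)
  moreover have "isomorphic S H"
    unfolding isomorphic_def
  proof (intro exI conjI)
    show "bij_betw (inv_into (verts H) \<phi>) (verts S) (verts H)"
      using inj by (simp add: S_def bij_betw_inv_into inj_on_imp_bij_betw)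
    have "(\<lambda>e. inv_into (verts H) \<phi> ` e) ` edges S = (\<lambda>e. inv_into (verts H) \<phi> ` (\<phi> ` e)) ` edges H"
      by (simp add: S_def copy_edges_def image_image)
    also have "\<dots> = (\<lambda>e. e) ` edges H"
      using eH inj by (intro image_cong) (auto simp: inv_into_image_cancel)
    finally show "edges H = (\<lambda>e. inv_into (verts H) \<phi> ` e) ` edges S"
      by simp
  qed
  ultimately show ?thesis
    by (auto simp: contains_copy_def)
qed

lemma contains_copy_imp_is_copy:
  assumes "contains_copy G H"
  obtains \<phi> where "is_copy G H \<phi>" "\<phi> \<in> extensional (verts H)"
proof -
  obtain S \<psi> where S: "subgraph S G" and \<psi>: "bij_betw \<psi> (verts S) (verts H)" "edges H = (\<lambda>e. \<psi> ` e) ` edges S"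
    using assms by (auto simp: contains_copy_def isomorphic_def)
  define \<phi> where "\<phi> = restrict (inv_into (verts S) \<psi>) (verts H)"
  have inj: "inj_on (inv_into (verts S) \<psi>) (verts H)" "inv_into (verts S) \<psi> ` verts H = verts S"
    using bij_betw_inv_into[OF \<psi>(1)] by (auto simp: bij_betw_def)
  have "\<phi> ` (\<psi> ` e) = e" if "e \<in> edges S" for e
  proof -
    have e: "e \<subseteq> verts S"
      using S that by (auto simp: subgraph_def simple_graph_def)
    moreover have "\<psi> ` e \<subseteq> verts H"
      using e \<psi>(1) by (auto simp: bij_betw_def)
    then have "\<phi> ` (\<psi> ` e) = inv_into (verts S) \<psi> ` (\<psi> ` e)"
      by (auto simp: \<phi>_def intro!: image_cong)
    ultimately show ?thesis
      using \<psi>(1) by (simp add: bij_betw_def inv_into_image_cancel)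
  qed
  then have "is_copy G H \<phi>"
    using inj S unfolding is_copy_def \<psi>(2) by (auto simp: \<phi>_def subgraph_def inj_on_restrict_eq)
  then show thesis
    by (intro that) (auto simp: \<phi>_def)
qed

lemma finite_obtains_maximum:
  fixes f :: "'c \<Rightarrow> 'd::linorder"
  assumes "finite A" "A \<noteq> {}"
  obtains x where "x \<in> A" "\<And>y. y \<in> A \<Longrightarrow> f y \<le> f x"
proof -
  have "Max (f ` A) \<in> f ` A"
    using assms by (intro Max_in) auto
  then obtain x where x: "x \<in> A" "f x = Max (f ` A)"
    by force
  then show thesis
    using that[of x] assms(1) Max_ge[of "f ` A"] by simp
qed

text \<open>Deleting all edges of a largest edge-disjoint family destroys every copy, since a
  surviving one could be added to the family. So farness bounds the number of these edges from
  below.\<close>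

lemma far_imp_edge_disjoint_copies:
  fixes H :: "'b sgraph" and G :: "'a sgraph"
  assumes G: "simple_graph G" and H: "simple_graph H" "edges H \<noteq> {}" and far: "far_from_H_free \<epsilon> G H"
  obtains F where "finite F" "\<And>\<phi>. \<phi> \<in> F \<Longrightarrow> is_copy G H \<phi> \<and> \<phi> \<in> extensional (verts H)"
    "\<And>\<phi> \<psi>. \<phi> \<in> F \<Longrightarrow> \<psi> \<in> F \<Longrightarrow> \<phi> \<noteq> \<psi> \<Longrightarrow> copy_edges H \<phi> \<inter> copy_edges H \<psi> = {}"
    "\<epsilon> * real (card (verts G)) < real (card F * card (edges H))"
proof -
  define \<Phi> where "\<Phi> = {\<phi> \<in> verts H \<rightarrow>\<^sub>E verts G. is_copy G H \<phi>}"
  have fin: "finite \<Phi>"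
    using G H finite_PiE[of "verts H" "\<lambda>_. verts G"] by (auto simp: \<Phi>_def simple_graph_def)
  have finE: "finite (edges H)"
    using H(1) by (rule simple_graph_finite_edges)
  have in\<Phi>: "\<phi> \<in> \<Phi>" if "is_copy G H \<phi>" "\<phi> \<in> extensional (verts H)" for \<phi>
    using that by (auto simp: \<Phi>_def is_copy_def PiE_def)
  define \<F> where "\<F> = {F. F \<subseteq> \<Phi> \<and> (\<forall>\<phi>\<in>F. \<forall>\<psi>\<in>F. \<phi> \<noteq> \<psi> \<longrightarrow> copy_edges H \<phi> \<inter> copy_edges H \<psi> = {})}"
  have "finite \<F>" "\<F> \<noteq> {}"
    using fin by (auto simp: \<F>_def intro!: exI[of _ "{}"])
  then obtain F where F: "F \<in> \<F>" and Fmax: "\<And>F'. F' \<in> \<F> \<Longrightarrow> card F' \<le> card F"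
    using finite_obtains_maximum[where f = card] by blast
  have F\<Phi>: "F \<subseteq> \<Phi>" "finite F"
    using F fin by (auto simp: \<F>_def intro: finite_subset)
  define D where "D = (\<Union>\<phi>\<in>F. copy_edges H \<phi>)"
  have "D \<subseteq> edges G"
    using F\<Phi> by (auto simp: D_def copy_edges_def \<Phi>_def is_copy_def)
  moreover have "H_free (delete_edges G D) H"
    unfolding H_free_def
  proof
    assume "contains_copy (delete_edges G D) H"
    then obtain \<phi> where \<phi>: "is_copy (delete_edges G D) H \<phi>" "\<phi> \<in> extensional (verts H)"
      by (rule contains_copy_imp_is_copy)
    then have "is_copy G H \<phi>" and d: "copy_edges H \<phi> \<inter> D = {}"
      by (auto simp: is_copy_def delete_edges_def copy_edges_def)
    then have "\<phi> \<in> \<Phi>"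
      using \<phi> in\<Phi> by blast
    \<comment> \<open>Here \<open>H\<close> must have an edge: a copy without edges would be
      disjoint from \<open>D\<close> even as a member of \<open>F\<close>.\<close>
    have "copy_edges H \<phi> \<noteq> {}"
      using H by (simp add: copy_edges_def)
    then have "\<phi> \<notin> F"
      using d by (auto simp: D_def)
    have "insert \<phi> F \<in> \<F>"
      using F d \<open>\<phi> \<in> \<Phi>\<close> by (fastforce simp: \<F>_def D_def)
    then show False
      using Fmax[of "insert \<phi> F"] \<open>\<phi> \<notin> F\<close> F\<Phi> by simp
  qed
  ultimately have "\<epsilon> * real (card (verts G)) < real (card D)"
    using far unfolding far_from_H_free_def by blast
  also have "card D \<le> (\<Sum>\<phi>\<in>F. card (copy_edges H \<phi>))"
    unfolding D_def using F\<Phi> by (intro card_UN_le)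
  also have "\<dots> \<le> (\<Sum>\<phi>\<in>F. card (edges H))"
    using finE by (intro sum_mono) (simp add: copy_edges_def card_image_le)
  also have "\<dots> = card F * card (edges H)"
    by simp
  finally have "\<epsilon> * real (card (verts G)) < real (card F * card (edges H))"
    by simp
  then show thesis
    using F F\<Phi> by (intro that[of F]) (auto simp: \<F>_def \<Phi>_def PiE_def)
qed

lemma pigeonhole_fiber:
  assumes "finite A" "finite B" "B \<noteq> {}" "f ` A \<subseteq> B"
  obtains b where "b \<in> B" "card A \<le> card B * card {x \<in> A. f x = b}"
proof -
  have "\<exists>b\<in>B. card A \<le> card B * card {x \<in> A. f x = b}"
  proof (rule ccontr)
    assume "\<not> ?thesis"
    then have less: "card B * card {x \<in> A. f x = b} < card A" if "b \<in> B" for b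
      using that by auto
    have "card A = (\<Sum>b\<in>B. card {x \<in> A. f x = b})"
      using sum.group[OF assms(1,2,4), of "\<lambda>_. 1::nat"] by simp
    then have "card B * card A = (\<Sum>b\<in>B. card B * card {x \<in> A. f x = b})"
      by (simp add: sum_distrib_left)
    also have "\<dots> < (\<Sum>b\<in>B. card A)"
      using assms less by (intro sum_strict_mono) auto
    finally show False
      by simp
  qed
  then show thesis
    using that by blast
qed

text \<open>Averaging over all colorings of \<open>V\<close> by \<open>W\<close>: a fixed map
  prescribes the colors of \<open>k\<close> vertices and leaves the others free, so it is colored
  correctly by \<open>k ^ (n - k)\<close> of the \<open>k ^ n\<close> colorings. Hence some coloring
  is correct for a fraction \<open>1 / k ^ k\<close> of the family.\<close>

lemma colorful_subfamily:
  fixes F :: "('b \<Rightarrow> 'a) set"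
  assumes fin: "finite F" "finite V" "finite W" "W \<noteq> {}"
    and F: "\<And>\<phi>. \<phi> \<in> F \<Longrightarrow> inj_on \<phi> W \<and> \<phi> ` W \<subseteq> V"
  obtains c where "card F \<le> card W ^ card W * card {\<phi> \<in> F. \<forall>a\<in>W. c (\<phi> a) = a}"
proof (cases "F = {}")
  case True
  then show thesis
    using that by auto
next
  case False
  define k n where "k = card W" and "n = card V"
  have kn: "k \<le> n"
  proof -
    obtain \<phi> where "\<phi> \<in> F"
      using False by auto
    then show ?thesis
      using F[of \<phi>] card_inj_on_le[of \<phi> W V] fin by (auto simp: k_def n_def)
  qed
  define Cs where "Cs = V \<rightarrow>\<^sub>E W"
  have finC: "finite Cs" and cardC: "card Cs = k ^ n" and neC: "Cs \<noteq> {}"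
    using fin by (auto simp: Cs_def card_PiE finite_PiE k_def n_def PiE_eq_empty_iff)
  define good where "good c \<phi> \<longleftrightarrow> (\<forall>a\<in>W. c (\<phi> a) = a)" for c :: "'a \<Rightarrow> 'b" and \<phi>
  have count: "card {c \<in> Cs. good c \<phi>} = k ^ (n - k)" if \<phi>: "\<phi> \<in> F" for \<phi>
  proof -
    have inj: "inj_on \<phi> W" and sub: "\<phi> ` W \<subseteq> V"
      using F[OF \<phi>] by auto
    define B where "B v = (if v \<in> \<phi> ` W then {inv_into W \<phi> v} else W)" for v
    have "{c \<in> Cs. good c \<phi>} = (\<Pi>\<^sub>E v\<in>V. B v)"
    proof (intro set_eqI iffI)
      fix c assume c: "c \<in> {c \<in> Cs. good c \<phi>}"
      then have "c v \<in> B v" if "v \<in> V" for v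
        using that inj by (auto simp: B_def good_def Cs_def)
      then show "c \<in> (\<Pi>\<^sub>E v\<in>V. B v)"
        using c by (auto simp: Cs_def PiE_def)
    next
      fix c assume c: "c \<in> (\<Pi>\<^sub>E v\<in>V. B v)"
      have "good c \<phi>"
        unfolding good_def
      proof
        fix a assume a: "a \<in> W"
        then have "c (\<phi> a) \<in> B (\<phi> a)"
          using c sub by (auto simp: PiE_def Pi_def)
        then show "c (\<phi> a) = a"
          using a inj by (simp add: B_def)
      qed
      moreover have "c v \<in> W" if "v \<in> V" for v
      proof -
        have "c v \<in> B v"
          using c that by (auto simp: PiE_def)
        then show ?thesis
          using inj by (auto simp: B_def split: if_splits)
      qed
      ultimately show "c \<in> {c \<in> Cs. good c \<phi>}"
        using c by (auto simp: Cs_def PiE_def)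
    qed
    then have "card {c \<in> Cs. good c \<phi>} = (\<Prod>v\<in>V. card (B v))"
      using fin by (simp add: card_PiE)
    also have "\<dots> = (\<Prod>v\<in>V - \<phi> ` W. card (B v)) * (\<Prod>v\<in>\<phi> ` W. card (B v))"
      using fin sub by (intro prod.subset_diff) auto
    also have "(\<Prod>v\<in>\<phi> ` W. card (B v)) = 1"
      by (intro prod.neutral) (auto simp: B_def)
    also have "(\<Prod>v\<in>V - \<phi> ` W. card (B v)) = (\<Prod>v\<in>V - \<phi> ` W. k)"
      by (intro prod.cong) (auto simp: B_def k_def)
    also have "\<dots> = k ^ (n - k)"
      using fin sub inj by (simp add: card_Diff_subset card_image n_def k_def)
    finally show ?thesis
      by simp
  qed
  have sumeq: "(\<Sum>c\<in>Cs. card {\<phi> \<in> F. good c \<phi>}) = card F * k ^ (n - k)"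
  proof -
    have "(\<Sum>c\<in>Cs. card {\<phi> \<in> F. good c \<phi>}) = (\<Sum>c\<in>Cs. \<Sum>\<phi>\<in>F. if good c \<phi> then 1 else 0)"
      using fin by (intro sum.cong refl) (simp add: sum.If_cases Int_def)
    also have "\<dots> = (\<Sum>\<phi>\<in>F. \<Sum>c\<in>Cs. if good c \<phi> then 1 else 0)"
      by (rule sum.swap)
    also have "\<dots> = (\<Sum>\<phi>\<in>F. card {c \<in> Cs. good c \<phi>})"
      using finC by (intro sum.cong refl) (simp add: sum.If_cases Int_def)
    also have "\<dots> = (\<Sum>\<phi>\<in>F. k ^ (n - k))"
      using count by (intro sum.cong) auto
    finally show ?thesis
      by simp
  qed
  have "\<exists>c\<in>Cs. card F \<le> k ^ k * card {\<phi> \<in> F. good c \<phi>}"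
  proof (rule ccontr)
    assume "\<not> ?thesis"
    then have "(\<Sum>c\<in>Cs. k ^ k * card {\<phi> \<in> F. good c \<phi>}) < (\<Sum>c\<in>Cs. card F)"
      using finC neC by (intro sum_strict_mono) auto
    also have "\<dots> = k ^ k * (card F * k ^ (n - k))"
      using kn by (simp add: cardC power_add[symmetric])
    also have "\<dots> = (\<Sum>c\<in>Cs. k ^ k * card {\<phi> \<in> F. good c \<phi>})"
      by (simp add: sumeq[symmetric] sum_distrib_left)
    finally show False
      by simp
  qed
  then show thesis
    using that by (auto simp: good_def k_def)
qed

text \<open>Take \<open>F'\<close> maximizing \<open>card F'\<close> plus the thresholds of the classes that \<open>F'\<close> avoids.\<close>

lemma thin_class_cleaning:
  fixes \<theta> :: "'i \<Rightarrow> real"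
  assumes "finite F" "finite I" "\<And>i. i \<in> I \<Longrightarrow> 0 \<le> \<theta> i"
  obtains F' where "F' \<subseteq> F" "\<And>i. i \<in> I \<Longrightarrow> F' \<inter> t i = {} \<or> \<theta> i \<le> card (F' \<inter> t i)"
    "real (card F) - (\<Sum>i\<in>I. \<theta> i) \<le> card F'"
proof -
  define pot where "pot X = real (card X) + (\<Sum>i\<in>{i \<in> I. X \<inter> t i = {}}. \<theta> i)" for X
  have fin: "finite (Pow F)" "Pow F \<noteq> {}"
    using assms by auto
  obtain F' where F': "F' \<in> Pow F" and "\<And>X. X \<in> Pow F \<Longrightarrow> pot X \<le> pot F'"
    using finite_obtains_maximum[OF fin, of pot] by blast
  then have max: "pot X \<le> pot F'" if "X \<subseteq> F" for X
    using that by blast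
  have finF': "finite F'"
    using F' assms by (auto intro: finite_subset)
  show thesis
  proof (rule that[of F'])
    show "F' \<subseteq> F"
      using F' by auto
    show "F' \<inter> t i = {} \<or> \<theta> i \<le> card (F' \<inter> t i)" if i: "i \<in> I" for i
    proof (rule ccontr)
      assume neg: "\<not> ?thesis"
      define Z where "Z X = {i \<in> I. X \<inter> t i = {}}" for X
      have "insert i (Z F') \<subseteq> Z (F' - t i)" "i \<notin> Z F'" "finite (Z X)" for X
        using i neg assms by (auto simp: Z_def)
      then have "\<theta> i + sum \<theta> (Z F') \<le> sum \<theta> (Z (F' - t i))"
        using sum_mono2[of "Z (F' - t i)" "insert i (Z F')" \<theta>] assms(3) by (auto simp: Z_def)
      moreover have "real (card (F' - t i)) = real (card F') - real (card (F' \<inter> t i))"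
        using finF' by (simp add: card_Diff_subset_Int card_mono of_nat_diff)
      \<comment> \<open>Removing the class loses less than \<open>\<theta> i\<close> in cardinality,
        while the newly avoided index \<open>i\<close> gains \<open>\<theta> i\<close>.\<close>
      ultimately have "pot F' < pot (F' - t i)"
        using neg by (simp add: pot_def Z_def)
      then show False
        using max[of "F' - t i"] F' by auto
    qed
    have "real (card F) \<le> pot F"
      using assms by (auto simp: pot_def intro!: sum_nonneg)
    also have "\<dots> \<le> pot F'"
      using max by simp
    also have "\<dots> \<le> real (card F') + (\<Sum>i\<in>I. \<theta> i)"
      using assms by (auto simp: pot_def intro!: sum_mono2)
    finally show "real (card F) - (\<Sum>i\<in>I. \<theta> i) \<le> card F'"
      by simp
  qed
qed

text \<open>If \<open>\<rho>\<close> lists the vertices of \<open>H\<close> in the order in which a copy meets the ordering of \<open>G\<close>, then the images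
  of the ancestors of \<open>a\<close> are weakly reachable from the image of \<open>a\<close>.\<close>

definition ancestors :: "'b sgraph \<Rightarrow> ('b \<Rightarrow> nat) \<Rightarrow> 'b \<Rightarrow> 'b set" where
  "ancestors H \<rho> a = {b \<in> verts H. (a, b) \<in> (adj_within H {c \<in> verts H. \<rho> b \<le> \<rho> c})\<^sup>*}"

text \<open>The answers at \<open>\<phi> a\<close> that keep the exploration going towards
  \<open>b\<close>: it may pass to another copy \<open>\<psi>\<close>, but the images of all
  ancestors of \<open>a\<close> stay the same. If \<open>b\<close> is itself an ancestor of
  \<open>a\<close>, only \<open>\<phi> b\<close> is left.\<close>

definition target :: "'b sgraph \<Rightarrow> ('b \<Rightarrow> nat) \<Rightarrow> ('b \<Rightarrow> 'a) set \<Rightarrow> ('b \<Rightarrow> 'a) \<Rightarrow> 'b \<Rightarrow> 'b \<Rightarrow> 'a set" where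
  "target H \<rho> F \<phi> a b = (\<lambda>\<psi>. \<psi> b) ` {\<psi> \<in> F. \<forall>d\<in>ancestors H \<rho> a. \<psi> d = \<phi> d}"

text \<open>All demands on the queries at one vertex. They are collected as distinct sets because
  their number enters a union bound.\<close>

definition targets :: "'b sgraph \<Rightarrow> ('b \<Rightarrow> nat) \<Rightarrow> ('b \<Rightarrow> 'a) set \<Rightarrow> 'a \<Rightarrow> 'a set set" where
  "targets H \<rho> F u = {target H \<rho> F \<phi> a b | \<phi> a b. \<phi> \<in> F \<and> a \<in> verts H \<and> b \<in> verts H \<and> {a, b} \<in> edges H \<and> \<phi> a = u}"

lemma ancestors_refl: "a \<in> verts H \<Longrightarrow> a \<in> ancestors H \<rho> a"
  by (simp add: ancestors_def)

lemma ancestors_subset: "ancestors H \<rho> a \<subseteq> verts H"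
  by (auto simp: ancestors_def)

lemma restrict_eq_iff: "restrict f A = restrict g A \<longleftrightarrow> (\<forall>x\<in>A. f x = g x)"
  by (auto simp: fun_eq_iff restrict_def)

text \<open>In a finite relation no walk has to be longer than the number of its pairs. The
  resulting square is the radius in \<open>reach_bound\<close> and the number of steps per vertex in
  \<open>explored_contains_copy\<close>.\<close>

lemma short_walk:
  assumes "finite (verts H)" "U \<subseteq> verts H" "(a, b) \<in> (adj_within H U)\<^sup>*"
  obtains m where "m \<le> card (verts H) * card (verts H)" "(a, b) \<in> adj_within H U ^^ m"
proof -
  have sub: "adj_within H U \<subseteq> verts H \<times> verts H"
    using assms(2) by (auto simp: adj_within_def)
  then have fin: "finite (adj_within H U)"
    using assms(1) finite_subset by blast
  have "card (adj_within H U) \<le> card (verts H) * card (verts H)"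
    using card_mono[OF _ sub] assms(1) by (simp add: card_cartesian_product)
  moreover obtain m where "m \<le> card (adj_within H U)" "(a, b) \<in> adj_within H U ^^ m"
    using assms(3) rtrancl_finite_eq_relpow[OF fin] by auto
  ultimately show thesis
    using that le_trans by blast
qed

text \<open>A copy maps a walk of \<open>H\<close> with minimum \<open>b\<close> to a walk of
  \<open>G\<close> with minimum \<open>\<phi> b\<close>, because \<open>ord\<close> transfers the
  comparisons.\<close>

lemma copy_ancestors_weakly_reachable:
  assumes \<phi>: "is_copy G H \<phi>" and fin: "finite (verts H)"
    and ord: "\<And>a b. a \<in> verts H \<Longrightarrow> b \<in> verts H \<Longrightarrow> \<rho> a \<le> \<rho> b \<Longrightarrow> rk (\<phi> a) \<le> rk (\<phi> b)"
    and b: "b \<in> ancestors H \<rho> a"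
  shows "\<phi> b \<in> weakly_reachable G rk (card (verts H) * card (verts H)) (\<phi> a)"
proof -
  let ?A = "{c \<in> verts H. \<rho> b \<le> \<rho> c}" and ?B = "{w \<in> verts G. rk (\<phi> b) \<le> rk w}"
  have bH: "b \<in> verts H"
    using b by (auto simp: ancestors_def)
  obtain m where m: "m \<le> card (verts H) * card (verts H)" "(a, b) \<in> adj_within H ?A ^^ m"
    using short_walk[OF fin, of ?A a b] b by (auto simp: ancestors_def)
  have step: "(\<phi> x, \<phi> y) \<in> adj_within G ?B" if "(x, y) \<in> adj_within H ?A" for x y
  proof -
    have "\<phi> ` {x, y} \<in> edges G"
      using that \<phi> by (simp only: is_copy_def adj_within_def) blast
    then show ?thesis
      using that \<phi> ord bH by (auto simp: adj_within_def is_copy_def)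
  qed
  have "(\<phi> a, \<phi> y) \<in> adj_within G ?B ^^ n" if "(a, y) \<in> adj_within H ?A ^^ n" for y n
    using that
  proof (induction n arbitrary: y)
    case (Suc n)
    then obtain z where "(a, z) \<in> adj_within H ?A ^^ n" "(z, y) \<in> adj_within H ?A"
      by auto
    then show ?case
      using Suc.IH step by (meson relpow_Suc_I)
  qed auto
  then have "(\<phi> a, \<phi> b) \<in> adj_within G ?B ^^ m"
    using m by blast
  moreover have "\<phi> b \<in> verts G"
    using \<phi> bH by (auto simp: is_copy_def)
  ultimately show ?thesis
    using m(1) by (auto simp: weakly_reachable_def)
qed

text \<open>Each edge is charged to its end of larger rank, from which the other end is weakly
  reachable in one step; the factor two accounts for both orders of a pair. This is the source of
  sparsity, for the degree sum as well as for the number of copies inside a vertex set.\<close>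

lemma card_adjacent_pairs:
  assumes G: "simple_graph G" and w: "\<And>v. v \<in> verts G \<Longrightarrow> card (weakly_reachable G rk r v) \<le> w"
    and r: "r \<ge> 1" and X: "X \<subseteq> verts G"
  shows "card {(x, y). x \<in> X \<and> y \<in> X \<and> {x, y} \<in> edges G} \<le> 2 * w * card X"
proof -
  have finX: "finite X"
    using G X by (auto simp: simple_graph_def intro: finite_subset)
  have finW: "finite (weakly_reachable G rk r v)" for v
    using G by (auto simp: simple_graph_def weakly_reachable_def)
  define B where "B = (SIGMA x:X. weakly_reachable G rk r x)"
  have cB: "card B \<le> w * card X"
  proof -
    have "card B = (\<Sum>x\<in>X. card (weakly_reachable G rk r x))"
      unfolding B_def using finX finW by simp
    also have "\<dots> \<le> (\<Sum>x\<in>X. w)"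
      using w X by (intro sum_mono) auto
    finally show ?thesis
      by (simp add: mult.commute)
  qed
  have fB: "finite B"
    using finX finW by (simp add: B_def)
  have key: "y \<in> weakly_reachable G rk r x" if "x \<in> X" "y \<in> X" "{x, y} \<in> edges G" "rk y \<le> rk x" for x y
  proof -
    have "(x, y) \<in> adj_within G {w \<in> verts G. rk y \<le> rk w} ^^ 1"
      using that X by (auto simp: adj_within_def)
    then show ?thesis
      using that X r unfolding weakly_reachable_def by blast
  qed
  have "{(x, y). x \<in> X \<and> y \<in> X \<and> {x, y} \<in> edges G} \<subseteq> B \<union> prod.swap ` B"
  proof clarify
    fix x y assume xy: "x \<in> X" "y \<in> X" "{x, y} \<in> edges G" "(x, y) \<notin> prod.swap ` B"
    show "(x, y) \<in> B"
    proof (cases "rk y \<le> rk x")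
      case True
      then show ?thesis
        using key xy by (auto simp: B_def)
    next
      case False
      then have "(y, x) \<in> B"
        using key[of y x] xy by (auto simp: B_def insert_commute)
      then show ?thesis
        using xy(4) by (metis image_eqI swap_simp)
    qed
  qed
  then have "card {(x, y). x \<in> X \<and> y \<in> X \<and> {x, y} \<in> edges G} \<le> card (B \<union> prod.swap ` B)"
    using fB by (intro card_mono) auto
  also have "\<dots> \<le> card B + card (prod.swap ` B)"
    by (rule card_Un_le)
  also have "\<dots> \<le> card B + card B"
    using card_image_le[OF fB] by simp
  finally show ?thesis
    using cB by simp
qed

lemma neighbors_subset_verts: "simple_graph G \<Longrightarrow> neighbors G u \<subseteq> verts G"
  by (auto simp: neighbors_def dest: simple_graph_edgeD)

lemma sum_degrees_le:
  assumes G: "simple_graph G" and w: "\<And>v. v \<in> verts G \<Longrightarrow> card (weakly_reachable G rk r v) \<le> w" and r: "r \<ge> 1"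
  shows "(\<Sum>x\<in>verts G. card (neighbors G x)) \<le> 2 * w * card (verts G)"
proof -
  have fin: "finite (verts G)"
    using G by (simp add: simple_graph_def)
  have "(\<Sum>x\<in>verts G. card (neighbors G x)) = card (SIGMA x:verts G. neighbors G x)"
    using fin neighbors_subset_verts[OF G] by (subst card_SigmaI) (auto intro: finite_subset)
  also have "(SIGMA x:verts G. neighbors G x) = {(x, y). x \<in> verts G \<and> y \<in> verts G \<and> {x, y} \<in> edges G}"
    using neighbors_subset_verts[OF G] by (auto simp: neighbors_def)
  finally show ?thesis
    using card_adjacent_pairs[OF G w r] by simp
qed

text \<open>Counting smaller elements replaces ranks by positions. These take at most
  \<open>card A\<close> values, which makes a pigeonhole argument over order patterns
  possible.\<close>

lemma position_order:
  fixes r :: "'b \<Rightarrow> nat"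
  assumes "finite A" "a \<in> A" "b \<in> A"
  shows "card {c \<in> A. r c < r a} \<le> card {c \<in> A. r c < r b} \<longleftrightarrow> r a \<le> r b"
proof
  assume "r a \<le> r b"
  then show "card {c \<in> A. r c < r a} \<le> card {c \<in> A. r c < r b}"
    using assms by (intro card_mono) auto
next
  assume le: "card {c \<in> A. r c < r a} \<le> card {c \<in> A. r c < r b}"
  show "r a \<le> r b"
  proof (rule ccontr)
    assume "\<not> r a \<le> r b"
    then have "{c \<in> A. r c < r b} \<subset> {c \<in> A. r c < r a}"
      using assms by force
    then show False
      using psubset_card_mono[of "{c \<in> A. r c < r a}" "{c \<in> A. r c < r b}"] assms le by simp
  qed
qed

lemma card_ancestor_restrictions:
  assumes fin: "finite F" "finite (verts H)" and W: "finite W" "card W \<le> w" "w \<ge> 1"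
    and sub: "\<And>\<phi> d. \<phi> \<in> F \<Longrightarrow> d \<in> ancestors H \<rho> a \<Longrightarrow> \<phi> d \<in> W"
  shows "card ((\<lambda>\<phi>. restrict \<phi> (ancestors H \<rho> a)) ` F) \<le> w ^ card (verts H)"
proof -
  let ?A = "ancestors H \<rho> a"
  have fA: "finite ?A" "card ?A \<le> card (verts H)"
    using fin ancestors_subset[of H \<rho> a] by (auto intro: finite_subset card_mono)
  have "(\<lambda>\<phi>. restrict \<phi> ?A) ` F \<subseteq> ?A \<rightarrow>\<^sub>E W"
    using sub by auto
  then have "card ((\<lambda>\<phi>. restrict \<phi> ?A) ` F) \<le> card (?A \<rightarrow>\<^sub>E W)"
    using fA W by (intro card_mono finite_PiE) auto
  also have "\<dots> = card W ^ card ?A"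
    using fA by (simp add: card_PiE)
  also have "\<dots> \<le> w ^ card ?A"
    using W by (intro power_mono) auto
  also have "\<dots> \<le> w ^ card (verts H)"
    using W fA by (intro power_increasing) auto
  finally show ?thesis .
qed


text \<open>The value of the bound in \<open>weak_coloring_number_bound\<close> at radius
  \<open>k * k\<close>, the walk length of \<open>short_walk\<close>.\<close>

definition reach_bound :: "nat \<Rightarrow> nat" where
  "reach_bound k = 5 ^ (k * k) * (5 * (2 * (k * k) + 1))"

text \<open>The cleaning removes all copies \<open>\<phi>\<close> for which few copies agree with \<open>\<phi>\<close> on the ancestors of some \<open>a\<close>, few
  meaning less than a small multiple of the degree of \<open>\<phi> a\<close>. This is affordable because there are boundedly
  many ways to map the ancestors of \<open>a\<close> once the image of \<open>a\<close> is known.\<close>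

theorem robust_family:
  fixes G :: "'a sgraph" and H :: "'b sgraph"
  assumes G: "simple_graph G" "K6_minor_free G" and H: "simple_graph H" "edges H \<noteq> {}"
    and far: "far_from_H_free \<epsilon> G H" and \<epsilon>: "0 < \<epsilon>"
  defines "k \<equiv> card (verts H)" and "e \<equiv> card (edges H)"
  defines "w \<equiv> reach_bound k"
  defines "\<eta> \<equiv> \<epsilon> / real (4 * e * k ^ (2 * k) * w)"
  obtains \<rho> F c where "finite F" "\<And>\<phi>. \<phi> \<in> F \<Longrightarrow> is_copy G H \<phi>" "\<And>\<phi> a. \<phi> \<in> F \<Longrightarrow> a \<in> verts H \<Longrightarrow> c (\<phi> a) = a"
    "inj_on \<rho> (verts H)"
    "\<And>\<phi> a b. \<phi> \<in> F \<Longrightarrow> a \<in> verts H \<Longrightarrow> b \<in> verts H \<Longrightarrow> {a, b} \<in> edges H \<Longrightarrow>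
       \<eta> / real (k * w ^ k) * real (card (neighbors G (\<phi> a))) \<le> real (card (target H \<rho> F \<phi> a b))"
    "\<And>u. u \<in> verts G \<Longrightarrow> finite (targets H \<rho> F u) \<and> card (targets H \<rho> F u) \<le> k * (k * w ^ k)"
    "\<eta> * real (card (verts G)) \<le> real (card (\<Union>\<phi>\<in>F. \<phi> ` verts H))"
proof -
  define n where "n = card (verts G)"
  have finH: "finite (verts H)" "finite (edges H)"
    using H simple_graph_finite_edges by (auto simp: simple_graph_def)
  have finG: "finite (verts G)"
    using G by (simp add: simple_graph_def)
  obtain a0 b0 where ab0: "{a0, b0} \<in> edges H" "a0 \<in> verts H" "b0 \<in> verts H"
  proof -
    obtain d where d: "d \<in> edges H"
      using H by auto
    then have "card d = 2" "d \<subseteq> verts H"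
      using H by (auto simp: simple_graph_def)
    then show thesis
      using d that by (auto simp: card_2_iff)
  qed
  have k: "k \<ge> 1" and e: "e \<ge> 1"
    using ab0 finH by (auto simp: k_def e_def Suc_le_eq card_gt_0_iff)
  have w: "w \<ge> 1"
    by (simp add: w_def reach_bound_def)
  obtain rk where rk: "inj_on rk (verts G)"
    "\<And>r v. v \<in> verts G \<Longrightarrow> card (weakly_reachable G rk r v) \<le> 5 ^ r * (5 * (2 * r + 1))"
    using weak_coloring_number_bound[OF G] by blast
  have wr: "card (weakly_reachable G rk (k * k) v) \<le> w" if "v \<in> verts G" for v
    using rk(2)[OF that, of "k * k"] by (simp only: w_def reach_bound_def)
  have kk: "k * k \<ge> 1"
    using k by simp
  obtain F0 where F0: "finite F0" "\<And>\<phi>. \<phi> \<in> F0 \<Longrightarrow> is_copy G H \<phi> \<and> \<phi> \<in> extensional (verts H)"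
    "\<And>\<phi> \<psi>. \<phi> \<in> F0 \<Longrightarrow> \<psi> \<in> F0 \<Longrightarrow> \<phi> \<noteq> \<psi> \<Longrightarrow> copy_edges H \<phi> \<inter> copy_edges H \<psi> = {}"
    "\<epsilon> * real n < real (card F0 * e)"
    using far_imp_edge_disjoint_copies[OF G(1) H far] unfolding n_def e_def by blast
  have F0inj: "inj_on \<phi> (verts H) \<and> \<phi> ` verts H \<subseteq> verts G" if "\<phi> \<in> F0" for \<phi>
    using F0(2)[OF that] by (simp add: is_copy_def)
  have neH: "verts H \<noteq> {}"
    using ab0 by auto
  obtain c where c: "card F0 \<le> k ^ k * card {\<phi> \<in> F0. \<forall>a\<in>verts H. c (\<phi> a) = a}"
    unfolding k_def by (rule colorful_subfamily[OF F0(1) finG finH(1) neH F0inj])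
  define F1 where "F1 = {\<phi> \<in> F0. \<forall>a\<in>verts H. c (\<phi> a) = a}"
  \<comment> \<open>The order in which a copy meets the ordering of \<open>G\<close>, one of at most
    \<open>k ^ k\<close> patterns.\<close>
  define pos where "pos \<phi> = restrict (\<lambda>a. card {b \<in> verts H. rk (\<phi> b) < rk (\<phi> a)}) (verts H)" for \<phi>
  have "pos \<phi> a < k" if "a \<in> verts H" for \<phi> a
  proof -
    have "{b \<in> verts H. rk (\<phi> b) < rk (\<phi> a)} \<subset> verts H"
      using that by auto
    then show ?thesis
      using finH that psubset_card_mono[of "verts H"] by (simp add: pos_def k_def)
  qed
  then have "pos ` F1 \<subseteq> verts H \<rightarrow>\<^sub>E {..<k}"
    by (auto simp: pos_def)
  moreover have "finite F1"
    using F0(1) by (simp add: F1_def)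
  moreover have "verts H \<rightarrow>\<^sub>E {..<k} \<noteq> {}"
    using k by (simp add: PiE_eq_empty_iff lessThan_empty_iff)
  moreover have "finite (verts H \<rightarrow>\<^sub>E {..<k})" "card (verts H \<rightarrow>\<^sub>E {..<k}) = k ^ k"
    using finH by (auto simp: finite_PiE card_PiE k_def)
  ultimately obtain \<rho> where \<rho>: "card F1 \<le> k ^ k * card {\<phi> \<in> F1. pos \<phi> = \<rho>}"
    using pigeonhole_fiber[of F1 "verts H \<rightarrow>\<^sub>E {..<k}" pos] by metis
  define F2 where "F2 = {\<phi> \<in> F1. pos \<phi> = \<rho>}"
  have F2: "finite F2" "F2 \<subseteq> F0"
    using F0(1) by (auto simp: F2_def F1_def)
  have F2copy: "is_copy G H \<phi>" if "\<phi> \<in> F2" for \<phi>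
    using F0(2) F2(2) that by auto
  have F2in: "\<phi> a \<in> verts G" if "\<phi> \<in> F2" "a \<in> verts H" for \<phi> a
    using F2copy[OF that(1)] that(2) by (auto simp: is_copy_def)
  have "card F0 \<le> k ^ k * (k ^ k * card F2)"
    using c \<rho> unfolding F1_def[symmetric] F2_def[symmetric] by (meson le_trans mult_le_mono2)
  then have cF2: "card F0 \<le> k ^ (2 * k) * card F2"
    by (simp add: mult_2 power_add mult.assoc)
  have ord: "\<rho> a \<le> \<rho> b \<longleftrightarrow> rk (\<phi> a) \<le> rk (\<phi> b)" if "\<phi> \<in> F2" "a \<in> verts H" "b \<in> verts H" for \<phi> a b
  proof -
    have "\<rho> = pos \<phi>"
      using that by (simp add: F2_def)
    then show ?thesis
      using position_order[OF finH(1) that(2,3), of "\<lambda>b. rk (\<phi> b)"] that by (simp add: pos_def)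
  qed
  define anc where "anc = ancestors H \<rho>"
  define cls where "cls a \<tau> = {\<phi> \<in> F2. restrict \<phi> (anc a) = \<tau>}" for a \<tau>
  define T where "T a x = (\<lambda>\<phi>. restrict \<phi> (anc a)) ` {\<phi> \<in> F2. \<phi> a = x}" for a x
  have finT: "finite (T a x)" for a x
    using F2(1) by (simp add: T_def)
  have cT: "card (T a x) \<le> w ^ k" if a: "a \<in> verts H" and x: "x \<in> verts G" for a x
    unfolding T_def anc_def k_def
  proof (rule card_ancestor_restrictions)
    show "card (weakly_reachable G rk (k * k) x) \<le> w"
      using wr x by simp
    show "\<phi> d \<in> weakly_reachable G rk (k * k) x" if "\<phi> \<in> {\<phi> \<in> F2. \<phi> a = x}" "d \<in> ancestors H \<rho> a" for \<phi> d
      using copy_ancestors_weakly_reachable[of G H \<phi> \<rho> rk d a] that F2copy[of \<phi>] finH ord[of \<phi>]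
      by (auto simp: k_def)
  qed (use F2 finH finG w in \<open>auto simp: weakly_reachable_def\<close>)
  define \<delta> where "\<delta> = \<eta> / real (k * w ^ k)"
  have \<eta>0: "\<eta> > 0"
    using \<epsilon> e k w by (simp add: \<eta>_def)
  then have \<delta>0: "\<delta> > 0"
    using k w by (simp add: \<delta>_def)
  \<comment> \<open>\<open>x\<close> is the value of \<open>\<tau>\<close> at \<open>a\<close>.
    Listing it separately allows the thresholds, which are multiples of the degree of
    \<open>x\<close>, to be summed vertex by vertex.\<close>
  define I where "I = (SIGMA a:verts H. SIGMA x:verts G. T a x)"
  define \<theta> :: "'b \<times> 'a \<times> ('b \<Rightarrow> 'a) \<Rightarrow> real" where "\<theta> = (\<lambda>(a, x, \<tau>). \<delta> * card (neighbors G x))"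
  have "finite I"
    using finH finG finT by (simp add: I_def)
  moreover have "0 \<le> \<theta> i" for i
    using \<delta>0 by (simp add: \<theta>_def split: prod.split)
  ultimately obtain F where F: "F \<subseteq> F2"
    "\<And>i. i \<in> I \<Longrightarrow> F \<inter> (case i of (a, x, \<tau>) \<Rightarrow> cls a \<tau>) = {} \<or> \<theta> i \<le> card (F \<inter> (case i of (a, x, \<tau>) \<Rightarrow> cls a \<tau>))"
    "real (card F2) - (\<Sum>i\<in>I. \<theta> i) \<le> card F"
    using thin_class_cleaning[OF F2(1), of I \<theta> "\<lambda>i. case i of (a, x, \<tau>) \<Rightarrow> cls a \<tau>"] by blast
  have finF: "finite F"
    using F(1) F2(1) finite_subset by blast
  \<comment> \<open>At most \<open>k * w ^ k\<close> classes belong to each vertex \<open>x\<close>,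
    and the denominator of \<open>\<delta>\<close> cancels this number. What remains is
    \<open>\<eta>\<close> times the degree sum.\<close>
  have cost: "(\<Sum>i\<in>I. \<theta> i) \<le> \<eta> * (2 * w * n)"
  proof -
    have "(\<Sum>i\<in>I. \<theta> i) = (\<Sum>a\<in>verts H. \<Sum>x\<in>verts G. \<Sum>\<tau>\<in>T a x. \<delta> * card (neighbors G x))"
    proof -
      have "(\<Sum>i\<in>I. \<theta> i) = (\<Sum>a\<in>verts H. \<Sum>p\<in>(SIGMA x:verts G. T a x). \<theta> (a, p))"
        unfolding I_def using finH finG finT
        by (subst sum.Sigma) (auto simp: split_def)
      moreover have "(\<Sum>p\<in>(SIGMA x:verts G. T a x). \<theta> (a, p)) = (\<Sum>x\<in>verts G. \<Sum>\<tau>\<in>T a x. \<delta> * card (neighbors G x))" for a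
        using finG finT by (subst sum.Sigma) (auto simp: \<theta>_def split_def)
      ultimately show ?thesis
        by simp
    qed
    also have "\<dots> \<le> (\<Sum>a\<in>verts H. \<Sum>x\<in>verts G. real (w ^ k) * (\<delta> * card (neighbors G x)))"
    proof (intro sum_mono)
      fix a x assume ax: "a \<in> verts H" "x \<in> verts G"
      have "real (card (T a x)) \<le> real (w ^ k)"
        using cT[OF ax] by (rule of_nat_mono)
      then have "real (card (T a x)) * (\<delta> * card (neighbors G x)) \<le> real (w ^ k) * (\<delta> * card (neighbors G x))"
        using \<delta>0 by (intro mult_right_mono) auto
      then show "(\<Sum>\<tau>\<in>T a x. \<delta> * card (neighbors G x)) \<le> real (w ^ k) * (\<delta> * card (neighbors G x))"
        by simp
    qed
    also have "\<dots> = real k * (real (w ^ k) * \<delta> * real (\<Sum>x\<in>verts G. card (neighbors G x)))"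
      by (simp add: k_def sum_distrib_left mult.assoc)
    also have "\<dots> = \<eta> * real (\<Sum>x\<in>verts G. card (neighbors G x))"
      using k w by (simp add: \<delta>_def)
    also have "\<dots> \<le> \<eta> * real (2 * w * n)"
      using sum_degrees_le[OF G(1) wr kk] \<eta>0 unfolding n_def
      by (intro mult_left_mono of_nat_mono) auto
    finally show ?thesis
      by simp
  qed
  \<comment> \<open>Farness gives more than \<open>\<epsilon> * n / e\<close> copies, and the
    coloring and the order pattern each keep a fraction \<open>1 / k ^ k\<close> of them. The factor
    four in \<open>\<eta>\<close> makes the result twice the cost of the cleaning.\<close>
  have big: "4 * \<eta> * w * n \<le> real (card F2)"
  proof -
    have "\<epsilon> * n \<le> real (card F0) * e"
      using F0(4) by simp
    also have "\<dots> \<le> real (k ^ (2 * k) * card F2) * e"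
      using cF2 by (intro mult_right_mono of_nat_mono) auto
    finally have "\<epsilon> * n \<le> card F2 * (e * real (k ^ (2 * k)))"
      by (simp add: mult_ac)
    then have "\<epsilon> * n / (e * real (k ^ (2 * k))) \<le> card F2"
      using e k by (simp add: divide_le_eq)
    moreover have "4 * \<eta> * w * n = \<epsilon> * n / (e * real (k ^ (2 * k)))"
      using w by (simp add: \<eta>_def)
    ultimately show ?thesis
      by simp
  qed
  have cF: "2 * \<eta> * w * n \<le> card F"
    using F(3) cost big by (simp add: algebra_simps)
  have FF0: "F \<subseteq> F0"
    using F(1) F2(2) by auto
  \<comment> \<open>Edge-disjointness makes a copy determined by its images of one edge. So in a
    class, where the image of \<open>a\<close> is fixed, distinct copies have distinct images of a
    neighbor \<open>b\<close>.\<close>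
  have edge_inj: "\<phi> = \<psi>" if "\<phi> \<in> F" "\<psi> \<in> F" "{a, b} \<in> edges H" "\<phi> a = \<psi> a" "\<phi> b = \<psi> b" for \<phi> \<psi> a b
  proof (rule ccontr)
    assume "\<phi> \<noteq> \<psi>"
    then have "copy_edges H \<phi> \<inter> copy_edges H \<psi> = {}"
      using F0(3) FF0 that by blast
    moreover have "\<phi> ` {a, b} \<in> copy_edges H \<phi>" "\<psi> ` {a, b} \<in> copy_edges H \<psi>"
      using that(3) unfolding copy_edges_def by blast+
    moreover have "\<phi> ` {a, b} = \<psi> ` {a, b}"
      using that by simp
    ultimately show False
      by auto
  qed
  have same_class: "{\<psi> \<in> F. \<forall>d\<in>ancestors H \<rho> a. \<psi> d = \<phi> d} = F \<inter> cls a (restrict \<phi> (anc a))" for \<phi> a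
    using F(1) by (auto simp: cls_def restrict_eq_iff anc_def)
  show thesis
  proof (rule that[of F c \<rho>])
    show "is_copy G H \<phi>" if "\<phi> \<in> F" for \<phi>
      using F2copy F(1) that by auto
    show "c (\<phi> a) = a" if "\<phi> \<in> F" "a \<in> verts H" for \<phi> a
      using F(1) that by (auto simp: F2_def F1_def)
    show "inj_on \<rho> (verts H)"
    proof (cases "F2 = {}")
      case True
      then have "\<epsilon> * real n < 0"
        using F0(4) cF2 by simp
      then show ?thesis
        using \<epsilon> by (simp add: mult_less_0_iff)
    next
      case False
      then obtain \<phi> where \<phi>: "\<phi> \<in> F2"
        by auto
      show ?thesis
      proof (rule inj_onI)
        fix a b assume ab: "a \<in> verts H" "b \<in> verts H" "\<rho> a = \<rho> b"
        then have "rk (\<phi> a) = rk (\<phi> b)"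
          using ord[OF \<phi>, of a b] ord[OF \<phi>, of b a] by simp
        then have "\<phi> a = \<phi> b"
          using rk(1) F2in[OF \<phi>] ab by (auto dest: inj_onD)
        then show "a = b"
          using F2copy[OF \<phi>] ab by (auto simp: is_copy_def dest: inj_onD)
      qed
    qed
    show "\<eta> / real (k * w ^ k) * real (card (neighbors G (\<phi> a))) \<le> real (card (target H \<rho> F \<phi> a b))"
      if \<phi>: "\<phi> \<in> F" and a: "a \<in> verts H" and b: "b \<in> verts H" and ab: "{a, b} \<in> edges H" for \<phi> a b
    proof -
      let ?\<tau> = "restrict \<phi> (anc a)"
      have "(a, \<phi> a, ?\<tau>) \<in> I"
        using \<phi> a F(1) F2in by (auto simp: I_def T_def)
      moreover have "\<phi> \<in> F \<inter> cls a ?\<tau>"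
        using \<phi> F(1) by (auto simp: cls_def)
      ultimately have "\<delta> * card (neighbors G (\<phi> a)) \<le> card (F \<inter> cls a ?\<tau>)"
        using F(2)[of "(a, \<phi> a, ?\<tau>)"] by (auto simp: \<theta>_def)
      moreover have "inj_on (\<lambda>\<psi>. \<psi> b) (F \<inter> cls a ?\<tau>)"
      proof (rule inj_onI)
        fix \<psi> \<psi>' assume \<psi>: "\<psi> \<in> F \<inter> cls a ?\<tau>" "\<psi>' \<in> F \<inter> cls a ?\<tau>" "\<psi> b = \<psi>' b"
        have "a \<in> anc a"
          unfolding anc_def by (rule ancestors_refl[OF a])
        then have "\<psi> a = \<psi>' a"
          using \<psi> by (auto simp: cls_def restrict_eq_iff)
        then show "\<psi> = \<psi>'"
          using edge_inj[OF _ _ ab] \<psi> by auto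
      qed
      then have "card (target H \<rho> F \<phi> a b) = card (F \<inter> cls a ?\<tau>)"
        unfolding target_def same_class by (rule card_image)
      ultimately show ?thesis
        by (simp add: \<delta>_def)
    qed
    show "finite (targets H \<rho> F u) \<and> card (targets H \<rho> F u) \<le> k * (k * w ^ k)" if u: "u \<in> verts G" for u
    proof -
      define B where "B = (SIGMA a:verts H. verts H \<times> T a u)"
      have finB: "finite B"
        using finH finT by (simp add: B_def)
      have "targets H \<rho> F u \<subseteq> (\<lambda>(a, b, \<tau>). (\<lambda>\<psi>. \<psi> b) ` (F \<inter> cls a \<tau>)) ` B"
      proof
        fix t assume "t \<in> targets H \<rho> F u"
        then obtain \<phi> a b where t: "t = target H \<rho> F \<phi> a b" "\<phi> \<in> F" "a \<in> verts H" "b \<in> verts H" "\<phi> a = u"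
          by (auto simp: targets_def)
        then have "(a, b, restrict \<phi> (anc a)) \<in> B"
          using F(1) by (auto simp: B_def T_def)
        moreover have "t = (\<lambda>\<psi>. \<psi> b) ` (F \<inter> cls a (restrict \<phi> (anc a)))"
          unfolding t(1) target_def same_class ..
        ultimately show "t \<in> (\<lambda>(a, b, \<tau>). (\<lambda>\<psi>. \<psi> b) ` (F \<inter> cls a \<tau>)) ` B"
          by (force intro: image_eqI)
      qed
      moreover have "card ((\<lambda>(a, b, \<tau>). (\<lambda>\<psi>. \<psi> b) ` (F \<inter> cls a \<tau>)) ` B) \<le> card B"
        using finB by (rule card_image_le)
      moreover have "card B \<le> k * (k * w ^ k)"
      proof -
        have "card B = (\<Sum>a\<in>verts H. card (verts H \<times> T a u))"
          unfolding B_def using finH finT by (subst card_SigmaI) auto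
        also have "\<dots> \<le> (\<Sum>a\<in>verts H. k * w ^ k)"
          using cT u by (intro sum_mono) (simp add: card_cartesian_product k_def)
        finally show ?thesis
          by (simp add: k_def)
      qed
      ultimately show ?thesis
        using finB by (meson card_mono finite_imageI finite_subset le_trans)
    qed
    show "\<eta> * real (card (verts G)) \<le> real (card (\<Union>\<phi>\<in>F. \<phi> ` verts H))"
    proof -
      define X where "X = (\<Union>\<phi>\<in>F. \<phi> ` verts H)"
      have X: "X \<subseteq> verts G"
        using F2in F(1) by (auto simp: X_def)
      \<comment> \<open>Each copy yields its own adjacent pair in \<open>X\<close>, so sparsity
        turns the number of copies into a lower bound on \<open>card X\<close>.\<close>
      have "inj_on (\<lambda>\<phi>. (\<phi> a0, \<phi> b0)) F"
        using edge_inj[OF _ _ ab0(1)] by (auto simp: inj_on_def)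
      then have "card F = card ((\<lambda>\<phi>. (\<phi> a0, \<phi> b0)) ` F)"
        by (simp add: card_image)
      also have "\<dots> \<le> card {(x, y). x \<in> X \<and> y \<in> X \<and> {x, y} \<in> edges G}"
      proof (rule card_mono)
        have "{(x, y). x \<in> X \<and> y \<in> X \<and> {x, y} \<in> edges G} \<subseteq> verts G \<times> verts G"
          using X by auto
        then show "finite {(x, y). x \<in> X \<and> y \<in> X \<and> {x, y} \<in> edges G}"
          using finG finite_subset by blast
        have "{\<phi> a0, \<phi> b0} \<in> edges G" if "\<phi> \<in> F" for \<phi>
        proof -
          have "\<phi> ` {a0, b0} \<in> edges G"
            using F2copy[of \<phi>] F(1) that ab0 unfolding is_copy_def by blast
          then show ?thesis
            by simp
        qed
        then show "(\<lambda>\<phi>. (\<phi> a0, \<phi> b0)) ` F \<subseteq> {(x, y). x \<in> X \<and> y \<in> X \<and> {x, y} \<in> edges G}"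
          using ab0 by (auto simp: X_def)
      qed
      also have "\<dots> \<le> 2 * w * card X"
        by (rule card_adjacent_pairs[OF G(1) wr kk X])
      finally have "real (card F) \<le> real (2 * w * card X)"
        by (rule of_nat_mono)
      then have "(2 * w) * (\<eta> * n) \<le> (2 * w) * card X"
        using cF by (simp add: algebra_simps)
      then show ?thesis
        using w by (simp add: n_def X_def)
    qed
  qed (rule finF)
qed

section \<open>Finding a copy by exploration\<close>

text \<open>In \<open>explores T l S L R\<close>, the vertices of \<open>S - L\<close> were queried in earlier levels.\<close>

definition explores :: "('a \<Rightarrow> 'a set set) \<Rightarrow> nat \<Rightarrow> 'a set \<Rightarrow> 'a set \<Rightarrow> 'a set set \<Rightarrow> bool" where
  "explores T l S L R \<longleftrightarrow> (\<exists>A :: nat \<Rightarrow> 'a set. A 0 = S \<and> (\<forall>i<l. A i \<subseteq> A (Suc i) \<and>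
     (\<forall>u\<in>A i. u \<notin> S - L \<longrightarrow> (\<forall>t\<in>T u. \<exists>x\<in>t. x \<in> A (Suc i) \<and> {u, x} \<in> R))))"

lemma ancestors_le: "d \<in> ancestors H \<rho> a \<Longrightarrow> \<rho> d \<le> \<rho> a"
  by (auto simp: ancestors_def adj_within_def elim: converse_rtranclE)

lemma ancestors_trans:
  assumes "p \<in> ancestors H \<rho> c" "d \<in> ancestors H \<rho> p"
  shows "d \<in> ancestors H \<rho> c"
proof -
  have "(c, p) \<in> (adj_within H {x \<in> verts H. \<rho> d \<le> \<rho> x})\<^sup>*"
    using assms(1) ancestors_le[OF assms(2)]
    by - (rule rtrancl_adj_within_mono[of c p H "{x \<in> verts H. \<rho> p \<le> \<rho> x}"], auto simp: ancestors_def)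
  then show ?thesis
    using assms(2) by (auto simp: ancestors_def)
qed

text \<open>Going from \<open>p\<close> back to \<open>q\<close> and on to \<open>d\<close> stays at
  or above the level of \<open>d\<close>. Hence the ancestors of \<open>q\<close> form a chain, and
  preserving the images of the ancestors of the largest proper one preserves those of all proper
  ones.\<close>

lemma ancestors_chain:
  assumes "d \<in> ancestors H \<rho> q" "p \<in> ancestors H \<rho> q" "\<rho> d \<le> \<rho> p"
  shows "d \<in> ancestors H \<rho> p"
proof -
  have "(q, p) \<in> (adj_within H {x \<in> verts H. \<rho> d \<le> \<rho> x})\<^sup>*"
    using assms(2,3)
    by - (rule rtrancl_adj_within_mono[of q p H "{x \<in> verts H. \<rho> p \<le> \<rho> x}"], auto simp: ancestors_def)
  then show ?thesis
    using assms(1) rtrancl_adj_within_sym by (fastforce simp: ancestors_def intro: rtrancl_trans)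
qed

text \<open>The images of the vertices of \<open>H\<close> are fixed in increasing order of \<open>\<rho>\<close>. To reach the next vertex \<open>q\<close>, one
  walks from its largest proper ancestor \<open>p\<close> through vertices having \<open>p\<close> as an ancestor: although each query may
  lead to another copy of the family, the images of the ancestors of \<open>p\<close> are never lost. Every edge of \<open>H\<close> at \<open>q\<close>
  towards a smaller vertex leads to an ancestor of \<open>q\<close>, so the target set of that query is a singleton and the
  edge is recorded.\<close>

lemma explored_contains_copy:
  fixes H :: "'b sgraph" and v :: 'a
  assumes H: "simple_graph H" "connected_graph H" "edges H \<noteq> {}"
    and F: "\<And>\<phi>. \<phi> \<in> F \<Longrightarrow> is_copy G H \<phi>" and c: "\<And>\<phi> a. \<phi> \<in> F \<Longrightarrow> a \<in> verts H \<Longrightarrow> c (\<phi> a) = a"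
    and \<rho>: "inj_on \<rho> (verts H)" and v: "\<phi>\<^sub>0 \<in> F" "v \<in> \<phi>\<^sub>0 ` verts H"
    and R: "explores (targets H \<rho> F) (card (verts H) * (card (verts H) * card (verts H)) + 1) {v} {v} R"
  shows "contains_copy (SGraph (insert v (\<Union>R)) R) H"
proof -
  let ?V = "verts H"
  define k where "k = card ?V"
  define N where "N = k * k"
  \<comment> \<open>Each of the \<open>k\<close> vertices is reached in at most \<open>N\<close>
    steps, and one last step records the edges.\<close>
  define l where "l = k * N + 1"
  define anc where "anc = ancestors H \<rho>"
  have finH: "finite ?V"
    using H by (simp add: simple_graph_def)
  obtain A where A0: "A 0 = {v}" and A: "\<forall>i<l. A i \<subseteq> A (Suc i) \<and>
      (\<forall>u\<in>A i. u \<notin> {v} - {v} \<longrightarrow> (\<forall>t\<in>targets H \<rho> F u. \<exists>x\<in>t. x \<in> A (Suc i) \<and> {u, x} \<in> R))"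
    using R unfolding explores_def k_def[symmetric] N_def[symmetric] l_def[symmetric] by (elim exE conjE)
  have Amono: "A i \<subseteq> A (Suc i)" if "i < l" for i
    using A that by simp
  have hit: "\<exists>x\<in>t. x \<in> A (Suc i) \<and> {u, x} \<in> R" if "i < l" "u \<in> A i" "t \<in> targets H \<rho> F u" for i u t
    using A that by simp
  have Ale: "A i \<subseteq> A j" if "i \<le> j" "j \<le> l" for i j
    using that
  proof (induction j rule: dec_induct)
    case (step j)
    then show ?case
      using Amono[of j] by auto
  qed auto
  have step: "\<exists>\<psi>\<in>F. (\<forall>d\<in>anc a. \<psi> d = \<phi> d) \<and> \<psi> b \<in> A (Suc i) \<and> {\<phi> a, \<psi> b} \<in> R"
    if h: "\<phi> \<in> F" "a \<in> ?V" "b \<in> ?V" "{a, b} \<in> edges H" "\<phi> a \<in> A i" "i < l" for \<phi> a b i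
  proof -
    have "target H \<rho> F \<phi> a b \<in> targets H \<rho> F (\<phi> a)"
      using h unfolding targets_def by blast
    then obtain x where "x \<in> target H \<rho> F \<phi> a b" "x \<in> A (Suc i)" "{\<phi> a, x} \<in> R"
      using hit[OF h(6,5)] by blast
    then show ?thesis
      by (auto simp: target_def anc_def)
  qed
  \<comment> \<open>\<open>D\<close> consists of ancestors of every vertex passed, so each change of
    the copy preserves the values on \<open>D\<close>.\<close>
  have walk: "\<exists>\<psi>\<in>F. (\<forall>d\<in>D. \<psi> d = \<phi> d) \<and> \<psi> b \<in> A (i + m)"
    if h: "(a, b) \<in> adj_within H U ^^ m" "U \<subseteq> ?V" "\<phi> \<in> F" "\<phi> a \<in> A i" "i + m \<le> l" "\<And>x. x \<in> U \<Longrightarrow> D \<subseteq> anc x"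
    for a b U m \<phi> i D
    using h(1,5)
  proof (induction m arbitrary: b)
    case 0
    then show ?case
      using h by auto
  next
    case (Suc m)
    then obtain z where z: "(a, z) \<in> adj_within H U ^^ m" "(z, b) \<in> adj_within H U"
      by auto
    then obtain \<psi> where \<psi>: "\<psi> \<in> F" "\<forall>d\<in>D. \<psi> d = \<phi> d" "\<psi> z \<in> A (i + m)"
      using Suc by auto
    have zb: "z \<in> U" "b \<in> U" "{z, b} \<in> edges H"
      using z by (auto simp: adj_within_def)
    obtain \<psi>' where "\<psi>' \<in> F" "\<forall>d\<in>anc z. \<psi>' d = \<psi> d" "\<psi>' b \<in> A (Suc (i + m))"
      using step[OF \<psi>(1) _ _ zb(3) \<psi>(3)] zb h(2) Suc.prems by auto
    then show ?case
      using \<psi>(2) h(6)[OF zb(1)] by (intro bexI[of _ \<psi>']) auto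
  qed
  have "?V \<noteq> {}"
    using H(2) by (simp add: connected_graph_def)
  then obtain r where r: "r \<in> ?V" "\<And>b. b \<in> ?V \<Longrightarrow> \<rho> r \<le> \<rho> b"
    using arg_min_if_finite[OF finH, of \<rho>] by (meson not_le)
  have conn: "(a, b) \<in> (adj_within H ?V)\<^sup>*" if "a \<in> ?V" "b \<in> ?V" for a b
  proof -
    have "{(x, y). {x, y} \<in> edges H} = adj_within H ?V"
      using simple_graph_edgeD[OF H(1)] by (auto simp: adj_within_def)
    then show ?thesis
      using H(2) that by (simp add: connected_graph_def)
  qed
  \<comment> \<open>By connectivity of \<open>H\<close>, every vertex other than \<open>r\<close>
    thus has a proper ancestor from which a walk to it can start.\<close>
  have r_anc: "r \<in> anc a" if "a \<in> ?V" for a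
  proof -
    have "{c \<in> ?V. \<rho> r \<le> \<rho> c} = ?V"
      using r by auto
    then show ?thesis
      using conn[OF that r(1)] r(1) by (simp add: anc_def ancestors_def)
  qed
  have k1: "k \<ge> 1"
    using r(1) finH by (auto simp: k_def Suc_le_eq card_gt_0_iff)
  \<comment> \<open>\<open>\<sigma>\<close> need not come from a single copy. Only its values on the
    ancestors of each single vertex do, and different vertices may use different copies.\<close>
  have build: "\<exists>D \<sigma>. D \<subseteq> ?V \<and> card D = n \<and> (\<forall>a\<in>D. \<forall>b\<in>?V. \<rho> b < \<rho> a \<longrightarrow> b \<in> D) \<and>
      (\<forall>a\<in>D. \<sigma> a \<in> A (n * N) \<and> (\<exists>\<psi>\<in>F. \<forall>d\<in>anc a. \<psi> d = \<sigma> d))"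
    if "1 \<le> n" "n \<le> k" for n
    using that
  proof (induction n rule: dec_induct)
    case base
    obtain a where a: "a \<in> ?V" "\<phi>\<^sub>0 a \<in> A 0"
      using v A0 by auto
    obtain m where m: "m \<le> N" "(a, r) \<in> adj_within H ?V ^^ m"
      using short_walk[OF finH subset_refl conn[OF a(1) r(1)]] unfolding N_def k_def by blast
    have "N \<le> l"
      using mult_le_mono1[OF k1, of N] unfolding l_def by linarith
    \<comment> \<open>No image is fixed yet, so the walk from the start vertex to \<open>r\<close>
      has nothing to preserve.\<close>
    obtain \<psi> where "\<psi> \<in> F" "\<psi> r \<in> A (0 + m)"
      using walk[OF m(2) subset_refl v(1) a(2), of "{}"] m(1) \<open>N \<le> l\<close> by auto
    moreover have "A m \<subseteq> A N"
      using m(1) \<open>N \<le> l\<close> by (intro Ale) auto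
    moreover have "\<not> \<rho> b < \<rho> r" if "b \<in> ?V" for b
      using r(2)[OF that] by simp
    ultimately show ?case
      using r(1) by (intro exI[of _ "{r}"] exI[of _ \<psi>]) auto
  next
    case (step n)
    then obtain D \<sigma> where D: "D \<subseteq> ?V" "card D = n" "\<And>a b. a \<in> D \<Longrightarrow> b \<in> ?V \<Longrightarrow> \<rho> b < \<rho> a \<Longrightarrow> b \<in> D"
      and \<sigma>: "\<And>a. a \<in> D \<Longrightarrow> \<sigma> a \<in> A (n * N) \<and> (\<exists>\<psi>\<in>F. \<forall>d\<in>anc a. \<psi> d = \<sigma> d)"
      by (metis Suc_leD)
    have finD: "finite D"
      using D(1) finH finite_subset by blast
    have "?V - D \<noteq> {}"
      using D step.prems finH by (auto simp: k_def dest: card_mono[OF finD])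
    then obtain q where q: "q \<in> ?V" "q \<notin> D" "\<And>b. b \<in> ?V - D \<Longrightarrow> \<rho> q \<le> \<rho> b"
      using arg_min_if_finite[of "?V - D" \<rho>] finH by (metis Diff_iff finite_Diff not_le)
    have below: "b \<in> D" if "b \<in> ?V" "\<rho> b < \<rho> q" for b
      using q(3)[of b] that by auto
    have "D \<noteq> {}"
      using D step.hyps by auto
    then obtain a where a: "a \<in> D"
      by auto
    have "r \<in> D"
    proof (cases "a = r")
      case False
      then have "\<rho> r < \<rho> a"
        using r a D(1) \<rho> by (metis inj_onD le_neq_implies_less subsetD)
      then show ?thesis
        using D(3) a r by blast
    qed (use a in simp)
    then have "r \<in> anc q - {q}"
      using r_anc q by auto
    moreover have finq: "finite (anc q - {q})"
      using finH ancestors_subset[of H \<rho> q] by (auto simp: anc_def intro: finite_subset)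
    ultimately obtain p where p: "p \<in> anc q - {q}" "\<And>d. d \<in> anc q - {q} \<Longrightarrow> \<rho> d \<le> \<rho> p"
      using finite_obtains_maximum[of "anc q - {q}" \<rho>] by blast
    have pV: "p \<in> ?V"
      using p(1) ancestors_subset[of H \<rho> q] by (auto simp: anc_def)
    have "\<rho> p \<le> \<rho> q" "\<rho> p \<noteq> \<rho> q"
      using p(1) pV q(1) \<rho> ancestors_le[of p H \<rho> q] by (auto simp: anc_def dest: inj_onD)
    then have pD: "p \<in> D"
      using below pV by auto
    obtain \<psi>p where \<psi>p: "\<psi>p \<in> F" "\<forall>d\<in>anc p. \<psi>p d = \<sigma> d"
      using \<sigma>[OF pD] by blast
    have p_anc: "p \<in> anc p"
      using pV by (simp add: anc_def ancestors_refl)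
    define P where "P = {x \<in> ?V. \<rho> p \<le> \<rho> x}"
    define U where "U = {x. (p, x) \<in> (adj_within H P)\<^sup>*}"
    have U: "connected_within H U"
      unfolding U_def by (rule component_connected_within) (auto simp: P_def pV)
    have pU: "p \<in> U"
      by (simp add: U_def)
    have qU: "q \<in> U"
      using p(1) by (auto simp: U_def P_def anc_def ancestors_def dest: rtrancl_adj_within_sym)
    have UV: "U \<subseteq> ?V"
      using U by (simp add: connected_within_def)
    have Uanc: "anc p \<subseteq> anc x" if "x \<in> U" for x
    proof -
      have "(x, p) \<in> (adj_within H P)\<^sup>*"
        using that by (simp add: U_def rtrancl_adj_within_sym)
      then have px: "p \<in> ancestors H \<rho> x"
        using pV by (simp add: ancestors_def P_def)
      show ?thesis
        using ancestors_trans[OF px] by (auto simp: anc_def)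
    qed
    have "(p, q) \<in> (adj_within H U)\<^sup>*"
      using U pU qU by (simp add: connected_within_def)
    then obtain m where m: "m \<le> N" "(p, q) \<in> adj_within H U ^^ m"
      using short_walk[OF finH UV] unfolding N_def k_def by blast
    have lim: "Suc n * N \<le> l"
      using mult_le_mono1[OF step.prems, of N] unfolding l_def by linarith
    have "\<psi>p p \<in> A (n * N)"
      using \<psi>p(2) p_anc \<sigma>[OF pD] by auto
    then obtain \<psi> where \<psi>: "\<psi> \<in> F" "\<forall>d\<in>anc p. \<psi> d = \<psi>p d" "\<psi> q \<in> A (n * N + m)"
      using walk[OF m(2) UV \<psi>p(1), of "n * N" "anc p"] Uanc m(1) lim by auto
    have A1: "A (n * N + m) \<subseteq> A (Suc n * N)" "A (n * N) \<subseteq> A (Suc n * N)"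
      using m(1) by (intro Ale lim; simp)+
    define \<sigma>' where "\<sigma>' = \<sigma>(q := \<psi> q)"
    have \<psi>\<sigma>': "\<forall>d\<in>anc q. \<psi> d = \<sigma>' d"
    proof
      fix d assume d: "d \<in> anc q"
      show "\<psi> d = \<sigma>' d"
      proof (cases "d = q")
        case False
        then have "d \<in> anc p"
          using p d unfolding anc_def by (intro ancestors_chain[of d H \<rho> q p]) auto
        then show ?thesis
          using \<psi>(2) \<psi>p(2) False by (simp add: \<sigma>'_def)
      qed (simp add: \<sigma>'_def)
    qed
    have ancD: "d \<in> D" if "a \<in> D" "d \<in> anc a" for a d
    proof (cases "d = a")
      case False
      have "d \<in> ?V" "a \<in> ?V"
        using that D(1) ancestors_subset[of H \<rho> a] by (auto simp: anc_def)
      then have "\<rho> d < \<rho> a"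
        using False that ancestors_le[of d H \<rho> a] \<rho> by (metis anc_def inj_onD le_neq_implies_less)
      then show ?thesis
        using D(3) that \<open>d \<in> ?V\<close> by blast
    qed (use that in simp)
    show ?case
    proof (intro exI[of _ "insert q D"] exI[of _ \<sigma>'] conjI ballI impI)
      show "insert q D \<subseteq> ?V" "card (insert q D) = Suc n"
        using D q finD by auto
      show "b \<in> insert q D" if "a \<in> insert q D" "b \<in> ?V" "\<rho> b < \<rho> a" for a b
        using that D(3) below by auto
      show "\<sigma>' a \<in> A (Suc n * N)" if "a \<in> insert q D" for a
        using that \<psi>(3) A1 \<sigma> q(2) by (auto simp: \<sigma>'_def)
      show "\<exists>\<psi>\<in>F. \<forall>d\<in>anc a. \<psi> d = \<sigma>' d" if "a \<in> insert q D" for a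
      proof (cases "a = q")
        case True
        then show ?thesis
          using \<psi>(1) \<psi>\<sigma>' by blast
      next
        case False
        then have "a \<in> D"
          using that by simp
        then obtain \<psi>' where "\<psi>' \<in> F" "\<forall>d\<in>anc a. \<psi>' d = \<sigma> d"
          using \<sigma> by blast
        moreover have "\<sigma>' d = \<sigma> d" if "d \<in> anc a" for d
          using ancD[OF \<open>a \<in> D\<close> that] q(2) by (auto simp: \<sigma>'_def)
        ultimately show ?thesis
          by (intro bexI[of _ \<psi>']) auto
      qed
    qed
  qed
  obtain D \<sigma> where D: "D \<subseteq> ?V" "card D = k"
    and \<sigma>: "\<And>a. a \<in> D \<Longrightarrow> \<sigma> a \<in> A (k * N) \<and> (\<exists>\<psi>\<in>F. \<forall>d\<in>anc a. \<psi> d = \<sigma> d)"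
    using build[of k] k1 by blast
  have DV: "D = ?V"
    using D finH by (simp add: k_def card_subset_eq)
  have self: "a \<in> anc a" if "a \<in> ?V" for a
    using that by (simp add: anc_def ancestors_refl)
  have edge: "{\<sigma> a, \<sigma> b} \<in> R" if ab: "a \<in> ?V" "b \<in> ?V" "{a, b} \<in> edges H" "\<rho> b \<le> \<rho> a" for a b
  proof -
    have "(a, b) \<in> adj_within H {c \<in> ?V. \<rho> b \<le> \<rho> c}"
      using ab by (auto simp: adj_within_def)
    then have "b \<in> anc a"
      using ab(2) by (auto simp: anc_def ancestors_def)
    obtain \<psi> where \<psi>: "\<psi> \<in> F" "\<forall>d\<in>anc a. \<psi> d = \<sigma> d"
      using \<sigma> ab DV by blast
    then have "\<psi> a \<in> A (k * N)"
      using \<sigma>[of a] self[OF ab(1)] ab DV by auto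
    then obtain \<psi>' where "\<forall>d\<in>anc a. \<psi>' d = \<psi> d" "{\<psi> a, \<psi>' b} \<in> R"
      using step[OF \<psi>(1) ab(1-3)] by (auto simp: l_def)
    then show ?thesis
      using \<psi>(2) \<open>b \<in> anc a\<close> self[OF ab(1)] by simp
  qed
  have edgeR: "\<sigma> ` e \<in> R" if e: "e \<in> edges H" for e
  proof -
    have "card e = 2" "e \<subseteq> ?V"
      using H(1) e by (auto simp: simple_graph_def)
    then obtain a b where ab: "e = {a, b}" "a \<in> ?V" "b \<in> ?V"
      by (auto simp: card_2_iff)
    then show ?thesis
      using edge[of a b] edge[of b a] e by (cases "\<rho> b \<le> \<rho> a") (auto simp: insert_commute)
  qed
  have c\<sigma>: "c (\<sigma> a) = a" if "a \<in> ?V" for a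
    using \<sigma>[of a] self[OF that] c[OF _ that] that DV by metis
  have in_R: "\<sigma> a \<in> \<Union>R" if a: "a \<in> ?V" for a
  proof -
    obtain e where e: "e \<in> edges H"
      using H(3) by auto
    then have "card e = 2" "e \<subseteq> ?V"
      using H(1) by (auto simp: simple_graph_def)
    then obtain b where b: "b \<in> ?V" "b \<noteq> a"
      by (auto simp: card_2_iff)
    obtain z where "(a, z) \<in> adj_within H ?V"
      using conn[OF a b(1)] b(2) by (metis converse_rtranclE)
    then have "{a, z} \<in> edges H"
      by (simp add: adj_within_def)
    then have "\<sigma> ` {a, z} \<in> R"
      by (rule edgeR)
    then show ?thesis
      by auto
  qed
  have "is_copy (SGraph (insert v (\<Union>R)) R) H \<sigma>"
    unfolding is_copy_def using c\<sigma> in_R edgeR by (auto intro: inj_on_inverseI)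
  then show ?thesis
    by (rule is_copy_imp_contains_copy[OF H(1)])
qed

section \<open>Random exploration\<close>

lemma prob_bind_pmf:
  "measure_pmf.prob (bind_pmf M f) X = measure_pmf.expectation M (\<lambda>x. measure_pmf.prob (f x) X)"
proof -
  have "ennreal (measure_pmf.prob (bind_pmf M f) X) = (\<integral>\<^sup>+x. ennreal (measure_pmf.prob (f x) X) \<partial>measure_pmf M)"
    by (simp add: measure_pmf.emeasure_eq_measure[symmetric])
  also have "\<dots> = ennreal (measure_pmf.expectation M (\<lambda>x. measure_pmf.prob (f x) X))"
    by (intro nn_integral_eq_integral measure_pmf.integrable_const_bound[where B = 1]) auto
  finally show ?thesis
    by (simp add: integral_nonneg_AE)
qed

lemma prob_bind_pmf_le:
  assumes "\<And>x. x \<in> set_pmf M \<Longrightarrow> x \<notin> B \<Longrightarrow> measure_pmf.prob (f x) X \<le> c" and "0 \<le> c"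
  shows "measure_pmf.prob (bind_pmf M f) X \<le> measure_pmf.prob M B + c"
proof -
  have "measure_pmf.prob (bind_pmf M f) X \<le> measure_pmf.expectation M (\<lambda>x. indicator B x + c)"
    unfolding prob_bind_pmf
  proof (intro integral_mono_AE)
    show "AE x in measure_pmf M. measure_pmf.prob (f x) X \<le> indicator B x + c"
      using assms by (auto simp: AE_measure_pmf_iff indicator_def intro: order_trans[OF measure_pmf.prob_le_1])
    show "integrable (measure_pmf M) (\<lambda>x. measure_pmf.prob (f x) X)"
      by (intro measure_pmf.integrable_const_bound[where B = 1]) auto
    show "integrable (measure_pmf M) (\<lambda>x. indicator B x + c)"
      using assms(2) by (intro measure_pmf.integrable_const_bound[where B = "1 + c"]) (auto simp: indicator_def)
  qed
  also have "\<dots> = measure_pmf.prob M B + c"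
  proof -
    have "integrable (measure_pmf M) (indicat_real B)"
      by (intro measure_pmf.integrable_const_bound[where B = 1]) (auto simp: indicator_def)
    then show ?thesis
      by (simp add: Bochner_Integration.integral_add)
  qed
  finally show ?thesis .
qed

lemma prob_bind_pmf_ge:
  assumes "\<And>x. x \<in> B \<Longrightarrow> c \<le> measure_pmf.prob (f x) X"
  shows "measure_pmf.prob M B * c \<le> measure_pmf.prob (bind_pmf M f) X"
proof -
  have "measure_pmf.prob M B * c = measure_pmf.expectation M (\<lambda>x. indicator B x * c)"
    by simp
  also have "\<dots> \<le> measure_pmf.prob (bind_pmf M f) X"
    unfolding prob_bind_pmf
  proof (intro integral_mono_AE)
    show "AE x in measure_pmf M. indicator B x * c \<le> measure_pmf.prob (f x) X"
      using assms by (auto simp: AE_measure_pmf_iff indicator_def)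
  qed (auto intro!: measure_pmf.integrable_const_bound[where B = 1])
  finally show ?thesis .
qed

lemma prob_replicate_pmf_avoids:
  "measure_pmf.prob (replicate_pmf d p) {xs. set xs \<inter> t = {}} = measure_pmf.prob p (- t) ^ d"
proof (induction d)
  case (Suc d)
  have *: "measure_pmf.prob (bind_pmf (replicate_pmf d p) (\<lambda>xs. return_pmf (x # xs))) {xs. set xs \<inter> t = {}}
      = indicator (- t) x * measure_pmf.prob (replicate_pmf d p) {xs. set xs \<inter> t = {}}" for x
  proof -
    have "(#) x -` {xs. set xs \<inter> t = {}} = (if x \<in> t then {} else {xs. set xs \<inter> t = {}})"
      by auto
    then show ?thesis
      by (simp add: map_pmf_def[symmetric])
  qed
  show ?case
    unfolding replicate_pmf.simps prob_bind_pmf[of p] * Suc.IH by simp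
qed simp

lemma prob_random_neighbors_miss:
  fixes \<delta> :: real
  assumes "finite (neighbors G u)" "t \<subseteq> neighbors G u" "t \<noteq> {}" "\<delta> * card (neighbors G u) \<le> card t"
  shows "measure_pmf.prob (random_neighbors G d u) {X. X \<inter> t = {}} \<le> (1 - \<delta>) ^ d"
proof -
  let ?N = "neighbors G u"
  have N: "?N \<noteq> {}"
    using assms by auto
  have c0: "real (card ?N) > 0"
    using N assms(1) by (simp add: card_gt_0_iff)
  have "measure_pmf.prob (random_neighbors G d u) {X. X \<inter> t = {}} =
      measure_pmf.prob (replicate_pmf d (pmf_of_set ?N)) {xs. set xs \<inter> t = {}}"
    using N by (simp add: random_neighbors_def vimage_def)
  also have "\<dots> = measure_pmf.prob (pmf_of_set ?N) (- t) ^ d"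
    by (rule prob_replicate_pmf_avoids)
  also have "\<dots> \<le> (1 - \<delta>) ^ d"
  proof (intro power_mono)
    have "?N \<inter> - t = ?N - t"
      by auto
    then have "measure_pmf.prob (pmf_of_set ?N) (- t) = (real (card ?N) - real (card t)) / card ?N"
      using assms N by (simp add: measure_pmf_of_set card_Diff_subset finite_subset card_mono of_nat_diff)
    also have "\<dots> = 1 - card t / card ?N"
      using c0 by (simp add: diff_divide_distrib)
    also have "\<dots> \<le> 1 - \<delta>"
      using c0 assms(4) by (simp add: pos_le_divide_eq)
    finally show "measure_pmf.prob (pmf_of_set ?N) (- t) \<le> 1 - \<delta>" .
  qed simp
  finally show ?thesis .
qed

lemma set_pmf_random_neighbors:
  assumes "finite (neighbors G u)" "X \<in> set_pmf (random_neighbors G d u)"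
  shows "X \<subseteq> neighbors G u" "finite X" "card X \<le> d"
proof -
  have "X \<subseteq> neighbors G u \<and> finite X \<and> card X \<le> d"
  proof (cases "neighbors G u = {}")
    case False
    then obtain xs where "X = set xs" "set xs \<subseteq> neighbors G u" "length xs = d"
      using assms by (auto simp: random_neighbors_def set_replicate_pmf)
    then show ?thesis
      using card_length[of xs] by auto
  qed (use assms in \<open>auto simp: random_neighbors_def\<close>)
  then show "X \<subseteq> neighbors G u" "finite X" "card X \<le> d"
    by auto
qed

text \<open>The witness is shifted by one index, with \<open>S\<close> in front. A vertex of
  \<open>L\<close> is queried only in this round, while its demands recur at every later index;
  since the sets grow, the answers obtained now meet all of them.\<close>

lemma explores_Suc:
  assumes R: "{{u, x} | u x. u \<in> L \<and> x \<in> \<Gamma> u} \<subseteq> R"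
    and ex: "explores T k (S \<union> (\<Union>u\<in>L. \<Gamma> u)) ((\<Union>u\<in>L. \<Gamma> u) - S) R"
    and good: "\<And>u t. u \<in> L \<Longrightarrow> t \<in> T u \<Longrightarrow> \<Gamma> u \<inter> t \<noteq> {}"
  shows "explores T (Suc k) S L R"
proof -
  let ?N = "\<Union>u\<in>L. \<Gamma> u"
  obtain A where A0: "A 0 = S \<union> ?N" and A: "\<forall>i<k. A i \<subseteq> A (Suc i) \<and>
     (\<forall>u\<in>A i. u \<notin> S \<union> ?N - (?N - S) \<longrightarrow> (\<forall>t\<in>T u. \<exists>x\<in>t. x \<in> A (Suc i) \<and> {u, x} \<in> R))"
    using ex unfolding explores_def by blast
  have A0i: "A 0 \<subseteq> A i" if "i \<le> k" for i
    using that
  proof (induction i)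
    case (Suc i)
    then show ?case
      using A by (meson Suc_le_lessD Suc_leD subset_trans)
  qed simp
  define B where "B i = (case i of 0 \<Rightarrow> S | Suc j \<Rightarrow> A j)" for i
  have "B i \<subseteq> B (Suc i)" if "i < Suc k" for i
    using that A A0 by (cases i) (auto simp: B_def)
  moreover have "\<exists>x\<in>t. x \<in> B (Suc i) \<and> {u, x} \<in> R" if i: "i < Suc k" and u: "u \<in> B i" "u \<notin> S - L" and t: "t \<in> T u" for i u t
  proof (cases "u \<in> L")
    case True
    then obtain x where x: "x \<in> \<Gamma> u" "x \<in> t"
      using good t by blast
    then have "x \<in> A i"
      using A0i[of i] A0 True i by auto
    moreover have "{u, x} \<in> R"
      using R True x by blast
    ultimately show ?thesis
      using x by (auto simp: B_def)
  next
    case False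
    then obtain j where j: "i = Suc j" "u \<in> A j" "u \<notin> S"
      using u by (cases i) (auto simp: B_def)
    have "u \<notin> S \<union> ?N - (?N - S)"
      using j(3) by blast
    moreover have "\<forall>u\<in>A j. u \<notin> S \<union> ?N - (?N - S) \<longrightarrow> (\<forall>t\<in>T u. \<exists>x\<in>t. x \<in> A (Suc j) \<and> {u, x} \<in> R)"
      using A i j(1) by simp
    ultimately show ?thesis
      using j t unfolding B_def by auto
  qed
  ultimately show ?thesis
    unfolding explores_def by (intro exI[of _ B]) (auto simp: B_def)
qed

text \<open>A union bound over queried vertices and demands: each of at most \<open>K\<close>
  demands at a vertex is missed with probability at most \<open>(1 - \<delta>) ^ d\<close>, and each
  level is at most \<open>d\<close> times as large as the previous one. The part
  \<open>R0 \<subseteq> R\<close> is carried along because the edges of a round have to survive into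
  the final \<open>R\<close>.\<close>

lemma prob_traverse_levels_explores:
  fixes \<delta> :: real and K :: nat
  assumes G: "simple_graph G"
    and T: "\<And>u. u \<in> verts G \<Longrightarrow> finite (T u) \<and> card (T u) \<le> K"
      "\<And>u t. u \<in> verts G \<Longrightarrow> t \<in> T u \<Longrightarrow> t \<subseteq> neighbors G u \<and> t \<noteq> {} \<and> \<delta> * card (neighbors G u) \<le> card t"
    and \<delta>: "\<delta> \<le> 1" and L: "L \<subseteq> verts G"
  shows "measure_pmf.prob (traverse_levels G d k S L R0) {R. \<not> (R0 \<subseteq> R \<and> explores T k S L R)}
    \<le> K * (1 - \<delta>) ^ d * card L * (real d + 1) ^ k"
  using L
proof (induction k arbitrary: S L R0)
  case 0
  have "explores T 0 S L R0"
    by (auto simp: explores_def)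
  then show ?case
    using \<delta> by simp
next
  case (Suc k)
  define \<beta> where "\<beta> = K * (1 - \<delta>) ^ d"
  have \<beta>0: "\<beta> \<ge> 0"
    using \<delta> by (simp add: \<beta>_def)
  have finV: "finite (verts G)"
    using G by (simp add: simple_graph_def)
  have finL: "finite L"
    using Suc.prems finV finite_subset by blast
  have finN: "finite (neighbors G u)" for u
    using neighbors_subset_verts[OF G] finV finite_subset by blast
  define M where "M = Pi_pmf L {} (random_neighbors G d)"
  define Bad where "Bad = {\<Gamma>. \<exists>u\<in>L. \<exists>t\<in>T u. \<Gamma> u \<inter> t = {}}"
  have "measure_pmf.prob M Bad \<le> (\<Sum>u\<in>L. measure_pmf.prob M (\<Union>t\<in>T u. {\<Gamma>. \<Gamma> u \<inter> t = {}}))"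
  proof -
    have "Bad = (\<Union>u\<in>L. \<Union>t\<in>T u. {\<Gamma>. \<Gamma> u \<inter> t = {}})"
      by (auto simp: Bad_def)
    then show ?thesis
      using finL by (auto intro!: measure_pmf.finite_measure_subadditive_finite)
  qed
  also have "\<dots> \<le> (\<Sum>u\<in>L. \<beta>)"
  proof (intro sum_mono)
    fix u assume u: "u \<in> L"
    then have uV: "u \<in> verts G"
      using Suc.prems by auto
    have "measure_pmf.prob M (\<Union>t\<in>T u. {\<Gamma>. \<Gamma> u \<inter> t = {}}) \<le> (\<Sum>t\<in>T u. measure_pmf.prob M {\<Gamma>. \<Gamma> u \<inter> t = {}})"
      using T(1)[OF uV] by (intro measure_pmf.finite_measure_subadditive_finite) auto
    also have "\<dots> \<le> (\<Sum>t\<in>T u. (1 - \<delta>) ^ d)"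
    proof (intro sum_mono)
      fix t assume t: "t \<in> T u"
      have "measure_pmf.prob M {\<Gamma>. \<Gamma> u \<inter> t = {}} = measure_pmf.prob (map_pmf (\<lambda>\<Gamma>. \<Gamma> u) M) {X. X \<inter> t = {}}"
        by (simp add: vimage_def)
      also have "map_pmf (\<lambda>\<Gamma>. \<Gamma> u) M = random_neighbors G d u"
        unfolding M_def using finL u by (simp add: Pi_pmf_component)
      also have "measure_pmf.prob (random_neighbors G d u) {X. X \<inter> t = {}} \<le> (1 - \<delta>) ^ d"
        using T(2)[OF uV t] finN by (intro prob_random_neighbors_miss) auto
      finally show "measure_pmf.prob M {\<Gamma>. \<Gamma> u \<inter> t = {}} \<le> (1 - \<delta>) ^ d" .
    qed
    also have "\<dots> = card (T u) * (1 - \<delta>) ^ d"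
      by simp
    also have "\<dots> \<le> \<beta>"
      unfolding \<beta>_def using T(1)[OF uV] \<delta> by (intro mult_right_mono) auto
    finally show "measure_pmf.prob M (\<Union>t\<in>T u. {\<Gamma>. \<Gamma> u \<inter> t = {}}) \<le> \<beta>" .
  qed
  finally have bad: "measure_pmf.prob M Bad \<le> \<beta> * card L"
    by (simp add: mult.commute)
  let ?X = "{R. \<not> (R0 \<subseteq> R \<and> explores T (Suc k) S L R)}"
  have good: "measure_pmf.prob (traverse_levels G d k (S \<union> (\<Union>u\<in>L. \<Gamma> u)) ((\<Union>u\<in>L. \<Gamma> u) - S)
         (R0 \<union> {{u, x} | u x. u \<in> L \<and> x \<in> \<Gamma> u})) ?X \<le> \<beta> * card L * d * (real d + 1) ^ k"
    if \<Gamma>: "\<Gamma> \<in> set_pmf M" "\<Gamma> \<notin> Bad" for \<Gamma>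
  proof -
    let ?S = "S \<union> (\<Union>u\<in>L. \<Gamma> u)" and ?L = "(\<Union>u\<in>L. \<Gamma> u) - S" and ?R = "R0 \<union> {{u, x} | u x. u \<in> L \<and> x \<in> \<Gamma> u}"
    have \<Gamma>u: "\<Gamma> u \<in> set_pmf (random_neighbors G d u)" if "u \<in> L" for u
      using \<Gamma>(1) that finL unfolding M_def by (auto simp: set_Pi_pmf PiE_dflt_def)
    note nb = set_pmf_random_neighbors[OF finN \<Gamma>u]
    have LV: "?L \<subseteq> verts G"
      using nb(1) neighbors_subset_verts[OF G] by blast
    have "card ?L \<le> card (\<Union>u\<in>L. \<Gamma> u)"
      using finL nb(2) by (intro card_mono) auto
    also have "\<dots> \<le> (\<Sum>u\<in>L. card (\<Gamma> u))"
      using finL by (rule card_UN_le)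
    also have "\<dots> \<le> (\<Sum>u\<in>L. d)"
      using nb(3) by (intro sum_mono)
    finally have cL: "card ?L \<le> card L * d"
      by simp
    have "measure_pmf.prob (traverse_levels G d k ?S ?L ?R) ?X
        \<le> measure_pmf.prob (traverse_levels G d k ?S ?L ?R) {R. \<not> (?R \<subseteq> R \<and> explores T k ?S ?L R)}"
    proof (rule measure_pmf.finite_measure_mono)
      show "?X \<subseteq> {R. \<not> (?R \<subseteq> R \<and> explores T k ?S ?L R)}"
      proof clarify
        fix R assume R: "?R \<subseteq> R" "explores T k ?S ?L R" "\<not> (R0 \<subseteq> R \<and> explores T (Suc k) S L R)"
        have "explores T (Suc k) S L R"
          using R(1) \<Gamma>(2) by (intro explores_Suc[OF _ R(2)]) (auto simp: Bad_def)
        then show False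
          using R by blast
      qed
    qed simp
    also have "\<dots> \<le> \<beta> * card ?L * (real d + 1) ^ k"
      unfolding \<beta>_def by (rule Suc.IH[OF LV])
    also have "\<dots> \<le> \<beta> * (card L * d) * (real d + 1) ^ k"
      using cL \<beta>0 by (intro mult_right_mono mult_left_mono) (auto simp flip: of_nat_mult)
    finally show ?thesis
      by (simp add: mult.assoc)
  qed
  have "measure_pmf.prob (traverse_levels G d (Suc k) S L R0) ?X \<le> measure_pmf.prob M Bad + \<beta> * card L * d * (real d + 1) ^ k"
    unfolding traverse_levels.simps M_def[symmetric]
    by (rule prob_bind_pmf_le[OF good]) (use \<beta>0 in auto)
  \<comment> \<open>The current level contributes \<open>1\<close> and the later ones
    \<open>d\<close> times the common factor, which together give one more factor
    \<open>real d + 1\<close>.\<close>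
  also have "\<dots> \<le> \<beta> * card L * (real d + 1) ^ k + \<beta> * card L * d * (real d + 1) ^ k"
  proof -
    have "\<beta> * card L * 1 \<le> \<beta> * card L * (real d + 1) ^ k"
      using \<beta>0 by (intro mult_left_mono one_le_power) auto
    then show ?thesis
      using bad by simp
  qed
  also have "\<dots> = \<beta> * card L * (real d + 1) ^ Suc k"
    by (simp add: algebra_simps)
  finally show ?case
    by (simp add: \<beta>_def)
qed

lemma set_pmf_traverse_levels:
  assumes "simple_graph G" "L \<subseteq> verts G" "R \<in> set_pmf (traverse_levels G d k S L R0)"
  shows "R \<subseteq> R0 \<union> edges G"
  using assms(2,3)
proof (induction k arbitrary: S L R0)
  case (Suc k)
  have finV: "finite (verts G)"
    using assms(1) by (simp add: simple_graph_def)
  have finL: "finite L"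
    using Suc.prems finV finite_subset by blast
  have finN: "finite (neighbors G u)" for u
    using neighbors_subset_verts[OF assms(1)] finV finite_subset by blast
  obtain \<Gamma> where \<Gamma>: "\<Gamma> \<in> set_pmf (Pi_pmf L {} (random_neighbors G d))"
    and R: "R \<in> set_pmf (traverse_levels G d k (S \<union> (\<Union>u\<in>L. \<Gamma> u)) ((\<Union>u\<in>L. \<Gamma> u) - S)
         (R0 \<union> {{u, x} | u x. u \<in> L \<and> x \<in> \<Gamma> u}))"
    using Suc.prems(2) by auto
  have nb: "\<Gamma> u \<subseteq> neighbors G u" if "u \<in> L" for u
    using set_pmf_random_neighbors(1)[OF finN] \<Gamma> that finL by (auto simp: set_Pi_pmf PiE_dflt_def)
  have "(\<Union>u\<in>L. \<Gamma> u) - S \<subseteq> verts G"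
    using nb neighbors_subset_verts[OF assms(1)] by blast
  then have "R \<subseteq> R0 \<union> {{u, x} | u x. u \<in> L \<and> x \<in> \<Gamma> u} \<union> edges G"
    using Suc.IH[OF _ R] by blast
  moreover have "{{u, x} | u x. u \<in> L \<and> x \<in> \<Gamma> u} \<subseteq> edges G"
    using nb by (auto simp: neighbors_def)
  ultimately show ?case
    by blast
qed auto

section \<open>Choice of the parameters and analysis of the tester\<close>

lemma planar_imp_K6_minor_free:
  assumes "simple_graph G" "planar G"
  shows "K6_minor_free G"
  unfolding K6_minor_free_def using planar_no_K6_minor[OF assms] by blast

text \<open>More queries per vertex also enlarge the levels, but only polynomially, while the error
  decays exponentially. With \<open>y\<close> the \<open>l\<close>-th root of \<open>x\<close>, the
  product is \<open>c\<close> times the \<open>l\<close>-th power of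
  \<open>(real d + 1) * y ^ d\<close>, which tends to zero.\<close>

lemma exists_query_degree:
  fixes x c :: real
  assumes "0 \<le> x" "x < 1" "0 < l"
  obtains d :: nat where "0 < d" "c * x ^ d * (real d + 1) ^ l \<le> 1 / 2"
proof -
  define y where "y = root l x"
  have y: "0 \<le> y" "y < 1" "y ^ l = x"
    using assms by (auto simp: y_def)
  have "(\<lambda>d. real d * y ^ d + y ^ d) \<longlonglongrightarrow> 0 + 0"
    using y by (intro tendsto_add powser_times_n_limit_0 LIMSEQ_power_zero) auto
  then have "(\<lambda>d. c * (real d * y ^ d + y ^ d) ^ l) \<longlonglongrightarrow> c * 0 ^ l"
    by (intro tendsto_intros) simp
  moreover have "c * (real d * y ^ d + y ^ d) ^ l = c * x ^ d * (real d + 1) ^ l" for d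
  proof -
    have "(real d * y ^ d + y ^ d) ^ l = ((real d + 1) * y ^ d) ^ l"
      by (simp add: algebra_simps)
    also have "\<dots> = (real d + 1) ^ l * (y ^ l) ^ d"
      by (simp add: power_mult_distrib power_mult[symmetric] mult.commute)
    finally show ?thesis
      by (simp add: y)
  qed
  ultimately have "(\<lambda>d. c * x ^ d * (real d + 1) ^ l) \<longlonglongrightarrow> 0"
    using assms(3) by (simp add: zero_power)
  then have "\<forall>\<^sub>F d in sequentially. c * x ^ d * (real d + 1) ^ l < 1 / 2"
    by (rule order_tendstoD) simp
  then have "\<forall>\<^sub>F d in sequentially. c * x ^ d * (real d + 1) ^ l < 1 / 2 \<and> 0 < d"
    using eventually_gt_at_top[of "0::nat"] by eventually_elim auto
  then obtain d where "c * x ^ d * (real d + 1) ^ l < 1 / 2" "0 < d"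
    using eventually_happens by fastforce
  then show thesis
    by (intro that[of d]) auto
qed

lemma edgeless_connected_graph:
  assumes "simple_graph H" "connected_graph H" "edges H = {}"
  obtains a where "verts H = {a}"
proof -
  obtain a where a: "a \<in> verts H"
    using assms(2) by (auto simp: connected_graph_def)
  have "b = a" if "b \<in> verts H" for b
    using assms(2,3) a that by (auto simp: connected_graph_def elim: rtranclE)
  then show thesis
    using a that by blast
qed

lemma traverse_explores:
  fixes \<delta> :: real and K :: nat
  assumes G: "simple_graph G" "v \<in> verts G"
    and T: "\<And>u. u \<in> verts G \<Longrightarrow> finite (T u) \<and> card (T u) \<le> K"
      "\<And>u t. u \<in> verts G \<Longrightarrow> t \<in> T u \<Longrightarrow> t \<subseteq> neighbors G u \<and> t \<noteq> {} \<and> \<delta> * card (neighbors G u) \<le> card t"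
    and \<delta>: "\<delta> \<le> 1" and d: "K * (1 - \<delta>) ^ d * (real d + 1) ^ l \<le> 1 / 2"
    and good: "\<And>R. explores T l {v} {v} R \<Longrightarrow> P (SGraph (insert v (\<Union>R)) R)"
  shows "1 / 2 \<le> measure_pmf.prob (traverse G v d l) {S. P S}"
proof -
  let ?M = "traverse_levels G d l {v} {v} {}"
  have "measure_pmf.prob ?M {R. \<not> ({} \<subseteq> R \<and> explores T l {v} {v} R)} \<le> K * (1 - \<delta>) ^ d * card {v} * (real d + 1) ^ l"
    using G by (intro prob_traverse_levels_explores T \<delta>) auto
  then have "measure_pmf.prob ?M {R. \<not> explores T l {v} {v} R} \<le> 1 / 2"
    using d by simp
  moreover have "measure_pmf.prob ?M {R. explores T l {v} {v} R} = 1 - measure_pmf.prob ?M {R. \<not> explores T l {v} {v} R}"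
    using measure_pmf.prob_compl[of "{R. \<not> explores T l {v} {v} R}" ?M] by (simp add: Compl_eq[symmetric] Collect_neg_eq)
  moreover have "measure_pmf.prob ?M {R. explores T l {v} {v} R} \<le> measure_pmf.prob ?M {R. P (SGraph (insert v (\<Union>R)) R)}"
    using good by (intro measure_pmf.finite_measure_mono) auto
  ultimately show ?thesis
    by (simp add: traverse_def vimage_def)
qed

text \<open>The three constants are fixed by \<open>H\<close> and \<open>\<epsilon>\<close> before
  \<open>G\<close> is given. The ordering, the coloring and the family of copies occur only in the
  analysis and are unknown to the exploration.\<close>

lemma RLBFS_finds_copy:
  fixes H :: "'b sgraph"
  assumes H: "simple_graph H" "connected_graph H" and \<epsilon>: "0 < \<epsilon>" "\<epsilon> < 1"
  obtains p :: real and d l :: nat where "0 < p" "0 < d" "0 < l"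
    "\<And>G :: 'a sgraph. simple_graph G \<Longrightarrow> verts G \<noteq> {} \<Longrightarrow> planar G \<Longrightarrow> far_from_H_free \<epsilon> G H \<Longrightarrow>
       p \<le> measure_pmf.prob (RLBFS G d l) {S. contains_copy S H}"
proof (cases "edges H = {}")
  case True
  obtain a where a: "verts H = {a}"
    using edgeless_connected_graph[OF H True] .
  \<comment> \<open>The start vertex alone is a copy of the one-vertex graph, so every run
    succeeds.\<close>
  have "contains_copy (SGraph (insert v V) R) H" for v :: 'a and V R
    using a True by (intro is_copy_imp_contains_copy[OF H(1), of _ "\<lambda>_. v"]) (simp add: is_copy_def)
  then have "measure_pmf.prob (RLBFS G 1 1) {S. contains_copy S H} = 1" for G :: "'a sgraph"
    unfolding RLBFS_def traverse_def prob_bind_pmf by simp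
  then show thesis
    by (intro that[of 1 1 1]) auto
next
  case False
  define k e where "k = card (verts H)" and "e = card (edges H)"
  define w where "w = reach_bound k"
  define \<eta> where "\<eta> = \<epsilon> / real (4 * e * k ^ (2 * k) * w)"
  define \<delta> where "\<delta> = \<eta> / real (k * w ^ k)"
  define K where "K = k * (k * w ^ k)"
  \<comment> \<open>The depth required by \<open>explored_contains_copy\<close>.\<close>
  define l where "l = k * (k * k) + 1"
  have "k \<ge> 1"
    using H by (auto simp: k_def connected_graph_def simple_graph_def Suc_le_eq card_gt_0_iff)
  moreover have "e \<ge> 1"
    using False simple_graph_finite_edges[OF H(1)] by (auto simp: e_def Suc_le_eq card_gt_0_iff)
  moreover have "w \<ge> 1"
    by (simp add: w_def reach_bound_def)
  ultimately have pos: "k \<ge> 1" "e \<ge> 1" "w \<ge> 1"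
    by auto
  have \<eta>: "0 < \<eta>" "\<eta> \<le> 1"
  proof -
    have "0 < 4 * e * k ^ (2 * k) * w"
      using pos by (intro mult_pos_pos zero_less_power) auto
    then have D: "1 \<le> real (4 * e * k ^ (2 * k) * w)"
      by (simp only: real_of_nat_ge_one_iff Suc_le_eq One_nat_def)
    show "0 < \<eta>"
      unfolding \<eta>_def using \<epsilon> D by (intro divide_pos_pos) linarith+
    show "\<eta> \<le> 1"
      unfolding \<eta>_def using \<epsilon> D by (subst divide_le_eq_1) linarith
  qed
  have \<delta>: "0 < \<delta>" "\<delta> \<le> 1"
  proof -
    have "0 < k * w ^ k"
      using pos by (intro mult_pos_pos zero_less_power) auto
    then have D: "1 \<le> real (k * w ^ k)"
      by (simp only: real_of_nat_ge_one_iff Suc_le_eq One_nat_def)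
    show "0 < \<delta>"
      unfolding \<delta>_def using \<eta> D by (intro divide_pos_pos) linarith+
    show "\<delta> \<le> 1"
      unfolding \<delta>_def using \<eta> D by (subst divide_le_eq_1) linarith
  qed
  obtain d :: nat where d: "0 < d" "real K * (1 - \<delta>) ^ d * (real d + 1) ^ l \<le> 1 / 2"
    using exists_query_degree[of "1 - \<delta>" l "real K"] \<delta> by (auto simp: l_def)
  \<comment> \<open>The start vertex lies in \<open>X\<close> with probability at least
    \<open>\<eta>\<close>, and from there the exploration succeeds with probability at least one
    half.\<close>
  show thesis
  proof (rule that[of "\<eta> / 2" d l])
    fix G :: "'a sgraph"
    assume G: "simple_graph G" "verts G \<noteq> {}" "planar G" and far: "far_from_H_free \<epsilon> G H"
    have finV: "finite (verts G)"
      using G by (simp add: simple_graph_def)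
    show "\<eta> / 2 \<le> measure_pmf.prob (RLBFS G d l) {S. contains_copy S H}"
    proof (rule robust_family[OF G(1) planar_imp_K6_minor_free[OF G(1,3)] H(1) False far \<epsilon>(1),
          folded k_def e_def, folded w_def, folded \<eta>_def, folded \<delta>_def K_def])
      fix \<rho> and F :: "('b \<Rightarrow> 'a) set" and c
      assume F: "finite F" "\<And>\<phi>. \<phi> \<in> F \<Longrightarrow> is_copy G H \<phi>" "\<And>\<phi> a. \<phi> \<in> F \<Longrightarrow> a \<in> verts H \<Longrightarrow> c (\<phi> a) = a"
        "inj_on \<rho> (verts H)"
        "\<And>\<phi> a b. \<phi> \<in> F \<Longrightarrow> a \<in> verts H \<Longrightarrow> b \<in> verts H \<Longrightarrow> {a, b} \<in> edges H \<Longrightarrow>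
           \<delta> * real (card (neighbors G (\<phi> a))) \<le> real (card (target H \<rho> F \<phi> a b))"
        "\<And>u. u \<in> verts G \<Longrightarrow> finite (targets H \<rho> F u) \<and> card (targets H \<rho> F u) \<le> K"
        "\<eta> * real (card (verts G)) \<le> real (card (\<Union>\<phi>\<in>F. \<phi> ` verts H))"
      define X where "X = (\<Union>\<phi>\<in>F. \<phi> ` verts H)"
      have XV: "X \<subseteq> verts G"
        using F(2) by (auto simp: X_def is_copy_def)
      have T2: "t \<subseteq> neighbors G u \<and> t \<noteq> {} \<and> \<delta> * card (neighbors G u) \<le> card t"
        if "t \<in> targets H \<rho> F u" for u t
      proof -
        obtain \<phi> a b where t: "t = target H \<rho> F \<phi> a b" "\<phi> \<in> F" "a \<in> verts H" "b \<in> verts H" "{a, b} \<in> edges H" "\<phi> a = u"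
          using \<open>t \<in> targets H \<rho> F u\<close> by (auto simp: targets_def)
        have "\<psi> b \<in> neighbors G u" if "\<psi> \<in> F" "\<forall>d\<in>ancestors H \<rho> a. \<psi> d = \<phi> d" for \<psi>
        proof -
          have "\<psi> ` {a, b} \<in> edges G"
            using F(2)[OF that(1)] t(5) unfolding is_copy_def by blast
          moreover have "\<psi> a = u"
            using that(2) t(6) ancestors_refl[OF t(3)] by auto
          ultimately show ?thesis
            by (simp add: neighbors_def)
        qed
        then have "t \<subseteq> neighbors G u"
          by (auto simp: t(1) target_def)
        moreover have "t \<noteq> {}"
          using t(2) by (auto simp: t(1) target_def)
        ultimately show ?thesis
          using F(5)[OF t(2-5)] t(1,6) by simp
      qed
      have "1 / 2 \<le> measure_pmf.prob (traverse G v d l) {S. contains_copy S H}" if v: "v \<in> X" for v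
      proof (rule traverse_explores[OF G(1) _ F(6) T2 \<delta>(2) d(2)])
        show "v \<in> verts G"
          using v XV by auto
        fix R assume R: "explores (targets H \<rho> F) l {v} {v} R"
        obtain \<phi> where \<phi>: "\<phi> \<in> F" "v \<in> \<phi> ` verts H"
          using v by (auto simp: X_def)
        show "contains_copy (SGraph (insert v (\<Union>R)) R) H"
          by (rule explored_contains_copy[where G = G and F = F and c = c and \<rho> = \<rho>])
            (use H False F(2-4) \<phi> R in \<open>auto simp: l_def k_def\<close>)
      qed
      then have "measure_pmf.prob (pmf_of_set (verts G)) X * (1 / 2) \<le> measure_pmf.prob (RLBFS G d l) {S. contains_copy S H}"
        unfolding RLBFS_def by (rule prob_bind_pmf_ge)
      moreover have "\<eta> \<le> measure_pmf.prob (pmf_of_set (verts G)) X"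
      proof -
        have "verts G \<inter> X = X" "0 < real (card (verts G))"
          using XV G(2) finV by (auto simp: card_gt_0_iff)
        then show ?thesis
          using F(7) G(2) finV by (simp add: measure_pmf_of_set pos_le_divide_eq X_def)
      qed
      ultimately show "\<eta> / 2 \<le> measure_pmf.prob (RLBFS G d l) {S. contains_copy S H}"
        by simp
    qed
  qed (use \<eta> d in \<open>auto simp: l_def\<close>)
qed

lemma prob_repetitions_reject:
  assumes p: "p \<le> measure_pmf.prob (RLBFS G (h \<epsilon> H) (g \<epsilon> H)) {S. contains_copy S H}"
  shows "1 - (1 - p) ^ f \<epsilon> H \<le> pmf (RBE f g h G H \<epsilon>) Reject"
proof -
  let ?M = "RLBFS G (h \<epsilon> H) (g \<epsilon> H)" and ?C = "{S. contains_copy S H}"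
  have "pmf (RBE f g h G H \<epsilon>) Reject = measure_pmf.prob (replicate_pmf (f \<epsilon> H) ?M) (- {Ss. set Ss \<inter> ?C = {}})"
    unfolding RBE_def pmf_map by (intro arg_cong2[where f = measure]) (auto split: if_splits)
  also have "\<dots> = 1 - measure_pmf.prob ?M (- ?C) ^ f \<epsilon> H"
    using measure_pmf.prob_compl[of "{Ss. set Ss \<inter> ?C = {}}" "replicate_pmf (f \<epsilon> H) ?M"]
    by (simp add: prob_replicate_pmf_avoids Compl_eq_Diff_UNIV)
  also have "measure_pmf.prob ?M (- ?C) = 1 - measure_pmf.prob ?M ?C"
    using measure_pmf.prob_compl[of ?C ?M] by (simp add: Compl_eq_Diff_UNIV)
  finally have "pmf (RBE f g h G H \<epsilon>) Reject = 1 - (1 - measure_pmf.prob ?M ?C) ^ f \<epsilon> H" .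
  moreover have "(1 - measure_pmf.prob ?M ?C) ^ f \<epsilon> H \<le> (1 - p) ^ f \<epsilon> H"
    using p by (intro power_mono) auto
  ultimately show ?thesis
    by simp
qed

text \<open>A returned subgraph consists of vertices and edges of \<open>G\<close>, so every copy in
  it is a copy in \<open>G\<close>: the error is one-sided.\<close>

lemma H_free_imp_accept:
  assumes G: "simple_graph G" "verts G \<noteq> {}" and free: "H_free G H"
  shows "pmf (RBE f g h G H \<epsilon>) Accept = 1"
proof -
  have finV: "finite (verts G)"
    using G by (simp add: simple_graph_def)
  have "\<not> contains_copy S H" if S_in: "S \<in> set_pmf (RLBFS G d l)" for S d l
  proof
    assume copy: "contains_copy S H"
    obtain v R where v: "v \<in> verts G" and R: "R \<in> set_pmf (traverse_levels G d l {v} {v} {})"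
      and S: "S = SGraph (insert v (\<Union>R)) R"
      using S_in set_pmf_of_set[OF G(2) finV] unfolding RLBFS_def traverse_def by auto
    have "R \<subseteq> edges G"
      using set_pmf_traverse_levels[OF G(1) _ R] v by auto
    then have "verts S \<subseteq> verts G" "edges S \<subseteq> edges G"
      using v G(1) by (auto simp: S simple_graph_def)
    then have "contains_copy G H"
      using copy unfolding contains_copy_def subgraph_def by blast
    then show False
      using free by (simp add: H_free_def)
  qed
  then have "RBE f g h G H \<epsilon> = map_pmf (\<lambda>_. Accept) (replicate_pmf (f \<epsilon> H) (RLBFS G (h \<epsilon> H) (g \<epsilon> H)))"
    unfolding RBE_def by (intro map_pmf_cong refl) (auto simp: set_replicate_pmf)
  then show ?thesis
    by simp
qed

theorem theorem3p1:
  "\<exists>f g h :: real \<Rightarrow> 'b sgraph \<Rightarrow> nat.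
     (\<forall>\<epsilon> H. 0 < f \<epsilon> H \<and> 0 < g \<epsilon> H \<and> 0 < h \<epsilon> H) \<and>
     (\<forall>H :: 'b sgraph. simple_graph H \<and> connected_graph H \<longrightarrow>
       (\<forall>\<epsilon>::real. 0 < \<epsilon> \<and> \<epsilon> < 1 \<longrightarrow>
         (\<forall>(n::nat) (G :: nat sgraph).
            1 \<le> n \<and> verts G = {1..n} \<and> simple_graph G \<and> planar G \<longrightarrow>
            (H_free G H \<longrightarrow> pmf (RBE f g h G H \<epsilon>) Accept = 1) \<and>
            (far_from_H_free \<epsilon> G H \<longrightarrow> pmf (RBE f g h G H \<epsilon>) Reject \<ge> 0.99))))"
proof -
  \<comment> \<open>All requirements on the three parameters at a single pair of arguments, so that
    the functions can be chosen pointwise.\<close>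
  define works where "works \<epsilon> H m l d \<longleftrightarrow> 0 < m \<and> 0 < l \<and> 0 < d \<and>
      (simple_graph H \<and> connected_graph H \<and> 0 < \<epsilon> \<and> \<epsilon> < 1 \<longrightarrow>
        (\<exists>p. (1 - p) ^ m \<le> 0.01 \<and> (\<forall>G :: nat sgraph. simple_graph G \<longrightarrow> verts G \<noteq> {} \<longrightarrow> planar G \<longrightarrow> far_from_H_free \<epsilon> G H \<longrightarrow>
           p \<le> measure_pmf.prob (RLBFS G d l) {S. contains_copy S H})))"
    for \<epsilon> :: real and H :: "'b sgraph" and m l d :: nat
  have "\<exists>m l d. works \<epsilon> H m l d" for \<epsilon> H
  proof (cases "simple_graph H \<and> connected_graph H \<and> 0 < \<epsilon> \<and> \<epsilon> < 1")
    case True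
    then obtain p :: real and d l :: nat where p: "0 < p" "0 < d" "0 < l"
      "\<And>G :: nat sgraph. simple_graph G \<Longrightarrow> verts G \<noteq> {} \<Longrightarrow> planar G \<Longrightarrow> far_from_H_free \<epsilon> G H \<Longrightarrow>
         p \<le> measure_pmf.prob (RLBFS G d l) {S. contains_copy S H}"
      using RLBFS_finds_copy[of H \<epsilon>, where ?'a = nat] by metis
    \<comment> \<open>\<open>p\<close> is only known to be positive; the cap keeps
      \<open>1 - q\<close> at least one half and below one.\<close>
    define q where "q = min p (1 / 2)"
    obtain m where m: "(1 - q) ^ m < 0.01"
      using real_arch_pow_inv[of "0.01" "1 - q"] p(1) by (auto simp: q_def)
    then have "0 < m"
      by (cases m) auto
    moreover have "q \<le> measure_pmf.prob (RLBFS G d l) {S. contains_copy S H}"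
      if "simple_graph G" "verts G \<noteq> {}" "planar G" "far_from_H_free \<epsilon> G H" for G :: "nat sgraph"
      using p(4)[OF that] by (simp add: q_def)
    ultimately have "works \<epsilon> H m l d"
      unfolding works_def using p(2,3) m by (intro conjI impI exI[of _ q] allI) auto
    then show ?thesis
      by blast
  next
    case False
    \<comment> \<open>Outside the admissible arguments the value one keeps the three functions
      positive.\<close>
    then have "works \<epsilon> H 1 1 1"
      by (auto simp: works_def)
    then show ?thesis
      by blast
  qed
  then obtain f g h where fgh: "\<And>\<epsilon> H. works \<epsilon> H (f \<epsilon> H) (g \<epsilon> H) (h \<epsilon> H)"
    by metis
  show ?thesis
  proof (intro exI conjI allI impI)
    show "0 < f \<epsilon> H" "0 < g \<epsilon> H" "0 < h \<epsilon> H" for \<epsilon> H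
      using fgh[of \<epsilon> H] by (auto simp: works_def)
    fix H :: "'b sgraph" and \<epsilon> :: real and n :: nat and G :: "nat sgraph"
    assume H: "simple_graph H \<and> connected_graph H" and \<epsilon>: "0 < \<epsilon> \<and> \<epsilon> < 1"
      and G: "1 \<le> n \<and> verts G = {1..n} \<and> simple_graph G \<and> planar G"
    have ne: "verts G \<noteq> {}"
      using G by auto
    show "pmf (RBE f g h G H \<epsilon>) Accept = 1" if "H_free G H"
      using H_free_imp_accept[of G H] G ne that by blast
    show "0.99 \<le> pmf (RBE f g h G H \<epsilon>) Reject" if far: "far_from_H_free \<epsilon> G H"
    proof -
      obtain p where p: "(1 - p) ^ f \<epsilon> H \<le> 0.01" "p \<le> measure_pmf.prob (RLBFS G (h \<epsilon> H) (g \<epsilon> H)) {S. contains_copy S H}"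
        using fgh[of \<epsilon> H] H \<epsilon> G ne far unfolding works_def by blast
      show ?thesis
        using prob_repetitions_reject[of p G h \<epsilon> H g f] p by simp
    qed
  qed
qed

end
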